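(* Let $|q|<1$ and $x\in\mathbb{C}^*$ such that all quantities below are defined. Then \[ \frac{x}{x-1}K_c(x,q)+\Bigl(1-\frac{1}{xq}\Bigr)K_{1,c}(xq,q)=\frac{j\bigl(xq^2;q^2\bigr)}{J_1}, \] \begin{align*} &\frac{J_1j\bigl(-xq;q^2\bigr)}{x-1}K_{c}(x,q)+\frac{2qJ_4j\bigl(x;q^2\bigr)}{x}g_{2,c}\bigl(-xq,q^2\bigr)\\ &\quad=\frac{2qJ_4^5j\bigl(x;q^2\bigr)}{xJ_2^2 j\bigl(x^2q^2;q^4\bigr)} -\frac{J_4^{11}j\bigl(x;q^2\bigr)j\bigl(-x^2q^2;q^4\bigr)}{x^2J_2^4J_8^4j\bigl(x^2q^2;q^4\bigr)j\bigl(-x^2q^4;q^4\bigr)} +\frac{J_4^5j\bigl(x;q^2\bigr)j\bigl(-xq;q^2\bigr)}{x^2J_8^2j\bigl(xq;q^2\bigr)j\bigl(-x^2q^4;q^4\bigr)} -\frac{J_1^5j\bigl(-xq;q^2\bigr)}{J_2^2j(x;q)}, \end{align*} and \begin{align*} &2xJ_4^2j\bigl(xq;q^2\bigr)S_{2,c}\bigl(x^2,q^2\bigr)-qJ_2^2j\bigl(x^2q^2;q^4\bigr)g_{3,c}\bigl(xq,q^2\bigr)\\ &\quad=\frac{xJ_4^{12}j\bigl(xq;q^2\bigr)j\bigl(-x^2q^2;q^4\bigr)}{J_2^4J_8^4j\bigl(x^2q^2;q^4\bigr)j\bigl(-x^2;q^4\bigr)} -\frac{xJ_2^5j\bigl(x^2q^2;q^4\bigr)j\bigl(-xq;q^2\bigr)^2}{2J_4^2j\bigl(-x^2;q^2\bigr)j\bigl(xq;q^2\bigr)}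 -\frac{xJ_2^5j\bigl(xq;q^2\bigr)j\bigl(x^2q^2;q^4\bigr)}{2J_4^2j\bigl(-x^2;q^2\bigr)}. \end{align*}
   Context: For $n\in\mathbb{Z}\cup\{\infty\}$: $(a;q)_\infty=\prod_{j\ge0}(1-aq^j)$, $(a;q)_n=(a;q)_\infty/(aq^n;q)_\infty$ (also for negative $n$), $(a_1,\dots,a_m;q)_n=\prod_i(a_i;q)_n$. $j(z;q)=(z,q/z,q;q)_\infty$, $J_m=(q^m;q^m)_\infty$. Bilateral series (sums over all $n\in\mathbb{Z}$): $K_c(x,q)=\sum_n\frac{(-1)^n(q;q^2)_nq^{n^2}}{(xq^2,q^2/x;q^2)_n}$, $K_{1,c}(x,q)=\sum_n\frac{(-1)^n(q;q^2)_nq^{(n+1)^2}}{(xq,q/x;q^2)_{n+1}}$, $g_{2,c}(x,q)=\sum_n\frac{(-q;q)_nq^{n(n+1)/2}}{(x,q/x;q)_{n+1}}$, $g_{3,c}(x,q)=\sum_n\frac{q^{n^2+n}}{(x,q/x;q)_{n+1}}$, $S_{2,c}(x,q)=(1+1/x)\sum_n\frac{(-q;q)_{2n}q^{n+1}}{(xq,q/x;q^2)_{n+1}}$. *)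

theory Defs
  imports "HOL-Analysis.Analysis"
begin

definition qpoch_inf :: "complex \<Rightarrow> complex \<Rightarrow> complex" where
  "qpoch_inf a q = (\<Prod>j. 1 - a * q ^ j)"

text \<open>
  The finite symbol is the quotient of infinite products, for every integer index.
  Since division by zero yields zero, \<open>qpoch a q n \<noteq> 0\<close> holds exactly if both
  infinite products are nonzero, i.e. if \<open>1 / qpoch a q n\<close> is genuinely defined.
\<close>
definition qpoch :: "complex \<Rightarrow> complex \<Rightarrow> int \<Rightarrow> complex" where
  "qpoch a q n = qpoch_inf a q / qpoch_inf (a * q powi n) q"

definition jtheta :: "complex \<Rightarrow> complex \<Rightarrow> complex" where
  "jtheta z q = qpoch_inf z q * qpoch_inf (q / z) q * qpoch_inf q q"

definition J :: "nat \<Rightarrow> complex \<Rightarrow> complex" where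
  "J m q = qpoch_inf (q ^ m) (q ^ m)"

definition K_c :: "complex \<Rightarrow> complex \<Rightarrow> complex" where
  "K_c x q = (\<Sum>\<^sub>\<infinity>n::int\<in>UNIV. (-1) powi n * qpoch q (q^2) n * q powi (n^2)
     / (qpoch (x * q^2) (q^2) n * qpoch (q^2 / x) (q^2) n))"

definition K1_c :: "complex \<Rightarrow> complex \<Rightarrow> complex" where
  "K1_c x q = (\<Sum>\<^sub>\<infinity>n::int\<in>UNIV. (-1) powi n * qpoch q (q^2) n * q powi ((n + 1)^2)
     / (qpoch (x * q) (q^2) (n + 1) * qpoch (q / x) (q^2) (n + 1)))"

definition g2_c :: "complex \<Rightarrow> complex \<Rightarrow> complex" where
  "g2_c x q = (\<Sum>\<^sub>\<infinity>n::int\<in>UNIV. qpoch (-q) q n * q powi (n * (n + 1) div 2)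
     / (qpoch x q (n + 1) * qpoch (q / x) q (n + 1)))"

definition g3_c :: "complex \<Rightarrow> complex \<Rightarrow> complex" where
  "g3_c x q = (\<Sum>\<^sub>\<infinity>n::int\<in>UNIV. q powi (n^2 + n)
     / (qpoch x q (n + 1) * qpoch (q / x) q (n + 1)))"

definition S2_c :: "complex \<Rightarrow> complex \<Rightarrow> complex" where
  "S2_c x q = (1 + 1 / x) * (\<Sum>\<^sub>\<infinity>n::int\<in>UNIV. qpoch (-q) q (2 * n) * q powi (n + 1)
     / (qpoch (x * q) (q^2) (n + 1) * qpoch (q / x) (q^2) (n + 1)))"

text \<open>
  Nonvanishing of the denominators of all terms. The numerator symbols are
  defined whenever \<open>0 < norm q < 1\<close>, and the series then converge absolutely,
  so no summability condition is needed.
\<close>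
definition K_c_defined :: "complex \<Rightarrow> complex \<Rightarrow> bool" where
  "K_c_defined x q \<longleftrightarrow> (\<forall>n::int. qpoch (x * q^2) (q^2) n * qpoch (q^2 / x) (q^2) n \<noteq> 0)"

definition K1_c_defined :: "complex \<Rightarrow> complex \<Rightarrow> bool" where
  "K1_c_defined x q \<longleftrightarrow> (\<forall>n::int. qpoch (x * q) (q^2) (n + 1) * qpoch (q / x) (q^2) (n + 1) \<noteq> 0)"

definition g2_c_defined :: "complex \<Rightarrow> complex \<Rightarrow> bool" where
  "g2_c_defined x q \<longleftrightarrow> (\<forall>n::int. qpoch x q (n + 1) * qpoch (q / x) q (n + 1) \<noteq> 0)"

definition g3_c_defined :: "complex \<Rightarrow> complex \<Rightarrow> bool" where
  "g3_c_defined x q \<longleftrightarrow> (\<forall>n::int. qpoch x q (n + 1) * qpoch (q / x) q (n + 1) \<noteq> 0)"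

definition S2_c_defined :: "complex \<Rightarrow> complex \<Rightarrow> bool" where
  "S2_c_defined x q \<longleftrightarrow> (\<forall>n::int. qpoch (x * q) (q^2) (n + 1) * qpoch (q / x) (q^2) (n + 1) \<noteq> 0)"

end

theory Submission
  imports Defs "HOL-Complex_Analysis.Complex_Analysis"
begin

text \<open>
  Multiplied by a theta function, each of the series becomes a function holomorphic on the punctured
  plane; telescoping shows that it satisfies a first-order inhomogeneous \<open>q\<close>-difference equation in \<open>x\<close>.
  The first identity is itself such a telescoped sum. In the other two the inhomogeneous parts of the
  two series cancel, so the difference of the two sides, cleared of denominators, is a function \<open>E\<close>
  holomorphic on the punctured plane with \<open>E (q\<^sup>2 * x) = C * x powi -4 * E x\<close>. Such a function vanishes once it
  has more than four zeros modulo \<open>q\<^sup>2\<close>. Five zeros are found by evaluating theta functions at special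
  points, where the values of the series are given by the \<open>q\<close>-Gauss sum.
\<close>

section \<open>Infinite products and theta functions\<close>

text \<open>No closed form is available for the series at a general point, so a zero of
  \<open>E\<close> can be certified only where each series is either evaluable or multiplied by a
  vanishing theta factor. A bilateral series becomes one-sided, and summable by q-Gauss, when its
  argument \<open>y\<close> is 1; this dictates the points 1 and -1/q in the second identity, and
  1/q and -1/q in the third. At one further point, \<open>\<i>\<close> respectively
  \<open>\<i> * q\<close>, theta factors remove both series. These are three points, but two of them
  are fixed by an inversion respected by \<open>E\<close> and count twice. Four zeros are what the
  exponent -4 permits: dividing by a theta function with a matching zero raises the exponent by one,
  and exponent 1 leaves only the zero function. The common form of the series has term ratio
  \<open>(\<alpha> - p powi (n + 1)) * (\<beta> - p powi (n + 1))\<close>. This polynomial form,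
  unlike the usual hypergeometric one with parameters p/\<alpha> and p/\<beta>, includes \<alpha> =
  0 and \<beta> = 0. The price of working without poles is that the infinite products grow as n
  tends to minus infinity, so convergence there has to come from a recurrence.\<close>

lemma summable_norm_geometric_mult:
  fixes a q :: complex
  assumes "norm q < 1"
  shows "summable (\<lambda>n. norm (a * q ^ n))"
  using assms by (simp add: norm_mult norm_power)

lemma qpoch_inf_convergent_prod:
  fixes a q :: complex
  assumes "norm q < 1"
  shows "convergent_prod (\<lambda>n. 1 - a * q ^ n)"
  by (rule abs_convergent_prod_imp_convergent_prod, rule summable_imp_abs_convergent_prod)
     (use summable_norm_geometric_mult[OF assms, of a] in simp)

lemma qpoch_inf_LIMSEQ:
  assumes "norm q < 1"
  shows "(\<lambda>n. \<Prod>k<n. 1 - a * q ^ k) \<longlonglongrightarrow> qpoch_inf a q"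
  using convergent_prod_LIMSEQ[OF qpoch_inf_convergent_prod[OF assms, of a]]
  unfolding qpoch_inf_def LIMSEQ_lessThan_iff_atMost .

lemma qpoch_inf_eqI:
  assumes "norm q < 1" "(\<lambda>n. \<Prod>k<n. 1 - a * q ^ k) \<longlonglongrightarrow> L"
  shows "qpoch_inf a q = L"
  using LIMSEQ_unique qpoch_inf_LIMSEQ assms by blast

lemma qpoch_inf_zero [simp]: "qpoch_inf 0 q = 1"
  by (simp add: qpoch_inf_def)

lemma qpoch_inf_rec:
  assumes "norm q < 1"
  shows "qpoch_inf a q = (1 - a) * qpoch_inf (a * q) q"
proof (rule qpoch_inf_eqI[OF assms])
  have "(\<lambda>n. (1 - a) * (\<Prod>k<n. 1 - a * q * q ^ k)) \<longlonglongrightarrow> (1 - a) * qpoch_inf (a * q) q"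
    by (intro tendsto_intros qpoch_inf_LIMSEQ assms)
  also have "(\<lambda>n. (1 - a) * (\<Prod>k<n. 1 - a * q * q ^ k)) = (\<lambda>n. \<Prod>k<Suc n. 1 - a * q ^ k)"
    by (simp only: prod.lessThan_Suc_shift) (simp add: mult_ac)
  finally show "(\<lambda>n. \<Prod>k<n. 1 - a * q ^ k) \<longlonglongrightarrow> (1 - a) * qpoch_inf (a * q) q"
    by (rule LIMSEQ_imp_Suc)
qed

lemma qpoch_inf_nonzero:
  assumes "norm q < 1" "\<And>n. a * q ^ n \<noteq> 1"
  shows "qpoch_inf a q \<noteq> 0"
  unfolding qpoch_inf_def
  by (rule prodinf_nonzero[OF qpoch_inf_convergent_prod[OF assms(1)]]) (use assms(2) in auto)

lemma qpoch_inf_nonzero':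
  assumes "norm q < 1" "norm a < 1"
  shows "qpoch_inf a q \<noteq> 0"
proof (rule qpoch_inf_nonzero[OF assms(1)])
  fix n
  have "norm (a * q ^ n) \<le> norm a * 1"
    unfolding norm_mult norm_power by (intro mult_left_mono power_le_one) (use assms in auto)
  with assms show "a * q ^ n \<noteq> 1" by auto
qed

text \<open>The bound is uniform in \<open>n\<close>: the majorant of the bilateral series needs it
  for finite products, which occur at negative indices, as well as for infinite ones.\<close>

lemma norm_prod_qpoch_le:
  fixes a q :: complex
  assumes "norm q < 1"
  shows "norm (\<Prod>k<n. 1 - a * q ^ k) \<le> exp (norm a / (1 - norm q))"
proof -
  have "norm (\<Prod>k<n. 1 - a * q ^ k) \<le> (\<Prod>k<n. exp (norm a * norm q ^ k))"
    unfolding prod_norm[symmetric]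
  proof (intro prod_mono conjI)
    fix k
    have "norm (1 - a * q ^ k) \<le> 1 + norm a * norm q ^ k"
      using norm_triangle_ineq4[of 1 "a * q ^ k"] by (simp add: norm_mult norm_power)
    also have "\<dots> \<le> exp (norm a * norm q ^ k)"
      by (rule exp_ge_add_one_self)
    finally show "norm (1 - a * q ^ k) \<le> exp (norm a * norm q ^ k)" .
  qed simp
  also have "\<dots> = exp (norm a * (\<Sum>k<n. norm q ^ k))"
    by (simp add: exp_sum sum_distrib_left)
  also have "(\<Sum>k<n. norm q ^ k) \<le> (\<Sum>k. norm q ^ k)"
    by (rule sum_le_suminf) (use assms in auto)
  also have "\<dots> = 1 / (1 - norm q)"
    using assms by (simp add: suminf_geometric)
  finally show ?thesis by (simp add: mult_left_mono)
qed

lemma norm_qpoch_inf_le: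
  assumes "norm q < 1"
  shows "norm (qpoch_inf a q) \<le> exp (norm a / (1 - norm q))"
  by (rule LIMSEQ_le_const2[OF tendsto_norm[OF qpoch_inf_LIMSEQ[OF assms]]])
     (use norm_prod_qpoch_le[OF assms] in blast)

lemma qpoch_inf_uniform_limit:
  assumes "norm q < 1"
  shows "uniform_limit (cball z r) (\<lambda>n a. \<Prod>k<n. 1 - a * q ^ k) (\<lambda>a. qpoch_inf a q) sequentially"
proof -
  have "uniformly_convergent_on (cball z r) (\<lambda>n a. \<Prod>k<n. 1 - a * q ^ k)"
  proof (rule uniformly_convergent_on_prod')
    show "uniformly_convergent_on (cball z r) (\<lambda>N x. \<Sum>n<N. norm (1 - x * q ^ n - 1))"
    proof (rule Weierstrass_m_test')
      fix n x assume "x \<in> cball z r"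
      then have "norm x \<le> norm z + r"
        using norm_triangle_ineq2[of x z] by (auto simp: dist_norm norm_minus_commute)
      then show "norm (norm (1 - x * q ^ n - 1)) \<le> (norm z + r) * norm q ^ n"
        by (simp add: norm_mult norm_power mult_right_mono)
    qed (use assms in auto)
  qed (auto intro!: continuous_intros)
  then obtain l where l: "uniform_limit (cball z r) (\<lambda>n a. \<Prod>k<n. 1 - a * q ^ k) l sequentially"
    unfolding uniformly_convergent_on_def by blast
  have "l a = qpoch_inf a q" if "a \<in> cball z r" for a
    using qpoch_inf_eqI[OF assms tendsto_uniform_limitI[OF l that]] by simp
  then show ?thesis
    by (intro uniform_limit_cong'[THEN iffD1, OF _ _ l]) auto
qed

lemma qpoch_inf_holomorphic:
  assumes "norm q < 1"
  shows "(\<lambda>a. qpoch_inf a q) holomorphic_on A"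
proof (rule holomorphic_on_subset[OF _ subset_UNIV])
  show "(\<lambda>a. qpoch_inf a q) holomorphic_on UNIV"
  proof (rule holomorphic_uniform_sequence)
    fix x :: complex
    show "\<exists>d>0. cball x d \<subseteq> UNIV \<and>
        uniform_limit (cball x d) (\<lambda>n a. \<Prod>k<n. 1 - a * q ^ k) (\<lambda>a. qpoch_inf a q) sequentially"
      using qpoch_inf_uniform_limit[OF assms, of x 1] by (intro exI[of _ 1]) auto
  qed (auto intro!: holomorphic_intros)
qed

lemma qpoch_inf_holomorphic' [holomorphic_intros]:
  assumes "norm q < 1" "f holomorphic_on A"
  shows "(\<lambda>z. qpoch_inf (f z) q) holomorphic_on A"
  using holomorphic_on_compose[OF assms(2) qpoch_inf_holomorphic[OF assms(1)]]
  by (simp add: o_def)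

lemma qpoch_inf_mult_minus:
  assumes "norm q < 1"
  shows "qpoch_inf a q * qpoch_inf (- a) q = qpoch_inf (a\<^sup>2) (q\<^sup>2)"
proof (rule qpoch_inf_eqI[symmetric])
  have "(\<lambda>n. (\<Prod>k<n. 1 - a * q ^ k) * (\<Prod>k<n. 1 - (- a) * q ^ k))
      \<longlonglongrightarrow> qpoch_inf a q * qpoch_inf (- a) q"
    by (intro tendsto_mult qpoch_inf_LIMSEQ assms)
  also have "(\<lambda>n. (\<Prod>k<n. 1 - a * q ^ k) * (\<Prod>k<n. 1 - (- a) * q ^ k))
      = (\<lambda>n. \<Prod>k<n. 1 - a\<^sup>2 * (q\<^sup>2) ^ k)"
    unfolding prod.distrib[symmetric]
    by (intro ext prod.cong refl) (simp add: power2_eq_square algebra_simps power_mult_distrib)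
  finally show "(\<lambda>n. \<Prod>k<n. 1 - a\<^sup>2 * (q\<^sup>2) ^ k) \<longlonglongrightarrow> qpoch_inf a q * qpoch_inf (- a) q" .
  show "norm (q\<^sup>2) < 1"
    using assms by (simp add: norm_power power_less_one_iff)
qed

lemma qpoch_inf_split_even_odd:
  assumes "norm q < 1"
  shows "qpoch_inf a q = qpoch_inf a (q\<^sup>2) * qpoch_inf (a * q) (q\<^sup>2)"
proof -
  have q2: "norm (q\<^sup>2) < 1"
    using assms by (simp add: norm_power power_less_one_iff)
  have "(\<lambda>n. (\<Prod>k<n. 1 - a * (q\<^sup>2) ^ k) * (\<Prod>k<n. 1 - a * q * (q\<^sup>2) ^ k))
      \<longlonglongrightarrow> qpoch_inf a (q\<^sup>2) * qpoch_inf (a * q) (q\<^sup>2)"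
    by (intro tendsto_mult qpoch_inf_LIMSEQ q2)
  moreover have "(\<Prod>k<n. 1 - a * (q\<^sup>2) ^ k) * (\<Prod>k<n. 1 - a * q * (q\<^sup>2) ^ k) = (\<Prod>k<2 * n. 1 - a * q ^ k)" for n
    by (induction n) (simp_all add: mult_ac flip: power_mult)
  moreover have "(\<lambda>n. \<Prod>k<2 * n. 1 - a * q ^ k) \<longlonglongrightarrow> qpoch_inf a q"
    using LIMSEQ_subseq_LIMSEQ[OF qpoch_inf_LIMSEQ[OF assms, of a], of "\<lambda>n. 2 * n"]
    by (simp add: o_def strict_mono_def)
  ultimately show ?thesis
    using LIMSEQ_unique by simp
qed

section \<open>Theta functions: functional equations and simplicity of the zeros\<close>

lemma jtheta_expand:
  assumes "norm q < 1"
  shows "jtheta z q = (1 - z) * (qpoch_inf (z * q) q * qpoch_inf (q / z) q * qpoch_inf q q)"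
  unfolding jtheta_def by (subst (1) qpoch_inf_rec[OF assms]) simp

lemma jtheta_shift:
  assumes "norm q < 1" "q \<noteq> 0" "z \<noteq> 0"
  shows "jtheta (q * z) q = - jtheta z q / z"
proof -
  have "jtheta (q * z) q = qpoch_inf (z * q) q * qpoch_inf (1 / z) q * qpoch_inf q q"
    using assms by (simp add: jtheta_def mult_ac)
  also have "qpoch_inf (1 / z) q = (1 - 1 / z) * qpoch_inf (q / z) q"
    by (subst qpoch_inf_rec[OF assms(1)]) simp
  finally show ?thesis
    using assms by (simp add: jtheta_expand[of q z] field_simps)
qed

lemma jtheta_reflect: "q \<noteq> 0 \<Longrightarrow> z \<noteq> 0 \<Longrightarrow> jtheta (q / z) q = jtheta z q"
  by (simp add: jtheta_def mult_ac)

lemma jtheta_inverse: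
  assumes "norm q < 1" "q \<noteq> 0" "z \<noteq> 0"
  shows "jtheta (1 / z) q = - jtheta z q / z"
  using jtheta_reflect[of q "q * z"] jtheta_shift[OF assms] assms by simp

lemma jtheta_one: "norm q < 1 \<Longrightarrow> jtheta 1 q = 0"
  by (simp add: jtheta_expand)

lemma jtheta_eq_0D:
  assumes "norm q < 1" "q \<noteq> 0" "z \<noteq> 0" "jtheta z q = 0"
  shows "\<exists>k::int. z = q powi k"
proof -
  have "qpoch_inf q q \<noteq> 0"
    using assms by (intro qpoch_inf_nonzero') auto
  then consider "qpoch_inf z q = 0" | "qpoch_inf (q / z) q = 0"
    using assms(4) by (auto simp: jtheta_def)
  then show ?thesis
  proof cases
    case 1
    then obtain n where "z * q ^ n = 1"
      using qpoch_inf_nonzero[OF assms(1)] by blast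
    then have "z = q powi (- int n)"
      using assms by (simp add: power_int_minus field_simps)
    then show ?thesis by blast
  next
    case 2
    then obtain n where "q / z * q ^ n = 1"
      using qpoch_inf_nonzero[OF assms(1)] by blast
    then have "z = q powi (int (Suc n))"
      using assms by (simp only: power_int_of_nat) (simp add: field_simps)
    then show ?thesis by blast
  qed
qed

lemma jtheta_holomorphic [holomorphic_intros]:
  assumes "norm q < 1" "f holomorphic_on A" "\<And>z. z \<in> A \<Longrightarrow> f z \<noteq> 0"
  shows "(\<lambda>z. jtheta (f z) q) holomorphic_on A"
  unfolding jtheta_def by (intro holomorphic_intros assms)

lemma jtheta_differentiable:
  assumes "norm q < 1" "z \<noteq> 0"
  shows "(\<lambda>z. jtheta z q) field_differentiable at z"
  by (rule holomorphic_on_imp_differentiable_at[of _ "- {0}"])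
     (use assms in \<open>auto intro!: holomorphic_intros\<close>)

lemma qpoch_inf_self_nonzero: "norm q < 1 \<Longrightarrow> qpoch_inf q q \<noteq> 0"
  by (rule qpoch_inf_nonzero')

text \<open>Splitting off the factor 1 - z leaves a cofactor holomorphic near 1, so the derivative
  is minus its value there, the cube of (q;q)_inf up to sign.\<close>

lemma deriv_jtheta_one:
  assumes "norm q < 1"
  shows "deriv (\<lambda>z. jtheta z q) 1 \<noteq> 0"
proof -
  define \<phi> where "\<phi> = (\<lambda>z. qpoch_inf (z * q) q * qpoch_inf (q / z) q * qpoch_inf q q)"
  have "\<phi> field_differentiable at 1"
    unfolding \<phi>_def
    by (rule holomorphic_on_imp_differentiable_at[of _ "- {0}"])
       (use assms in \<open>auto intro!: holomorphic_intros\<close>)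
  then have "(\<phi> has_field_derivative deriv \<phi> 1) (at 1)"
    by (simp add: field_differentiable_derivI)
  then have "((\<lambda>z. (1 - z) * \<phi> z) has_field_derivative - \<phi> 1) (at 1)"
    by (auto intro!: derivative_eq_intros)
  then have "deriv (\<lambda>z. jtheta z q) 1 = - \<phi> 1"
    using jtheta_expand[OF assms] unfolding \<phi>_def[symmetric] by (simp add: DERIV_imp_deriv \<phi>_def)
  then show ?thesis
    using qpoch_inf_self_nonzero[OF assms] by (simp add: \<phi>_def)
qed

text \<open>Differentiate \<open>jtheta_shift\<close>; at a zero the derivative of 1/z contributes
  nothing. Nonvanishing of the derivative thus passes between z and qz.\<close>

lemma deriv_jtheta_shift:
  assumes "norm q < 1" "q \<noteq> 0" "z \<noteq> 0" "jtheta z q = 0"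
  shows "deriv (\<lambda>z. jtheta z q) (q * z) = - deriv (\<lambda>z. jtheta z q) z / (q * z)"
proof -
  let ?j = "\<lambda>z. jtheta z q"
  have "(?j has_field_derivative deriv ?j z) (at z)"
    using jtheta_differentiable assms field_differentiable_derivI by blast
  then have 1: "((\<lambda>z. - ?j z / z) has_field_derivative - deriv ?j z / z) (at z)"
    using assms by (auto intro!: derivative_eq_intros simp: field_simps)
  have "(?j has_field_derivative deriv ?j (q * z)) (at (q * z))"
    using jtheta_differentiable[of q "q * z"] assms field_differentiable_derivI by auto
  then have "((\<lambda>z. ?j (q * z)) has_field_derivative deriv ?j (q * z) * q) (at z)"
    using DERIV_chain2[of ?j "deriv ?j (q * z)" "\<lambda>z. q * z" z q]
    by (auto intro!: derivative_eq_intros)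
  moreover have "eventually (\<lambda>w. ?j (q * w) = - ?j w / w) (nhds z)"
    using t1_space_nhds[OF assms(3)] by eventually_elim (use assms jtheta_shift in auto)
  ultimately have "((\<lambda>z. - ?j z / z) has_field_derivative deriv ?j (q * z) * q) (at z)"
    by (subst (asm) DERIV_cong_ev) auto
  from DERIV_unique[OF this 1] show ?thesis
    using assms by (simp add: field_simps)
qed

text \<open>The multiplier has no zero on the punctured plane, so a zero propagates in both
  directions along the orbit of multiplication by q.\<close>

lemma quasi_periodic_zeros:
  fixes f :: "complex \<Rightarrow> complex"
  assumes "q \<noteq> 0" "z \<noteq> 0" "C \<noteq> 0"
    and f: "\<And>x. x \<noteq> 0 \<Longrightarrow> f (q * x) = C * x powi m * f x" and "f z = 0"
  shows "f (z * q powi k) = 0"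
proof (induction k rule: int_induct[of _ 0])
  case base
  show ?case using assms by simp
next
  case (step1 i)
  have "z * q powi (i + 1) = q * (z * q powi i)"
    using assms by (simp add: power_int_add)
  moreover have "f (q * (z * q powi i)) = 0"
    using f[of "z * q powi i"] step1 assms by simp
  ultimately show ?case by (simp only:)
next
  case (step2 i)
  have eq: "q * (z * q powi (i - 1)) = z * q powi i"
    using assms by (simp add: power_int_diff)
  have nz: "z * q powi (i - 1) \<noteq> 0"
    using assms by simp
  have "0 = C * (z * q powi (i - 1)) powi m * f (z * q powi (i - 1))"
    using f[OF nz] step2 unfolding eq by simp
  then show ?case
    using assms nz by (metis mult_eq_0_iff power_int_not_zero)
qed

lemma jtheta_simple_zeros:
  assumes "norm q < 1" "q \<noteq> 0" "z \<noteq> 0" "jtheta z q = 0"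
  shows "deriv (\<lambda>z. jtheta z q) z \<noteq> 0"
proof -
  let ?j = "\<lambda>z. jtheta z q"
  obtain k where k: "z = q powi k"
    using jtheta_eq_0D assms by blast
  have z: "jtheta (q powi k) q = 0" for k
    using quasi_periodic_zeros[of q 1 "-1" ?j "-1" k] jtheta_shift[OF assms(1,2)] jtheta_one assms
    by (simp add: power_int_minus field_simps)
  have "deriv ?j (q powi k) \<noteq> 0"
  proof (induction k rule: int_induct[of _ 0])
    case base
    show ?case using deriv_jtheta_one assms by simp
  next
    case (step1 i)
    have "q powi (i + 1) = q * q powi i"
      using assms by (simp add: power_int_add)
    then show ?case
      using deriv_jtheta_shift[of q "q powi i"] step1 assms z by simp
  next
    case (step2 i)
    have "q * q powi (i - 1) = q powi i"
      using assms by (simp add: power_int_diff)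
    then show ?case
      using deriv_jtheta_shift[of q "q powi (i - 1)"] step2 assms z by auto
  qed
  then show ?thesis using k by simp
qed

section \<open>Quasi-periodic functions on the punctured plane\<close>

lemma has_field_derivative_cong_ev:
  assumes "(f has_field_derivative D) (at z)" "eventually (\<lambda>w. f w = g w) (nhds z)"
  shows "(g has_field_derivative D) (at z)"
  using iffD1[OF DERIV_cong_ev[OF refl assms(2) refl]] assms(1) by blast

lemma field_differentiable_cong_ev:
  assumes "eventually (\<lambda>w. f w = g w) (nhds z)" "f field_differentiable at z"
  shows "g field_differentiable at z"
  using assms(2) has_field_derivative_cong_ev[OF _ assms(1)]
  unfolding field_differentiable_def by blast

text \<open>Near a zero of \<open>h\<close> the quotient equals that of the two difference
  quotients, which extend holomorphically, and simplicity keeps the lower one away from 0. The point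
  \<open>b\<close> rules out that \<open>h\<close> is identically zero, so its zeros are
  isolated.\<close>

lemma holomorphic_divide_simple_zeros:
  fixes f h :: "complex \<Rightarrow> complex"
  assumes S: "open S" "connected S" and hol: "f holomorphic_on S" "h holomorphic_on S"
    and nz: "b \<in> S" "h b \<noteq> 0"
    and zeros: "\<And>z. z \<in> S \<Longrightarrow> h z = 0 \<Longrightarrow> f z = 0 \<and> deriv h z \<noteq> 0"
  shows "\<exists>g. g holomorphic_on S \<and> (\<forall>z\<in>S. f z = h z * g z)"
proof -
  define g where "g = (\<lambda>z. if h z = 0 then deriv f z / deriv h z else f z / h z)"
  have "g field_differentiable at z" if z: "z \<in> S" for z
  proof (cases "h z = 0")
    case False
    have "isCont h z"
      using hol z S continuous_on_eq_continuous_at holomorphic_on_imp_continuous_on by blast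
    then have "eventually (\<lambda>w. h w \<noteq> 0) (at z)"
      using False tendsto_imp_eventually_ne by (auto simp: isCont_def)
    then have "eventually (\<lambda>w. h w \<noteq> 0) (nhds z)"
      using False by (simp add: eventually_nhds_conv_at)
    then have "eventually (\<lambda>w. f w / h w = g w) (nhds z)"
      by eventually_elim (auto simp: g_def)
    moreover have "(\<lambda>w. f w / h w) field_differentiable at z"
      using hol z S False by (intro field_differentiable_divide) (auto simp: holomorphic_on_imp_differentiable_at)
    ultimately show ?thesis
      by (rule field_differentiable_cong_ev)
  next
    case True
    define f1 where "f1 = (\<lambda>w. if w = z then deriv f z else (f w - f z) / (w - z))"
    define h1 where "h1 = (\<lambda>w. if w = z then deriv h z else (h w - h z) / (w - z))"
    have "f1 holomorphic_on S" "h1 holomorphic_on S"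
      unfolding f1_def h1_def using hol S z by (auto intro!: pole_lemma simp: interior_open)
    then have diff: "(\<lambda>w. f1 w / h1 w) field_differentiable at z"
      using z S zeros[OF z True] h1_def
      by (intro field_differentiable_divide) (auto simp: holomorphic_on_imp_differentiable_at)
    have "eventually (\<lambda>w. h w \<noteq> 0) (at z)"
      using non_zero_neighbour_alt[OF hol(2) S z nz] by eventually_elim auto
    then have "eventually (\<lambda>w. f1 w / h1 w = g w) (at z)"
      using eventually_neq_at_within[of z z]
    proof eventually_elim
      case (elim w)
      then show ?case using zeros[OF z True] True by (simp add: f1_def h1_def g_def)
    qed
    moreover have "f1 z / h1 z = g z"
      using True by (simp add: f1_def h1_def g_def)
    ultimately have "eventually (\<lambda>w. f1 w / h1 w = g w) (nhds z)"
      by (simp add: eventually_nhds_conv_at)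
    then show ?thesis
      using diff by (rule field_differentiable_cong_ev)
  qed
  then have "g holomorphic_on S"
    by (simp add: field_differentiable_at_within holomorphic_on_def)
  moreover have "f z = h z * g z" if "z \<in> S" for z
    using zeros[OF that] by (auto simp: g_def)
  ultimately show ?thesis by blast
qed

lemma norm_powi_eqD:
  fixes q :: complex
  assumes "norm q < 1" "q \<noteq> 0" "norm (q powi m) = norm (q powi n)"
  shows "m = n"
proof (rule ccontr)
  assume "m \<noteq> n"
  then consider "m < n" | "n < m" by linarith
  then show False
  proof cases
    case 1
    then show False
      using power_int_strict_decreasing[of m n "norm q"] assms by (simp add: norm_power_int)
  next
    case 2
    then show False
      using power_int_strict_decreasing[of n m "norm q"] assms by (simp add: norm_power_int)
  qed
qed

lemma powi_neq_minus_one: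
  fixes q :: complex
  assumes "norm q < 1" "q \<noteq> 0"
  shows "q powi n \<noteq> - 1"
proof
  assume *: "q powi n = - 1"
  then have "norm (q powi n) = norm (q powi 0)" by simp
  then have "n = 0" using norm_powi_eqD assms by blast
  then show False using * by simp
qed

lemma jtheta_minus_one_nonzero:
  assumes "norm q < 1" "q \<noteq> 0"
  shows "jtheta (-1) q \<noteq> 0"
proof
  assume "jtheta (-1) q = 0"
  then obtain k where "-1 = q powi k"
    using jtheta_eq_0D[OF assms] by force
  then show False using powi_neq_minus_one[OF assms, of k] by simp
qed

text \<open>The zeros of \<open>jtheta (x / u) q\<close> are simple and lie on the orbit of
  \<open>u\<close>, where \<open>f\<close> vanishes by quasi-periodicity. The divisor picks up -u/x
  under x -> qx, which turns the multiplier C x^m into (-C/u) x^(m+1).\<close>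

lemma quasi_periodic_divide:
  fixes f :: "complex \<Rightarrow> complex"
  assumes q: "norm q < 1" "q \<noteq> 0" and "C \<noteq> 0" and hol: "f holomorphic_on - {0}"
    and f: "\<And>x. x \<noteq> 0 \<Longrightarrow> f (q * x) = C * x powi m * f x"
    and u: "u \<noteq> 0" "f u = 0"
  shows "\<exists>g. g holomorphic_on - {0} \<and> (\<forall>x. x \<noteq> 0 \<longrightarrow> f x = jtheta (x / u) q * g x) \<and>
           (\<forall>x. x \<noteq> 0 \<longrightarrow> g (q * x) = (- C / u) * x powi (m + 1) * g x)"
proof -
  define h where "h = (\<lambda>x. jtheta (x / u) q)"
  have conn: "connected (- {0::complex})" "open (- {0::complex})"
    by (auto simp: connected_punctured_universe)
  have hol_h: "h holomorphic_on - {0}"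
    unfolding h_def using q u by (auto intro!: holomorphic_intros)
  have hz: "f z = 0 \<and> deriv h z \<noteq> 0" if "z \<in> - {0}" "h z = 0" for z
  proof
    have z: "jtheta (z / u) q = 0" "z / u \<noteq> 0"
      using that u by (auto simp: h_def)
    from jtheta_eq_0D[OF q z(2,1)] obtain k where "z / u = q powi k" by blast
    then have "z = u * q powi k" using u by (simp add: field_simps)
    then show "f z = 0"
      using quasi_periodic_zeros[OF q(2) u(1) \<open>C \<noteq> 0\<close> f u(2)] by simp
    have "((\<lambda>w. jtheta w q) has_field_derivative deriv (\<lambda>w. jtheta w q) (z / u)) (at (z / u))"
      using jtheta_differentiable[OF q(1) z(2)] field_differentiable_derivI by blast
    then have "(h has_field_derivative deriv (\<lambda>w. jtheta w q) (z / u) * (1 / u)) (at z)"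
      unfolding h_def
      by (rule DERIV_chain2) (use u in \<open>auto intro!: derivative_eq_intros\<close>)
    then show "deriv h z \<noteq> 0"
      using jtheta_simple_zeros[OF q z(2,1)] u by (simp add: DERIV_imp_deriv)
  qed
  have hb: "- u \<in> - {0}" "h (- u) \<noteq> 0"
    using jtheta_minus_one_nonzero[OF q] u by (auto simp: h_def)
  obtain g where g: "g holomorphic_on - {0}" "\<And>z. z \<noteq> 0 \<Longrightarrow> f z = h z * g z"
    using holomorphic_divide_simple_zeros[OF conn(2,1) hol hol_h hb hz] by auto
  have "g (q * x) = (- C / u) * x powi (m + 1) * g x" if "x \<noteq> 0" for x
  proof -
    \<comment> \<open>Cancelling \<open>h\<close> yields the equation for \<open>g\<close> only off
      the zeros of \<open>h\<close>. Its defect \<open>D\<close> is therefore zero on a punctured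
      neighbourhood of every point, hence everywhere by continuity.\<close>
    define D where "D = (\<lambda>x. g (q * x) - (- C / u) * x powi (m + 1) * g x)"
    have D: "D w = 0" if "h w \<noteq> 0" "w \<noteq> 0" for w
    proof -
      have "h (q * w) * g (q * w) = C * w powi m * (h w * g w)"
        using f[of w] g(2)[of w] g(2)[of "q * w"] that q by simp
      moreover have "h (q * w) = - h w * u / w"
        using jtheta_shift[of q "w / u"] q u that by (simp add: h_def)
      ultimately have "h w * (- u / w * g (q * w)) = h w * (C * w powi m * g w)"
        by (simp add: mult_ac)
      then have "- u / w * g (q * w) = C * w powi m * g w"
        using that(1) mult_left_cancel by blast
      then show ?thesis
        using that u by (simp add: D_def power_int_add field_simps add_eq_0_iff)
    qed
    have "(\<lambda>x. q * x) holomorphic_on - {0}"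
      by (intro holomorphic_intros)
    then have "(g \<circ> (\<lambda>x. q * x)) holomorphic_on - {0}"
      by (rule holomorphic_on_compose_gen[OF _ g(1)]) (use q in auto)
    then have "(\<lambda>x. g (q * x)) holomorphic_on - {0}"
      by (simp add: o_def)
    then have "D holomorphic_on - {0}"
      unfolding D_def using g by (auto intro!: holomorphic_intros)
    then have "isCont D x"
      using that conn continuous_on_eq_continuous_at holomorphic_on_imp_continuous_on by blast
    then have "D \<midarrow>x\<rightarrow> D x" by (simp add: isCont_def)
    moreover have "eventually (\<lambda>w. D w = 0) (at x)"
      using non_zero_neighbour_alt[OF hol_h conn(2,1) _ hb, of x] that
      by (auto elim!: eventually_mono intro: D)
    then have "D \<midarrow>x\<rightarrow> 0" by (simp add: tendsto_eventually)
    ultimately have "D x = 0" using tendsto_unique[OF at_neq_bot] by blast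
    then show ?thesis by (simp only: D_def right_minus_eq)
  qed
  then show ?thesis using g unfolding h_def by blast
qed

text \<open>After one division the product rule at \<open>u\<close> gives f'(u) = j'(1) g(u) / u,
  because the theta factor vanishes there; since j'(1) is nonzero, the quotient \<open>g\<close>
  still vanishes at \<open>u\<close>.\<close>

lemma quasi_periodic_divide_square:
  fixes f :: "complex \<Rightarrow> complex"
  assumes q: "norm q < 1" "q \<noteq> 0" and "C \<noteq> 0" and hol: "f holomorphic_on - {0}"
    and f: "\<And>x. x \<noteq> 0 \<Longrightarrow> f (q * x) = C * x powi m * f x"
    and u: "u \<noteq> 0" "f u = 0" "deriv f u = 0"
  shows "\<exists>g C'. C' \<noteq> 0 \<and> g holomorphic_on - {0} \<and>
           (\<forall>x. x \<noteq> 0 \<longrightarrow> f x = (jtheta (x / u) q)\<^sup>2 * g x) \<and>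
           (\<forall>x. x \<noteq> 0 \<longrightarrow> g (q * x) = C' * x powi (m + 2) * g x)"
proof -
  obtain g where g: "g holomorphic_on - {0}" "\<And>x. x \<noteq> 0 \<Longrightarrow> f x = jtheta (x / u) q * g x"
      "\<And>x. x \<noteq> 0 \<Longrightarrow> g (q * x) = (- C / u) * x powi (m + 1) * g x"
    using quasi_periodic_divide[OF assms(1-5) u(1,2)] by blast
  have "((\<lambda>w. jtheta w q) has_field_derivative deriv (\<lambda>w. jtheta w q) 1) (at (u / u))"
    using jtheta_differentiable[OF q(1), of 1] u field_differentiable_derivI by fastforce
  then have "((\<lambda>w. jtheta (w / u) q) has_field_derivative deriv (\<lambda>w. jtheta w q) 1 * (1 / u)) (at u)"
    by (rule DERIV_chain2) (use u in \<open>auto intro!: derivative_eq_intros\<close>)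
  moreover have "(g has_field_derivative deriv g u) (at u)"
    using g u by (intro holomorphic_derivI) auto
  ultimately have "((\<lambda>x. jtheta (x / u) q * g x) has_field_derivative deriv (\<lambda>w. jtheta w q) 1 / u * g u) (at u)"
    using u q by (auto intro!: derivative_eq_intros simp: jtheta_one)
  moreover have "eventually (\<lambda>x. jtheta (x / u) q * g x = f x) (nhds u)"
    using t1_space_nhds[OF u(1)] by eventually_elim (use g in auto)
  ultimately have "(f has_field_derivative deriv (\<lambda>w. jtheta w q) 1 / u * g u) (at u)"
    by (rule has_field_derivative_cong_ev)
  then have "deriv (\<lambda>w. jtheta w q) 1 / u * g u = 0"
    using u by (simp add: DERIV_imp_deriv)
  then have "g u = 0" using deriv_jtheta_one[OF q(1)] u by simp
  moreover have "- C / u \<noteq> 0" using assms u by simp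
  ultimately obtain g2 where g2: "g2 holomorphic_on - {0}" "\<And>x. x \<noteq> 0 \<Longrightarrow> g x = jtheta (x / u) q * g2 x"
      "\<And>x. x \<noteq> 0 \<Longrightarrow> g2 (q * x) = (- (- C / u) / u) * x powi (m + 1 + 1) * g2 x"
    using quasi_periodic_divide[OF q _ g(1,3) u(1)] by blast
  show ?thesis
  proof (intro exI conjI allI impI)
    show "- (- C / u) / u \<noteq> 0" using assms u by simp
    show "g2 holomorphic_on - {0}" by fact
    show "f x = (jtheta (x / u) q)\<^sup>2 * g2 x" if "x \<noteq> 0" for x
      using g(2) g2(2) that by (simp add: power2_eq_square mult.assoc)
    show "g2 (q * x) = (- (- C / u) / u) * x powi (m + 2) * g2 x" if "x \<noteq> 0" for x
      using g2(3)[OF that] by (simp add: add.assoc)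
  qed
qed

text \<open>
  The functional equation forces decay towards both \<open>0\<close> and \<open>\<infinity>\<close>, so the supremum over the
  punctured plane is attained on one annulus and Liouville's theorem applies.
\<close>
lemma quasi_periodic_pos_eq_0:
  fixes g :: "complex \<Rightarrow> complex"
  assumes q: "norm q < 1" "q \<noteq> 0" and hol: "g holomorphic_on - {0}"
    and g: "\<And>x. x \<noteq> 0 \<Longrightarrow> g (q * x) = C * x ^ Suc m * g x"
    and x: "x \<noteq> 0"
  shows "g x = 0"
proof (cases "C = 0")
  case True
  then show ?thesis using g[of "x / q"] q x by simp
next
  case False
  define s where "s = norm q"
  have s: "0 < s" "s < 1" using q by (auto simp: s_def)
  \<comment> \<open>At this radius the multiplier has modulus one: replacing y by qy does not
    increase |g| below it and does not decrease |g| above it.\<close>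
  define r where "r = root (Suc m) (1 / norm C)"
  have r: "r > 0" "norm C * r ^ Suc m = 1"
    using False by (simp_all add: r_def del: power_Suc)
  have low: "norm (g (q * y)) \<le> norm (g y)" if "norm y \<le> r" "y \<noteq> 0" for y
  proof -
    have "norm C * norm y ^ Suc m \<le> 1"
      unfolding r(2)[symmetric] using that by (intro mult_left_mono power_mono) auto
    then show ?thesis
      using g[OF that(2)] mult_right_mono[of "norm C * norm y ^ Suc m" 1 "norm (g y)"]
      by (simp add: norm_mult norm_power)
  qed
  have high: "norm (g y) \<le> norm (g (q * y))" if "norm y \<ge> r" for y
  proof -
    have "y \<noteq> 0" using that r by auto
    have "norm C * norm y ^ Suc m \<ge> 1"
      unfolding r(2)[symmetric] using that r by (intro mult_left_mono power_mono) auto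
    then show ?thesis
      using g[OF \<open>y \<noteq> 0\<close>] mult_right_mono[of 1 "norm C * norm y ^ Suc m" "norm (g y)"]
      by (simp add: norm_mult norm_power)
  qed
  \<comment> \<open>A fundamental annulus for multiplication by q. Its bound spreads inward by
    \<open>low\<close> and then outward by \<open>high\<close>.\<close>
  define A where "A = cball 0 r - ball (0::complex) (s * r)"
  have "A \<subseteq> - {0}" using s r by (auto simp: A_def)
  moreover have "compact A" by (simp add: A_def compact_diff)
  ultimately have "compact (g ` A)"
    using hol by (meson compact_continuous_image continuous_on_subset holomorphic_on_imp_continuous_on)
  then obtain B where B: "\<And>y. y \<in> A \<Longrightarrow> norm (g y) \<le> B"
    using compact_imp_bounded bounded_iff by (metis imageI)
  have B1: "norm (g y) \<le> B" if "s ^ Suc n * r \<le> norm y" "norm y \<le> r" for n y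
    using that
  proof (induction n arbitrary: y)
    case 0
    then show ?case using B by (auto simp: A_def)
  next
    case (Suc n)
    show ?case
    proof (cases "s ^ Suc n * r \<le> norm y")
      case True
      then show ?thesis using Suc by simp
    next
      case False
      have y: "norm (y / q) = norm y / s" by (simp add: norm_divide s_def)
      have "s ^ n \<le> 1" using s by (simp add: power_le_one)
      then have "s * (s ^ n * r) \<le> s * (1 * r)"
        using s r by (intro mult_left_mono mult_right_mono) auto
      then have "norm y \<le> s * r" using False by simp
      then have "norm (y / q) \<le> r"
        using s unfolding y by (simp add: field_simps)
      moreover have "s ^ Suc n * r \<le> norm (y / q)"
        using Suc.prems s unfolding y by (simp add: field_simps)
      ultimately have "norm (g (y / q)) \<le> B" using Suc.IH by blast
      moreover have "s ^ Suc (Suc n) * r > 0" using s r by simp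
      then have "y \<noteq> 0" using Suc.prems by auto
      ultimately show ?thesis
        using low[of "y / q"] \<open>norm (y / q) \<le> r\<close> q by auto
    qed
  qed
  have B2: "norm (g y) \<le> B" if "y \<noteq> 0" "norm y \<le> r" for y
  proof -
    have "(\<lambda>n. s ^ n) \<longlonglongrightarrow> 0" using s by (intro LIMSEQ_power_zero) auto
    then have "eventually (\<lambda>n. s ^ n < norm y / r) sequentially"
      using that r by (intro order_tendstoD) auto
    then obtain n where n: "s ^ n < norm y / r"
      using eventually_happens by fastforce
    then have "s ^ n * r < norm y" using r by (simp add: field_simps)
    moreover have "s ^ Suc n * r \<le> s ^ n * r"
      using s r by (simp add: mult_le_cancel_right1 mult_left_le_one_le)
    ultimately show ?thesis using B1[of n y] that by simp
  qed
  have B3: "norm (g y) \<le> B" if "y \<noteq> 0" "norm y \<le> r / s ^ n" for n y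
    using that
  proof (induction n arbitrary: y)
    case 0
    then show ?case using B2 by simp
  next
    case (Suc n)
    show ?case
    proof (cases "norm y \<le> r")
      case True
      then show ?thesis using B2 Suc by simp
    next
      case False
      have "norm (q * y) \<le> r / s ^ n"
        using Suc.prems s by (simp add: norm_mult s_def[symmetric] field_simps)
      then have "norm (g (q * y)) \<le> B" using Suc q by simp
      then show ?thesis using high[of y] False by simp
    qed
  qed
  have bd: "norm (g y) \<le> B" if "y \<noteq> 0" for y
  proof -
    have "(\<lambda>n. s ^ n) \<longlonglongrightarrow> 0" using s by (intro LIMSEQ_power_zero) auto
    then have "eventually (\<lambda>n. s ^ n < r / norm y) sequentially"
      using that r by (intro order_tendstoD) auto
    then obtain n where "s ^ n < r / norm y"
      using eventually_happens by fastforce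
    then have "norm y \<le> r / s ^ n" using s that by (simp add: field_simps)
    then show ?thesis using B3 that by blast
  qed
  \<comment> \<open>Boundedness removes the singularity at 0 and makes the extension constant. A
    nonzero constant would force the multiplier to be 1 both at z = 1 and at z = 2.\<close>
  have "\<exists>B. eventually (\<lambda>z. norm (g z) \<le> B) (at 0)"
    by (rule exI[of _ B]) (use bd in \<open>auto intro: eventually_mono[OF eventually_neq_at_within[of 0 0]]\<close>)
  then obtain G where G: "G holomorphic_on UNIV" "\<And>z. z \<noteq> 0 \<Longrightarrow> G z = g z"
    using holomorphic_on_extend_bounded[of g UNIV 0] hol by (auto simp: Compl_eq_Diff_UNIV)
  have "norm (G z) \<le> max B (norm (G 0))" for z
    using bd[of z] G(2)[of z] by (cases "z = 0") auto
  then have "bounded (range G)" by (auto simp: bounded_iff)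
  then obtain c where c: "\<And>z. G z = c"
    using Liouville_theorem[OF G(1)] unfolding constant_on_def by blast
  then have gc: "g z = c" if "z \<noteq> 0" for z
    using G(2)[OF that] by simp
  have "c = 0"
  proof (rule ccontr)
    assume "c \<noteq> 0"
    have "C * z ^ Suc m = 1" if "z \<noteq> 0" for z
      using g[OF that] gc[OF that] gc[of "q * z"] that q \<open>c \<noteq> 0\<close> by simp
    from this[of 1] this[of 2] have "(2::complex) ^ Suc m = 1" by simp
    then have "norm ((2::complex) ^ Suc m) = 1" by simp
    then have "(2::real) ^ Suc m = 1" by (simp only: norm_power norm_numeral)
    moreover have "(2::real) ^ Suc m > 1" by (rule one_less_power) auto
    ultimately show False by simp
  qed
  then show ?thesis using gc x by simp
qed

text \<open>The double zeros raise the exponent from -4 to -2 and then to 0, the simple zero raises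
  it to 1, and \<open>quasi_periodic_pos_eq_0\<close> applies. The conditions on theta values put
  \<open>u\<close>, \<open>v\<close>, \<open>w\<close> on different orbits, so that each zero
  survives the earlier divisions.\<close>

lemma quasi_periodic_five_zeros_eq_0:
  fixes f :: "complex \<Rightarrow> complex"
  assumes q: "norm q < 1" "q \<noteq> 0" and "C \<noteq> 0" and hol: "f holomorphic_on - {0}"
    and f: "\<And>x. x \<noteq> 0 \<Longrightarrow> f (q * x) = C * x powi (-4) * f x"
    and u: "u \<noteq> 0" "f u = 0" "deriv f u = 0"
    and v: "v \<noteq> 0" "f v = 0" "deriv f v = 0"
    and w: "w \<noteq> 0" "f w = 0"
    and ne: "jtheta (v / u) q \<noteq> 0" "jtheta (w / u) q \<noteq> 0" "jtheta (w / v) q \<noteq> 0"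
    and x: "x \<noteq> 0"
  shows "f x = 0"
proof -
  obtain g D where g: "D \<noteq> 0" "g holomorphic_on - {0}" "\<And>x. x \<noteq> 0 \<Longrightarrow> f x = (jtheta (x / u) q)\<^sup>2 * g x"
      "\<And>x. x \<noteq> 0 \<Longrightarrow> g (q * x) = D * x powi (-2) * g x"
    using quasi_periodic_divide_square[OF assms(1-5) u] by auto
  have gv: "g v = 0" using g(3)[OF v(1)] v ne by simp
  have "(\<lambda>x. (jtheta (x / u) q)\<^sup>2) holomorphic_on - {0}"
    using q u by (auto intro!: holomorphic_intros)
  then have "((\<lambda>x. (jtheta (x / u) q)\<^sup>2) has_field_derivative deriv (\<lambda>x. (jtheta (x / u) q)\<^sup>2) v) (at v)"
    using v by (intro holomorphic_derivI) auto
  moreover have "(g has_field_derivative deriv g v) (at v)"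
    using g v by (intro holomorphic_derivI) auto
  ultimately have "((\<lambda>x. (jtheta (x / u) q)\<^sup>2 * g x) has_field_derivative
      deriv (\<lambda>x. (jtheta (x / u) q)\<^sup>2) v * g v + deriv g v * (jtheta (v / u) q)\<^sup>2) (at v)"
    by (rule DERIV_mult)
  moreover have "eventually (\<lambda>x. (jtheta (x / u) q)\<^sup>2 * g x = f x) (nhds v)"
    using t1_space_nhds[OF v(1)] by eventually_elim (use g in auto)
  ultimately have "(f has_field_derivative deriv (\<lambda>x. (jtheta (x / u) q)\<^sup>2) v * g v
      + deriv g v * (jtheta (v / u) q)\<^sup>2) (at v)"
    by (rule has_field_derivative_cong_ev)
  then have "(f has_field_derivative deriv g v * (jtheta (v / u) q)\<^sup>2) (at v)"
    by (simp add: gv)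
  then have "deriv g v = 0"
    using v ne by (auto simp: DERIV_imp_deriv)
  then obtain h E where h: "E \<noteq> 0" "h holomorphic_on - {0}" "\<And>x. x \<noteq> 0 \<Longrightarrow> g x = (jtheta (x / v) q)\<^sup>2 * h x"
      "\<And>x. x \<noteq> 0 \<Longrightarrow> h (q * x) = E * x powi 0 * h x"
    using quasi_periodic_divide_square[OF q g(1,2,4) v(1) gv] by auto
  have "h w = 0" using g(3)[OF w(1)] h(3)[OF w(1)] w ne by simp
  then obtain k where k: "k holomorphic_on - {0}" "\<And>x. x \<noteq> 0 \<Longrightarrow> h x = jtheta (x / w) q * k x"
      "\<And>x. x \<noteq> 0 \<Longrightarrow> k (q * x) = (- E / w) * x powi (0 + 1) * k x"
    using quasi_periodic_divide[OF q h(1,2,4) w(1)] by blast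
  have "k x = 0"
    by (rule quasi_periodic_pos_eq_0[OF q k(1) _ x, of "- E / w" 0]) (use k(3) in simp)
  then show ?thesis using g(3) h(3) k(2) x by simp
qed

section \<open>Bilateral series\<close>

lemma summable_on_int_halves:
  fixes f :: "int \<Rightarrow> real"
  assumes "summable (\<lambda>n. norm (f (int n)))" "summable (\<lambda>n. norm (f (- 1 - int n)))"
  shows "f summable_on UNIV"
proof -
  have "(f \<circ> int) summable_on UNIV" "(f \<circ> (\<lambda>n. - 1 - int n)) summable_on UNIV"
    using norm_summable_imp_summable_on[OF assms(1)] norm_summable_imp_summable_on[OF assms(2)]
    by (simp_all add: o_def)
  then have "f summable_on range int" "f summable_on range (\<lambda>n. - 1 - int n)"
    by (simp_all add: summable_on_reindex inj_on_def)
  moreover have "range int \<inter> range (\<lambda>n. - 1 - int n) = {}" by auto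
  moreover have "range int \<union> range (\<lambda>n. - 1 - int n) = UNIV"
  proof (intro equalityI subsetI UNIV_I)
    fix n :: int
    have "n = int (nat n) \<or> n = - 1 - int (nat (- 1 - n))" by linarith
    then show "n \<in> range int \<union> range (\<lambda>n. - 1 - int n)" by blast
  qed
  ultimately show ?thesis
    using summable_on_Un_disjoint by metis
qed

lemma has_sum_int_telescope:
  fixes W :: "int \<Rightarrow> complex"
  assumes "(\<lambda>n. W n - W (n + 1)) summable_on UNIV"
    and "(\<lambda>n. W (int n)) \<longlonglongrightarrow> A" "(\<lambda>n. W (- int n)) \<longlonglongrightarrow> B"
  shows "((\<lambda>n. W n - W (n + 1)) has_sum (B - A)) UNIV"
proof -
  obtain S where S: "((\<lambda>n. W n - W (n + 1)) has_sum S) UNIV"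
    using assms(1) summable_on_def by blast
  \<comment> \<open>The unordered sum may be computed along any exhausting sequence of finite sets.
    Half-open intervals make the partial sums collapse to
    \<open>W (- int N) - W (int N)\<close>.\<close>
  have "filterlim (\<lambda>N. {- int N..<int N}) (finite_subsets_at_top UNIV) sequentially"
    unfolding filterlim_finite_subsets_at_top
  proof (intro allI impI)
    fix X :: "int set" assume X: "finite X \<and> X \<subseteq> UNIV"
    then obtain b where b: "\<And>x. x \<in> X \<Longrightarrow> \<bar>x\<bar> \<le> b"
      using finite_abs_int_segment by (metis (full_types) X Max_ge finite_imageI imageI)
    have "X \<subseteq> {- int N..<int N}" if "N \<ge> nat (b + 1)" for N
      using b that by force
    then show "\<forall>\<^sub>F N in sequentially. finite {- int N..<int N} \<and> X \<subseteq> {- int N..<int N} \<and> {- int N..<int N} \<subseteq> UNIV"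
      by (intro eventually_sequentiallyI[of "nat (b + 1)"]) simp
  qed
  with S have "(\<lambda>N. \<Sum>n\<in>{- int N..<int N}. W n - W (n + 1)) \<longlonglongrightarrow> S"
    unfolding has_sum_def by (rule filterlim_compose)
  moreover have "(\<Sum>n\<in>{- int N..<int N}. W n - W (n + 1)) = W (- int N) - W (int N)" for N
  proof (induction N)
    case (Suc N)
    have "{- int (Suc N)..<int (Suc N)} = insert (- int (Suc N)) (insert (int N) {- int N..<int N})"
      by auto
    then show ?case using Suc by (simp add: algebra_simps)
  qed simp
  ultimately have "(\<lambda>N. W (- int N) - W (int N)) \<longlonglongrightarrow> S" by simp
  moreover have "(\<lambda>N. W (- int N) - W (int N)) \<longlonglongrightarrow> B - A"
    by (intro tendsto_intros assms)
  ultimately have "S = B - A" using LIMSEQ_unique by blast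
  then show ?thesis using S by simp
qed

lemma prod_qpoch_inverse_bounded:
  fixes a q :: complex
  assumes "norm q < 1" "\<And>n. a * q ^ n \<noteq> 1"
  shows "\<exists>K>0. \<forall>n. norm (inverse (\<Prod>k<n. 1 - a * q ^ k)) \<le> K"
proof -
  have "(\<lambda>n. inverse (\<Prod>k<n. 1 - a * q ^ k)) \<longlonglongrightarrow> inverse (qpoch_inf a q)"
    by (intro tendsto_inverse qpoch_inf_LIMSEQ qpoch_inf_nonzero assms)
  then have "Bseq (\<lambda>n. inverse (\<Prod>k<n. 1 - a * q ^ k))"
    by (rule convergent_imp_Bseq[OF convergentI])
  then show ?thesis by (auto simp: Bseq_def)
qed

lemma holomorphic_on_infsum_punctured_plane:
  fixes f :: "int \<Rightarrow> complex \<Rightarrow> complex"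
  assumes hol: "\<And>n. f n holomorphic_on - {0}"
    and bd: "\<And>R. R > 0 \<Longrightarrow> \<exists>M. M summable_on UNIV \<and>
      (\<forall>n y. y \<noteq> 0 \<longrightarrow> norm y \<le> R \<longrightarrow> norm (1 / y) \<le> R \<longrightarrow> norm (f n y) \<le> M n)"
  shows "(\<lambda>y. \<Sum>\<^sub>\<infinity>n. f n y) holomorphic_on - {0}"
proof -
  have "(\<lambda>y. \<Sum>\<^sub>\<infinity>n. f n y) field_differentiable at z" if z: "z \<in> - {0}" for z
  proof -
    define r where "r = norm z / 2"
    have r: "r > 0" using z by (simp add: r_def)
    \<comment> \<open>On the closed disc of radius \<open>r\<close> about \<open>z\<close> this
      dominates both |y| and 1/|y|.\<close>
    define R where "R = norm z + r + 1 / r"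
    have "R > 0" using r by (simp add: R_def add_nonneg_pos)
    then obtain M where M: "M summable_on UNIV"
      "\<And>n y. y \<noteq> 0 \<Longrightarrow> norm y \<le> R \<Longrightarrow> norm (1 / y) \<le> R \<Longrightarrow> norm (f n y) \<le> M n"
      using bd by blast
    have cb: "norm y \<ge> r \<and> norm y \<le> norm z + r" if "y \<in> cball z r" for y
      using that norm_triangle_ineq2[of z y] norm_triangle_ineq2[of y z]
      by (auto simp: dist_norm r_def norm_minus_commute)
    then have sub: "cball z r \<subseteq> - {0}" using cb[of 0] r by auto
    have "norm (f n y) \<le> M n" if "y \<in> cball z r" for n y
    proof (rule M(2))
      show "y \<noteq> 0" using cb[OF that] r by auto
      show "norm y \<le> R" using cb[OF that] r by (simp add: R_def add_increasing2)
      have "1 / norm y \<le> 1 / r" using cb[OF that] r by (intro frac_le) auto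
      then show "norm (1 / y) \<le> R" using r by (simp add: R_def norm_divide add_increasing)
    qed
    then have "uniform_limit (cball z r) (\<lambda>X y. \<Sum>n\<in>X. f n y) (\<lambda>y. \<Sum>\<^sub>\<infinity>n. f n y) (finite_subsets_at_top UNIV)"
      using M(1) by (intro Weierstrass_m_test_general) auto
    moreover have "continuous_on (cball z r) (\<lambda>y. \<Sum>n\<in>X. f n y) \<and> (\<lambda>y. \<Sum>n\<in>X. f n y) holomorphic_on ball z r" for X
    proof -
      have "(\<lambda>y. \<Sum>n\<in>X. f n y) holomorphic_on - {0}"
        by (intro holomorphic_intros hol)
      then show ?thesis
        using sub ball_subset_cball
        by (meson holomorphic_on_imp_continuous_on holomorphic_on_subset subset_trans)
    qed
    ultimately have "(\<lambda>y. \<Sum>\<^sub>\<infinity>n. f n y) holomorphic_on ball z r"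
      using holomorphic_uniform_limit[of z r "\<lambda>X y. \<Sum>n\<in>X. f n y" "finite_subsets_at_top UNIV"]
      by auto
    then show ?thesis using r by (simp add: holomorphic_on_imp_differentiable_at)
  qed
  then show ?thesis
    by (simp add: field_differentiable_at_within holomorphic_on_def)
qed

text \<open>
  Up to a constant factor, \<open>c\<close> is the numerator of each of the series: with
  \<open>(\<alpha>, \<beta>) = (q, 0)\<close> and \<open>p = q\<^sup>2\<close> for \<open>K_c\<close> and \<open>K1_c\<close>, \<open>(0, -1)\<close> for \<open>g2_c\<close>, \<open>(0, 0)\<close> for \<open>g3_c\<close>, and
  \<open>(-q, -1)\<close> with \<open>p = q\<^sup>2\<close> for \<open>S2_c\<close>.
\<close>
locale bilateral =
  fixes p \<alpha> \<beta> :: complex and c :: "int \<Rightarrow> complex"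
  assumes p_less: "norm p < 1" and p_nz: "p \<noteq> 0"
    and \<alpha>\<beta>_less: "norm (\<alpha> * \<beta>) < 1"
    and \<alpha>_ne: "\<alpha> * p ^ k \<noteq> 1" and \<beta>_ne: "\<beta> * p ^ k \<noteq> 1"
    and c_0: "c 0 = 1"
    and c_rec: "c (n + 1) = (\<alpha> - p powi (n + 1)) * (\<beta> - p powi (n + 1)) * c n"
begin

text \<open>
  Clearing denominators in \<open>\<Sum> c n / (y, p / y; p)\<^bsub>n + 1\<^esub>\<close> gives \<open>H y\<close>, which has no poles on the
  punctured plane. Both \<open>H y\<close> and \<open>H (p * y)\<close> are combinations of \<open>E0 y\<close> and \<open>E1 y\<close>, and the
  telescoping sequence \<open>W\<close> yields the one linear relation between them.
\<close>
definition e :: "int \<Rightarrow> complex \<Rightarrow> complex" where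
  "e n y = c n * qpoch_inf (y * p powi (n + 2)) p * qpoch_inf (p powi (n + 2) / y) p"

definition E0 :: "complex \<Rightarrow> complex" where
  "E0 y = (\<Sum>\<^sub>\<infinity>n. e n y)"

definition E1 :: "complex \<Rightarrow> complex" where
  "E1 y = (\<Sum>\<^sub>\<infinity>n. p powi (n + 1) * e n y)"

definition \<theta> :: "complex \<Rightarrow> complex" where
  "\<theta> y = qpoch_inf y p * qpoch_inf (p / y) p"

definition H :: "complex \<Rightarrow> complex" where
  "H y = (\<Sum>\<^sub>\<infinity>n. c n * qpoch_inf (y * p powi (n + 1)) p * qpoch_inf (p powi (n + 2) / y) p)"

definition W :: "int \<Rightarrow> complex \<Rightarrow> complex" where
  "W n y = c n * qpoch_inf (y * p powi (n + 1)) p * qpoch_inf (p powi (n + 1) / y) p"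

lemma qpoch_inf_powi_rec:
  "qpoch_inf (a * p powi n) p = (1 - a * p powi n) * qpoch_inf (a * p powi (n + 1)) p"
  using qpoch_inf_rec[OF p_less, of "a * p powi n"] p_nz by (simp add: power_int_add mult.assoc)

lemma qpoch_inf_powi_rec':
  "qpoch_inf (p powi n / a) p = (1 - p powi n / a) * qpoch_inf (p powi (n + 1) / a) p"
  using qpoch_inf_powi_rec[of "inverse a" n] by (simp add: field_simps)

lemma H_summand:
  "c n * qpoch_inf (y * p powi (n + 1)) p * qpoch_inf (p powi (n + 2) / y) p
     = (1 - y * p powi (n + 1)) * e n y"
  using qpoch_inf_powi_rec[of y "n + 1"] by (simp add: e_def add.assoc)

lemma H_shift_summand:
  assumes "y \<noteq> 0"
  shows "c n * qpoch_inf (p * y * p powi (n + 1)) p * qpoch_inf (p powi (n + 2) / (p * y)) p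
     = (1 - p powi (n + 1) / y) * e n y"
proof -
  have "p * y * p powi (n + 1) = y * p powi (n + 2)" "p powi (n + 2) / (p * y) = p powi (n + 1) / y"
    using p_nz assms by (simp_all add: power_int_add field_simps power2_eq_square)
  then show ?thesis
    using qpoch_inf_powi_rec'[of "n + 1" y] by (simp only: e_def add.assoc) (simp add: mult_ac)
qed

text \<open>This form of \<open>W\<close> comes from the infinite products, the next one from the
  recurrence of \<open>c\<close>. Equating them at the same index gives a recurrence for
  \<open>e\<close>; subtracting them at neighbouring indices gives the telescoping relation.\<close>

lemma W_eq: "W n y = (1 - y * p powi (n + 1)) * (1 - p powi (n + 1) / y) * e n y"
  using qpoch_inf_powi_rec[of y "n + 1"] qpoch_inf_powi_rec'[of "n + 1" y]
  by (simp add: W_def e_def add.assoc mult_ac)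

lemma W_Suc_eq: "W (n + 1) y = (\<alpha> - p powi (n + 1)) * (\<beta> - p powi (n + 1)) * e n y"
  by (simp add: W_def e_def c_rec add.assoc mult_ac)

section \<open>Convergence and holomorphy of the bilateral sums\<close>

lemma summable_c: "summable (\<lambda>n. norm (c (int n)))"
proof -
  define b where "b = (\<lambda>n. (\<alpha> - p ^ Suc n) * (\<beta> - p ^ Suc n))"
  have "b \<longlonglongrightarrow> (\<alpha> - 0) * (\<beta> - 0)"
    unfolding b_def
    by (intro tendsto_intros LIMSEQ_Suc LIMSEQ_power_zero p_less)
  then have "(\<lambda>n. norm (b n)) \<longlonglongrightarrow> norm (\<alpha> * \<beta>)"
    using tendsto_norm by fastforce
  moreover obtain r where r: "norm (\<alpha> * \<beta>) < r" "r < 1"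
    using \<alpha>\<beta>_less dense by blast
  ultimately have "eventually (\<lambda>n. norm (b n) < r) sequentially"
    by (simp add: order_tendstoD)
  then obtain N where N: "\<And>n. n \<ge> N \<Longrightarrow> norm (b n) < r"
    by (auto simp: eventually_sequentially)
  show ?thesis
  proof (rule summable_ratio_test[OF r(2), of N])
    fix n assume "n \<ge> N"
    have "c (int (Suc n)) = b n * c (int n)"
      using c_rec[of "int n"] by (simp add: b_def power_int_def nat_add_distrib add.commute)
    then show "norm (norm (c (int (Suc n)))) \<le> r * norm (norm (c (int n)))"
      using N[OF \<open>n \<ge> N\<close>] by (simp add: norm_mult mult_right_mono)
  qed
qed

text \<open>At index -1-m the arguments of the infinite products grow like p^(-m), which defeats
  termwise bounds. The recurrence for \<open>e\<close>, run backwards from -1, cancels this growth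
  against \<open>c\<close> and leaves p^(2m) times products that stay bounded in m.\<close>

lemma e_neg:
  assumes "y \<noteq> 0"
  shows "e (- 1 - int m) y = p ^ (2 * m) * (qpoch_inf (y * p) p * qpoch_inf (p / y) p *
           (\<Prod>k<m. 1 - y * p ^ k) * (\<Prod>k<m. 1 - 1 / y * p ^ k) *
           inverse (\<Prod>k<Suc m. 1 - \<alpha> * p ^ k) * inverse (\<Prod>k<Suc m. 1 - \<beta> * p ^ k))"
proof (induction m)
  case 0
  have "c 0 = (\<alpha> - 1) * (\<beta> - 1) * c (- 1)"
    using c_rec[of "-1"] by simp
  then have "(1 - \<alpha>) * (1 - \<beta>) * c (- 1) = 1"
    using c_0 by (simp add: algebra_simps)
  then have "c (- 1) = inverse (1 - \<alpha>) * inverse (1 - \<beta>)"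
    using inverse_unique by (metis inverse_mult_distrib)
  then show ?case by (simp add: e_def)
next
  case (Suc m)
  define P where "P = p ^ m"
  define n where "n = - 1 - int (Suc m)"
  have P: "P \<noteq> 0" "p powi (n + 1) = inverse (P * p)" "p powi (n + 2) = inverse P"
    using p_nz by (simp_all add: P_def n_def power_int_def nat_add_distrib power_inverse)
  have ne: "\<alpha> * P * p \<noteq> 1" "\<beta> * P * p \<noteq> 1"
    using \<alpha>_ne[of "Suc m"] \<beta>_ne[of "Suc m"] by (simp_all add: P_def mult_ac)
  have "W (n + 1) y = (1 - y * p powi (n + 2)) * (1 - p powi (n + 2) / y) * e (n + 1) y"
    using W_eq[of "n + 1" y] by (simp add: add.assoc)
  then have *: "(\<alpha> - inverse (P * p)) * (\<beta> - inverse (P * p)) * e n y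
      = (1 - y * inverse P) * (1 - inverse P / y) * e (n + 1) y"
    unfolding W_Suc_eq P by simp
  \<comment> \<open>Extracting the negative powers of p from both sides leaves (Pp)^(-2) against
    P^(-2). Their ratio is the p^2 gained in each step.\<close>
  have "(\<alpha> - inverse (P * p)) * (\<beta> - inverse (P * p)) = (1 - \<alpha> * P * p) * (1 - \<beta> * P * p) / (P * p)\<^sup>2"
    using P p_nz by (simp add: field_simps power2_eq_square)
  moreover have "(1 - y * inverse P) * (1 - inverse P / y) = (1 - y * P) * (1 - 1 / y * P) / P\<^sup>2"
    using P assms by (simp add: field_simps power2_eq_square)
  ultimately have "(1 - \<alpha> * P * p) * (1 - \<beta> * P * p) / (P * p)\<^sup>2 * e n y
      = (1 - y * P) * (1 - 1 / y * P) / P\<^sup>2 * e (n + 1) y"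
    using * by simp
  then have "e n y = p\<^sup>2 * ((1 - y * P) * (1 - 1 / y * P)) * inverse (1 - \<alpha> * P * p) * inverse (1 - \<beta> * P * p) * e (n + 1) y"
    using ne P(1) p_nz assms by (simp add: divide_simps) (simp add: power2_eq_square mult_ac)
  also have "n + 1 = - 1 - int m" by (simp add: n_def)
  finally show ?case
    unfolding n_def[symmetric] Suc.IH P_def
    by (simp add: mult_ac power2_eq_square)
qed

text \<open>One majorant serves \<open>E0\<close> and \<open>E1\<close>: at n = -1-m the decay
  p^(2m) of \<open>e\<close> pays for the factor p^(n+1) = p^(-m) in \<open>E1\<close> and still
  leaves p^m.\<close>

lemma e_bound:
  assumes "R > 0"
  shows "\<exists>M. M summable_on UNIV \<and> (\<forall>n y. y \<noteq> 0 \<longrightarrow> norm y \<le> R \<longrightarrow> norm (1 / y) \<le> R \<longrightarrow>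
            norm (e n y) \<le> M n \<and> norm (p powi (n + 1) * e n y) \<le> M n)"
proof -
  define B where "B = exp (R / (1 - norm p))"
  have B: "B > 0" by (simp add: B_def)
  have qB: "norm (qpoch_inf a p) \<le> B" if "norm a \<le> R" for a
    using norm_qpoch_inf_le[OF p_less, of a] that p_less
    by (auto simp: B_def intro!: divide_right_mono elim!: order_trans)
  have pB: "norm (\<Prod>k<n. 1 - a * p ^ k) \<le> B" if "norm a \<le> R" for a n
    using norm_prod_qpoch_le[OF p_less, of a n] that p_less
    by (auto simp: B_def intro!: divide_right_mono elim!: order_trans)
  obtain K1 where K1: "K1 > 0" "\<And>n. norm (inverse (\<Prod>k<n. 1 - \<alpha> * p ^ k)) \<le> K1"
    using prod_qpoch_inverse_bounded[OF p_less \<alpha>_ne] by blast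
  obtain K2 where K2: "K2 > 0" "\<And>n. norm (inverse (\<Prod>k<n. 1 - \<beta> * p ^ k)) \<le> K2"
    using prod_qpoch_inverse_bounded[OF p_less \<beta>_ne] by blast
  define K where "K = B * B * B * B * K1 * K2"
  define M where "M = (\<lambda>n::int. if n \<ge> 0 then norm (c n) * (B * B) else norm p ^ nat (- 1 - n) * K)"
  have M_pos: "M (int n) = norm (c (int n)) * (B * B)" for n by (simp add: M_def)
  have M_neg: "M (- 1 - int n) = norm p ^ n * K" for n by (simp add: M_def)
  have K: "K > 0" using B K1 K2 by (simp add: K_def)
  have "M summable_on UNIV"
  proof (rule summable_on_int_halves)
    show "summable (\<lambda>n. norm (M (int n)))"
      unfolding M_pos using summable_mult2[OF summable_c, of "B * B"] B by (simp add: norm_mult abs_mult)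
    show "summable (\<lambda>n. norm (M (- 1 - int n)))"
      unfolding M_neg using p_less K
      by (simp add: norm_mult norm_power abs_mult) (intro summable_mult2 summable_geometric, simp)
  qed
  moreover have "norm (e n y) \<le> M n \<and> norm (p powi (n + 1) * e n y) \<le> M n"
    if y: "y \<noteq> 0" "norm y \<le> R" "norm (1 / y) \<le> R" for n y
  proof (cases "n \<ge> 0")
    case True
    have small: "norm (p powi k) \<le> 1" if "k \<ge> 0" for k
      using p_less that by (simp add: power_int_def norm_power power_le_one)
    have "norm y * norm (p powi (n + 2)) \<le> R * 1" "norm (1 / y) * norm (p powi (n + 2)) \<le> R * 1"
      using y small[of "n + 2"] True assms by (intro mult_mono; simp)+
    then have "norm (qpoch_inf (y * p powi (n + 2)) p) \<le> B" "norm (qpoch_inf (p powi (n + 2) / y) p) \<le> B"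
      by (auto intro!: qB simp: norm_mult norm_divide)
    then have "norm (e n y) \<le> norm (c n) * (B * B)"
      unfolding e_def norm_mult mult.assoc using B by (intro mult_mono) auto
    moreover have "norm (p powi (n + 1) * e n y) \<le> 1 * norm (e n y)"
      unfolding norm_mult using small[of "n + 1"] True by (intro mult_right_mono) auto
    ultimately show ?thesis using True by (simp add: M_def)
  next
    case False
    define m where "m = nat (- 1 - n)"
    have m: "n = - 1 - int m" using False by (simp add: m_def)
    define X where "X = qpoch_inf (y * p) p * qpoch_inf (p / y) p *
           (\<Prod>k<m. 1 - y * p ^ k) * (\<Prod>k<m. 1 - 1 / y * p ^ k) *
           inverse (\<Prod>k<Suc m. 1 - \<alpha> * p ^ k) * inverse (\<Prod>k<Suc m. 1 - \<beta> * p ^ k)"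
    have "norm y * norm p \<le> R * 1" "norm (1 / y) * norm p \<le> R * 1"
      using y p_less assms by (intro mult_mono; simp)+
    then have "norm (qpoch_inf (y * p) p) \<le> B" "norm (qpoch_inf (p / y) p) \<le> B"
      by (auto intro!: qB simp: norm_mult norm_divide)
    then have X: "norm X \<le> K"
      unfolding X_def K_def norm_mult
      by (intro mult_mono mult_nonneg_nonneg norm_ge_zero less_imp_le[OF B] less_imp_le[OF K1(1)]
            less_imp_le[OF K2(1)] pB y(2,3) K1(2) K2(2)) assumption+
    have eX: "e n y = p ^ (2 * m) * X"
      unfolding m e_neg[OF y(1)] X_def by simp
    have "norm p ^ (2 * m) \<le> norm p ^ m"
      using p_less by (intro power_decreasing) auto
    then have 1: "norm (e n y) \<le> norm p ^ m * K"
      unfolding eX norm_mult norm_power using X by (intro mult_mono) auto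
    have "p powi (n + 1) * e n y = p ^ m * X"
      unfolding eX unfolding m using p_nz by (simp add: power_int_minus mult_2 power_add)
    then have 2: "norm (p powi (n + 1) * e n y) \<le> norm p ^ m * K"
      using X by (simp add: norm_mult norm_power mult_left_mono)
    show ?thesis using 1 2 unfolding m M_neg by simp
  qed
  ultimately show ?thesis by blast
qed

lemma summable_e:
  assumes "y \<noteq> 0"
  shows "(\<lambda>n. e n y) summable_on UNIV" "(\<lambda>n. p powi (n + 1) * e n y) summable_on UNIV"
proof -
  define R where "R = max (norm y) (norm (1 / y))"
  have "R > 0" using assms by (simp add: R_def less_max_iff_disj)
  from e_bound[OF this] obtain M where M: "M summable_on UNIV"
     "\<And>n. norm (e n y) \<le> M n" "\<And>n. norm (p powi (n + 1) * e n y) \<le> M n"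
    using assms unfolding R_def by auto
  show "(\<lambda>n. e n y) summable_on UNIV" "(\<lambda>n. p powi (n + 1) * e n y) summable_on UNIV"
    by (rule abs_summable_summable, rule Infinite_Sum.abs_summable_on_comparison_test'[OF M(1)], rule M(2,3))+
qed

lemma e_holomorphic: "e n holomorphic_on - {0}"
  unfolding e_def using p_less by (auto intro!: holomorphic_intros)

lemma E0_holomorphic: "E0 holomorphic_on - {0}"
  unfolding E0_def[abs_def]
proof (rule holomorphic_on_infsum_punctured_plane[OF e_holomorphic])
  fix R :: real assume "R > 0"
  from e_bound[OF this] obtain M where "M summable_on UNIV"
    "\<forall>n y. y \<noteq> 0 \<longrightarrow> norm y \<le> R \<longrightarrow> norm (1 / y) \<le> R \<longrightarrow>
       norm (e n y) \<le> M n \<and> norm (p powi (n + 1) * e n y) \<le> M n" by blast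
  then show "\<exists>M. M summable_on UNIV \<and>
      (\<forall>n y. y \<noteq> 0 \<longrightarrow> norm y \<le> R \<longrightarrow> norm (1 / y) \<le> R \<longrightarrow> norm (e n y) \<le> M n)"
    by (intro exI[of _ M]) simp
qed

lemma E1_holomorphic: "E1 holomorphic_on - {0}"
  unfolding E1_def[abs_def]
proof (rule holomorphic_on_infsum_punctured_plane)
  show "(\<lambda>y. p powi (n + 1) * e n y) holomorphic_on - {0}" for n
    by (intro holomorphic_intros e_holomorphic)
next
  fix R :: real assume "R > 0"
  from e_bound[OF this] obtain M where "M summable_on UNIV"
    "\<forall>n y. y \<noteq> 0 \<longrightarrow> norm y \<le> R \<longrightarrow> norm (1 / y) \<le> R \<longrightarrow>
       norm (e n y) \<le> M n \<and> norm (p powi (n + 1) * e n y) \<le> M n" by blast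
  then show "\<exists>M. M summable_on UNIV \<and>
      (\<forall>n y. y \<noteq> 0 \<longrightarrow> norm y \<le> R \<longrightarrow> norm (1 / y) \<le> R \<longrightarrow> norm (p powi (n + 1) * e n y) \<le> M n)"
    by (intro exI[of _ M]) simp
qed

lemma has_sum_linear:
  assumes "y \<noteq> 0"
  shows "((\<lambda>n. (a + b * p powi (n + 1)) * e n y) has_sum (a * E0 y + b * E1 y)) UNIV"
proof -
  have "((\<lambda>n. a * e n y + b * (p powi (n + 1) * e n y)) has_sum (a * E0 y + b * E1 y)) UNIV"
    unfolding E0_def E1_def using summable_e[OF assms]
    by (intro has_sum_add has_sum_cmult_right has_sum_infsum)
  then show ?thesis by (simp add: algebra_simps)
qed

lemma H_eq: "y \<noteq> 0 \<Longrightarrow> H y = E0 y - y * E1 y"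
  unfolding H_def H_summand using infsumI[OF has_sum_linear[of y 1 "- y"]] by simp

lemma H_shift_eq: "y \<noteq> 0 \<Longrightarrow> H (p * y) = E0 y - E1 y / y"
  unfolding H_def H_shift_summand using infsumI[OF has_sum_linear[of y 1 "- 1 / y"]] by simp

lemma H_holomorphic: "H holomorphic_on - {0}"
proof (rule holomorphic_transform)
  show "(\<lambda>y. E0 y - y * E1 y) holomorphic_on - {0}"
    by (intro holomorphic_intros E0_holomorphic E1_holomorphic)
qed (simp add: H_eq)

section \<open>Telescoping and the q-difference equation of \<open>H\<close>\<close>

lemma W_tendsto_0:
  assumes "y \<noteq> 0"
  shows "(\<lambda>n. W (int n) y) \<longlonglongrightarrow> 0"
proof -
  have "(\<lambda>n. c (int n)) \<longlonglongrightarrow> 0"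
    using summable_LIMSEQ_zero[OF summable_norm_cancel[OF summable_c]] .
  moreover have "(\<lambda>n. qpoch_inf (y * p powi (int n + 1)) p) \<longlonglongrightarrow> qpoch_inf (y * 0) p"
    "(\<lambda>n. qpoch_inf (p powi (int n + 1) / y) p) \<longlonglongrightarrow> qpoch_inf (0 / y) p"
  proof -
    have "isCont (\<lambda>a. qpoch_inf a p) 0"
      using holomorphic_on_imp_differentiable_at[OF qpoch_inf_holomorphic[OF p_less, of UNIV]]
      by (simp add: field_differentiable_imp_continuous_at)
    moreover have "(\<lambda>n. p powi (int n + 1)) \<longlonglongrightarrow> 0"
      using LIMSEQ_Suc[OF LIMSEQ_power_zero[OF p_less]]
      by (simp add: power_int_def nat_add_distrib add.commute)
    then have "(\<lambda>n. y * p powi (int n + 1)) \<longlonglongrightarrow> 0" "(\<lambda>n. p powi (int n + 1) / y) \<longlonglongrightarrow> 0"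
      by (auto intro: tendsto_mult_right_zero tendsto_divide_zero)
    ultimately show "(\<lambda>n. qpoch_inf (y * p powi (int n + 1)) p) \<longlonglongrightarrow> qpoch_inf (y * 0) p"
      "(\<lambda>n. qpoch_inf (p powi (int n + 1) / y) p) \<longlonglongrightarrow> qpoch_inf (0 / y) p"
      using isCont_tendsto_compose by fastforce+
  qed
  ultimately have "(\<lambda>n. c (int n) * qpoch_inf (y * p powi (int n + 1)) p * qpoch_inf (p powi (int n + 1) / y) p)
      \<longlonglongrightarrow> 0 * qpoch_inf (y * 0) p * qpoch_inf (0 / y) p"
    by (intro tendsto_mult)
  then show ?thesis by (simp add: W_def)
qed

text \<open>The boundary value of \<open>W\<close> at minus infinity. As \<open>W\<close> tends to 0
  at plus infinity, it is the whole inhomogeneous term of the q-difference equation.\<close>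

definition wlim :: "complex \<Rightarrow> complex" where
  "wlim y = - (\<theta> y)\<^sup>2 / (y * qpoch_inf \<alpha> p * qpoch_inf \<beta> p)"

lemma W_tendsto_wlim:
  assumes "y \<noteq> 0"
  shows "(\<lambda>n. W (- int n) y) \<longlonglongrightarrow> wlim y"
proof -
  let ?X = "\<lambda>m. qpoch_inf (y * p) p * qpoch_inf (p / y) p *
           (\<Prod>k<m. 1 - y * p ^ k) * (\<Prod>k<m. 1 - 1 / y * p ^ k) *
           inverse (\<Prod>k<Suc m. 1 - \<alpha> * p ^ k) * inverse (\<Prod>k<Suc m. 1 - \<beta> * p ^ k)"
  have nz: "qpoch_inf \<alpha> p \<noteq> 0" "qpoch_inf \<beta> p \<noteq> 0"
    using qpoch_inf_nonzero[OF p_less] \<alpha>_ne \<beta>_ne by auto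
  have pn: "(\<lambda>n. p ^ n) \<longlonglongrightarrow> 0" by (rule LIMSEQ_power_zero[OF p_less])
  have "W (- int m) y = (\<alpha> * p ^ m - 1) * (\<beta> * p ^ m - 1) * ?X m" for m
  proof -
    have "W (- int m) y = (\<alpha> - inverse (p ^ m)) * (\<beta> - inverse (p ^ m)) * e (- 1 - int m) y"
      using W_Suc_eq[of "- 1 - int m" y] by (simp add: power_int_minus)
    also have "(\<alpha> - inverse (p ^ m)) * (\<beta> - inverse (p ^ m)) * (p ^ (2 * m) * Z) = (\<alpha> * p ^ m - 1) * (\<beta> * p ^ m - 1) * Z" for Z
      unfolding power_even_eq using p_nz by (simp add: power2_eq_square field_simps)
    note this[of "?X m", folded e_neg[OF assms]]
    finally show ?thesis .
  qed
  moreover have "(\<lambda>m. (\<alpha> * p ^ m - 1) * (\<beta> * p ^ m - 1) * ?X m) \<longlonglongrightarrow>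
      (\<alpha> * 0 - 1) * (\<beta> * 0 - 1) * (qpoch_inf (y * p) p * qpoch_inf (p / y) p *
        qpoch_inf y p * qpoch_inf (1 / y) p * inverse (qpoch_inf \<alpha> p) * inverse (qpoch_inf \<beta> p))"
    by (intro tendsto_intros pn qpoch_inf_LIMSEQ p_less LIMSEQ_Suc[OF qpoch_inf_LIMSEQ] nz)
  \<comment> \<open>Two of the four limiting products form \<theta>(1/y), which reflects to a
    multiple of \<theta>(y); the other two are \<theta>(y) itself. Hence the square.\<close>
  moreover have "qpoch_inf (1 / y) p * qpoch_inf (y * p) p = - \<theta> y / y"
  proof -
    have 1: "qpoch_inf (1 / y) p = (1 - 1 / y) * qpoch_inf (p / y) p"
      using qpoch_inf_rec[OF p_less, of "1 / y"] by simp
    have 2: "qpoch_inf y p = (1 - y) * qpoch_inf (y * p) p"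
      by (rule qpoch_inf_rec[OF p_less])
    show ?thesis
      unfolding \<theta>_def 1 2 using assms by (simp add: field_simps)
  qed
  then have "(\<alpha> * 0 - 1) * (\<beta> * 0 - 1) * (qpoch_inf (y * p) p * qpoch_inf (p / y) p *
        qpoch_inf y p * qpoch_inf (1 / y) p * inverse (qpoch_inf \<alpha> p) * inverse (qpoch_inf \<beta> p)) = wlim y" (is "?lhs = _")
  proof -
    assume *: "qpoch_inf (1 / y) p * qpoch_inf (y * p) p = - \<theta> y / y"
    have "?lhs = (qpoch_inf (1 / y) p * qpoch_inf (y * p) p) * \<theta> y *
        inverse (qpoch_inf \<alpha> p) * inverse (qpoch_inf \<beta> p)"
      by (simp add: \<theta>_def mult_ac)
    also have "\<dots> = wlim y"
      unfolding * by (simp add: wlim_def power2_eq_square field_simps)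
    finally show ?thesis .
  qed
  ultimately show ?thesis by simp
qed

text \<open>With P = p^(n+1), both (1 - yP)(1 - P/y) and (\<alpha> - P)(\<beta> - P) have leading
  term P^2. Their difference is linear in P, so \<open>W n y - W (n + 1) y\<close> involves no sums
  other than \<open>E0\<close> and \<open>E1\<close>.\<close>

lemma telescoped_sum:
  assumes "y \<noteq> 0"
  shows "(1 - \<alpha> * \<beta>) * E0 y - (y + 1 / y - \<alpha> - \<beta>) * E1 y = wlim y"
proof -
  have eq: "W n y - W (n + 1) y = ((1 - \<alpha> * \<beta>) + (- (y + 1 / y - \<alpha> - \<beta>)) * p powi (n + 1)) * e n y" for n
    unfolding W_eq[of n] W_Suc_eq[of n] using assms by (simp add: field_simps)
  note sum = has_sum_linear[OF assms, of "1 - \<alpha> * \<beta>" "- (y + 1 / y - \<alpha> - \<beta>)"]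
  have "((\<lambda>n. W n y - W (n + 1) y) has_sum (wlim y - 0)) UNIV"
    using sum eq summable_on_def assms
    by (intro has_sum_int_telescope W_tendsto_0 W_tendsto_wlim) auto
  from has_sum_unique[OF this[unfolded eq] sum] show ?thesis
    by (simp add: algebra_simps)
qed

text \<open>\<open>H y\<close>, \<open>H (p * y)\<close> and \<open>wlim y\<close> are three linear
  forms in \<open>E0 y\<close> and \<open>E1 y\<close>; this is the dependency among them.\<close>

lemma H_functional:
  assumes "y \<noteq> 0"
  shows "(1 - \<alpha> * y) * (1 - \<beta> * y) * H (p * y) = (y - \<alpha>) * (y - \<beta>) * H y + (1 - y\<^sup>2) * wlim y"
proof -
  have "y * (1 / y) = 1" using assms by simp
  then have "(1 - \<alpha> * y) * (1 - \<beta> * y) * (a - b * (1 / y)) = (y - \<alpha>) * (y - \<beta>) * (a - y * b)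
      + (1 - y\<^sup>2) * ((1 - \<alpha> * \<beta>) * a - (y + 1 / y - \<alpha> - \<beta>) * b)" for a b
    by algebra
  from this[of "E0 y" "E1 y"] show ?thesis
    unfolding telescoped_sum[OF assms, symmetric] H_eq[OF assms] H_shift_eq[OF assms] by simp
qed

text \<open>For \<beta> = -1 every term of the general equation contains the factor 1 + y. It is
  cancelled in the coefficients of \<open>E0\<close> and \<open>E1\<close>, not by dividing values,
  so the point y = -1 is covered.\<close>

lemma H_functional_minus_one:
  assumes "y \<noteq> 0" "\<beta> = -1"
  shows "(1 - \<alpha> * y) * H (p * y) = (y - \<alpha>) * H y + (1 - y) * wlim y"
proof -
  have "y * (1 / y) = 1" using assms by simp
  then have "(1 - \<alpha> * y) * (a - b * (1 / y)) = (y - \<alpha>) * (a - y * b)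
      + (1 - y) * ((1 - \<alpha> * \<beta>) * a - (y + 1 / y - \<alpha> - \<beta>) * b)" for a b
    using assms(2) by algebra
  from this[of "E0 y" "E1 y"] show ?thesis
    unfolding telescoped_sum[OF assms(1), symmetric] H_eq[OF assms(1)] H_shift_eq[OF assms(1)]
    by simp
qed

text \<open>
  At \<open>y = 1\<close> only the terms with \<open>n \<ge> 0\<close> survive, and \<open>H 1\<close> is a \<open>q\<close>-Gauss sum. It is evaluated
  by inserting a parameter \<open>t\<close>, relating \<open>V t\<close> to \<open>V (p * t)\<close> and iterating towards \<open>t = 0\<close>.
\<close>
definition u :: "nat \<Rightarrow> complex \<Rightarrow> complex" where
  "u n t = c (int n) * t ^ n * qpoch_inf (t * p ^ (n + 2)) p * qpoch_inf (p ^ (n + 1)) p"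

definition V :: "complex \<Rightarrow> complex" where
  "V t = (\<Sum>n. u n t)"

lemma u_bound:
  assumes "norm t \<le> 1"
  shows "norm (u n t) \<le> norm (c (int n)) * exp (1 / (1 - norm p)) ^ 2"
proof -
  have qB: "norm (qpoch_inf a p) \<le> exp (1 / (1 - norm p))" if "norm a \<le> 1" for a
    using norm_qpoch_inf_le[OF p_less, of a] that p_less
    by (auto intro!: divide_right_mono elim!: order_trans)
  have small: "norm (p ^ k) \<le> 1" for k
    using p_less by (simp add: norm_power power_le_one)
  have "norm (t * p ^ (n + 2)) \<le> 1 * 1"
    unfolding norm_mult by (intro mult_mono small assms) auto
  then have 1: "norm (qpoch_inf (t * p ^ (n + 2)) p) \<le> exp (1 / (1 - norm p))"
    by (intro qB) simp
  have 2: "norm (qpoch_inf (p ^ (n + 1)) p) \<le> exp (1 / (1 - norm p))"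
    by (intro qB small)
  have "norm t ^ n \<le> 1" using assms by (simp add: power_le_one)
  then have "norm (u n t) \<le> norm (c (int n)) * 1 * exp (1 / (1 - norm p)) * exp (1 / (1 - norm p))"
    unfolding u_def norm_mult norm_power[of t]
    by (intro mult_mono mult_nonneg_nonneg order.refl 1 2) auto
  then show ?thesis by (simp add: power2_eq_square)
qed

lemma summable_u_majorant: "summable (\<lambda>n. norm (c (int n)) * exp (1 / (1 - norm p)) ^ 2)"
  by (rule summable_mult2[OF summable_c])

lemma summable_norm_u:
  assumes "norm t \<le> 1"
  shows "summable (\<lambda>n. norm (u n t))"
  by (rule summable_comparison_test'[OF summable_u_majorant]) (use u_bound[OF assms] in simp)

lemma V_functional:
  assumes "norm t \<le> 1"
  shows "(1 - t * \<alpha> * \<beta>) * V t = (1 - t * p * \<alpha>) * (1 - t * p * \<beta>) * V (p * t)"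
proof -
  have pt: "norm (p * t) \<le> 1"
    using mult_mono[of "norm p" 1 "norm t" 1] p_less assms by (simp add: norm_mult)
  \<comment> \<open>The telescoping certificate for the parameter \<open>t\<close>. The factor 1 -
    p^n makes it vanish at n = 0, and \<open>u n t\<close> tends to 0, so neither end
    contributes.\<close>
  define g where "g = (\<lambda>n. u n t * (1 - p ^ n))"
  have u_sums: "(\<lambda>n. u n s) sums V s" if "norm s \<le> 1" for s
    unfolding V_def by (rule summable_sums[OF summable_norm_cancel[OF summable_norm_u[OF that]]])
  have "(\<lambda>n. u n t) \<longlonglongrightarrow> 0"
    using summable_LIMSEQ_zero[OF summable_norm_cancel[OF summable_norm_u[OF assms]]] .
  then have "g \<longlonglongrightarrow> 0 * (1 - 0)"
    unfolding g_def by (intro tendsto_intros LIMSEQ_power_zero p_less)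
  then have "(\<lambda>n. g n - g (Suc n)) sums (g 0 - 0)"
    by (intro telescope_sums') simp
  then have g: "(\<lambda>n. g n - g (Suc n)) sums 0" by (simp add: g_def)
  have eq: "g n - g (Suc n) = (1 - t * \<alpha> * \<beta>) * u n t - (1 - t * p * \<alpha>) * (1 - t * p * \<beta>) * u n (p * t)" for n
  proof -
    \<comment> \<open>\<open>D\<close> is the factor common to \<open>u n t\<close>,
      \<open>u n (p * t)\<close> and \<open>u (Suc n) t\<close>; with it split off, the claim is
      polynomial in \<open>N\<close>.\<close>
    define N D where "N = p ^ n"
      and "D = c (int n) * t ^ n * qpoch_inf (t * p ^ (n + 3)) p * qpoch_inf (p ^ (n + 2)) p"
    have rec1: "qpoch_inf (t * p ^ (n + 2)) p = (1 - t * p\<^sup>2 * N) * qpoch_inf (t * p ^ (n + 3)) p"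
      using qpoch_inf_rec[OF p_less, of "t * p ^ (n + 2)"]
      by (simp add: N_def power_add power2_eq_square power3_eq_cube mult_ac)
    have rec2: "qpoch_inf (p ^ (n + 1)) p = (1 - p * N) * qpoch_inf (p ^ (n + 2)) p"
      using qpoch_inf_rec[OF p_less, of "p ^ (n + 1)"] by (simp add: N_def mult_ac)
    have c: "c (int (Suc n)) = (\<alpha> - p * N) * (\<beta> - p * N) * c (int n)"
      using c_rec[of "int n"] by (simp add: N_def power_int_def nat_add_distrib add.commute)
    have u1: "u n t = (1 - p * N) * (1 - t * p\<^sup>2 * N) * D"
      unfolding u_def rec1 rec2 by (simp add: D_def)
    have u2: "u n (p * t) = N * (1 - p * N) * D"
    proof -
      have "p * t * p ^ (n + 2) = t * p ^ (n + 3)" by (simp add: power_add power2_eq_square power3_eq_cube)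
      then show ?thesis unfolding u_def rec2 by (simp only: D_def N_def power_mult_distrib) (simp add: mult_ac)
    qed
    have u3: "u (Suc n) t = (\<alpha> - p * N) * (\<beta> - p * N) * t * D"
      unfolding u_def c by (simp add: D_def numeral_3_eq_3)
    show ?thesis
      unfolding g_def u1 u2 u3 power_Suc N_def[symmetric] by algebra
  qed
  have "(\<lambda>n. g n - g (Suc n)) sums ((1 - t * \<alpha> * \<beta>) * V t - (1 - t * p * \<alpha>) * (1 - t * p * \<beta>) * V (p * t))"
    unfolding eq by (intro sums_diff sums_mult u_sums assms pt)
  from sums_unique2[OF this g] show ?thesis by simp
qed

lemma V_iterate:
  "(\<Prod>k<N. 1 - \<alpha> * \<beta> * p ^ k) * V 1
     = (\<Prod>k<N. 1 - p * \<alpha> * p ^ k) * (\<Prod>k<N. 1 - p * \<beta> * p ^ k) * V (p ^ N)"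
proof (induction N)
  case (Suc N)
  have "norm (p ^ N) \<le> 1" using p_less by (simp add: norm_power power_le_one)
  note step = V_functional[OF this]
  let ?P = "(\<Prod>k<N. 1 - p * \<alpha> * p ^ k) * (\<Prod>k<N. 1 - p * \<beta> * p ^ k)"
  have "(\<Prod>k<Suc N. 1 - \<alpha> * \<beta> * p ^ k) * V 1
      = (1 - \<alpha> * \<beta> * p ^ N) * ((\<Prod>k<N. 1 - \<alpha> * \<beta> * p ^ k) * V 1)"
    by (simp add: mult_ac)
  also have "\<dots> = ?P * ((1 - p ^ N * \<alpha> * \<beta>) * V (p ^ N))"
    unfolding Suc by (simp add: mult_ac)
  also have "\<dots> = (\<Prod>k<Suc N. 1 - p * \<alpha> * p ^ k) * (\<Prod>k<Suc N. 1 - p * \<beta> * p ^ k) * V (p ^ Suc N)"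
    unfolding step by (simp add: mult_ac)
  finally show ?case .
qed simp

text \<open>As t tends to 0 the factor t^n leaves only the term n = 0; a majorant independent of t
  permits the interchange of limit and sum.\<close>

lemma V_tendsto: "(\<lambda>N. V (p ^ N)) \<longlonglongrightarrow> qpoch_inf p p"
proof -
  have lim: "(\<lambda>N. u n (p ^ N)) \<longlonglongrightarrow> (if n = 0 then qpoch_inf p p else 0)" for n
  proof -
    have "isCont (\<lambda>t. u n t) 0"
    proof -
      have "(\<lambda>t. u n t) holomorphic_on UNIV"
        unfolding u_def using p_less by (auto intro!: holomorphic_intros)
      then show ?thesis
        using holomorphic_on_imp_differentiable_at by (simp add: field_differentiable_imp_continuous_at)
    qed
    then have "(\<lambda>N. u n (p ^ N)) \<longlonglongrightarrow> u n 0"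
      using isCont_tendsto_compose LIMSEQ_power_zero[OF p_less] by blast
    then show ?thesis by (cases "n = 0") (auto simp: u_def c_0 zero_power)
  qed
  have "(\<lambda>N. \<Sum>n. u n (p ^ N)) \<longlonglongrightarrow> (\<Sum>n. if n = 0 then qpoch_inf p p else 0)"
  proof (rule tannerys_theorem[where M = "\<lambda>n. norm (c (int n)) * exp (1 / (1 - norm p)) ^ 2", THEN conjunct2, THEN conjunct2])
    show "\<forall>\<^sub>F (n, N) in at_top \<times>\<^sub>F sequentially. norm (u n (p ^ N)) \<le> norm (c (int n)) * exp (1 / (1 - norm p)) ^ 2"
      using u_bound p_less by (auto simp: norm_power power_le_one intro!: always_eventually)
  qed (use lim summable_u_majorant in auto)
  moreover have "(\<Sum>n. if n = (0::nat) then qpoch_inf p p else 0) = qpoch_inf p p"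
    using suminf_finite[of "{0::nat}" "\<lambda>n. if n = 0 then qpoch_inf p p else 0"] by simp
  ultimately show ?thesis unfolding V_def[symmetric] by simp
qed

lemma V_one: "V 1 = qpoch_inf p p * qpoch_inf (p * \<alpha>) p * qpoch_inf (p * \<beta>) p / qpoch_inf (\<alpha> * \<beta>) p"
proof -
  have "(\<lambda>N. (\<Prod>k<N. 1 - \<alpha> * \<beta> * p ^ k) * V 1) \<longlonglongrightarrow> qpoch_inf (\<alpha> * \<beta>) p * V 1"
    by (intro tendsto_intros qpoch_inf_LIMSEQ p_less)
  moreover have "(\<lambda>N. (\<Prod>k<N. 1 - p * \<alpha> * p ^ k) * (\<Prod>k<N. 1 - p * \<beta> * p ^ k) * V (p ^ N))
      \<longlonglongrightarrow> qpoch_inf (p * \<alpha>) p * qpoch_inf (p * \<beta>) p * qpoch_inf p p"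
    by (intro tendsto_intros qpoch_inf_LIMSEQ p_less V_tendsto)
  ultimately have "qpoch_inf (\<alpha> * \<beta>) p * V 1 = qpoch_inf (p * \<alpha>) p * qpoch_inf (p * \<beta>) p * qpoch_inf p p"
    unfolding V_iterate using LIMSEQ_unique by blast
  moreover have "qpoch_inf (\<alpha> * \<beta>) p \<noteq> 0"
    by (rule qpoch_inf_nonzero'[OF p_less \<alpha>\<beta>_less])
  ultimately show ?thesis by (simp add: field_simps)
qed

section \<open>Inversion symmetry and the value at y = 1\<close>

lemma e_inverse: "e n (1 / y) = e n y"
  by (simp add: e_def mult_ac)

lemma E0_inverse: "E0 (1 / y) = E0 y" and E1_inverse: "E1 (1 / y) = E1 y"
  by (simp_all only: E0_def E1_def e_inverse)

text \<open>Because \<open>E0\<close> and \<open>E1\<close> are invariant under y -> 1/y,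
  \<open>H_shift_eq\<close> at 1/y has the same right-hand side as \<open>H_eq\<close> at y.\<close>

lemma H_reflect:
  assumes "y \<noteq> 0"
  shows "H (p / y) = H y"
  using H_shift_eq[of "1 / y"] H_eq[OF assms] assms by (simp add: E0_inverse E1_inverse)

lemma H_one: "H 1 = qpoch_inf p p * qpoch_inf (p * \<alpha>) p * qpoch_inf (p * \<beta>) p / qpoch_inf (\<alpha> * \<beta>) p"
proof -
  let ?f = "\<lambda>n. c n * qpoch_inf (1 * p powi (n + 1)) p * qpoch_inf (p powi (n + 2) / 1) p"
  have "?f n = 0" if "n \<notin> range int" for n
  proof -
    have "n < 0" using that by (metis not_le rangeI zero_le_imp_eq_int)
    define m where "m = nat (- 1 - n)"
    have "n + 1 = - int m" using \<open>n < 0\<close> by (simp add: m_def)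
    \<comment> \<open>For n = -1-m the factor with index m of the first infinite product is 1 - 1,
      which removes all negative indices.\<close>
    then have "p powi (n + 1) * p ^ m = 1"
      using p_nz by (simp add: power_int_minus)
    then have "(\<Prod>k<Suc (m). 1 - p powi (n + 1) * p ^ k) = 0" by simp
    then have "eventually (\<lambda>N. (\<Prod>k<N. 1 - p powi (n + 1) * p ^ k) = 0) sequentially"
      by (intro eventually_sequentiallyI[of "Suc (m)"]) (auto simp: prod_zero_iff)
    then have "(\<lambda>N. (\<Prod>k<N. 1 - p powi (n + 1) * p ^ k)) \<longlonglongrightarrow> 0" by (rule tendsto_eventually)
    then have "qpoch_inf (p powi (n + 1)) p = 0" by (rule qpoch_inf_eqI[OF p_less])
    then show ?thesis by simp
  qed
  then have "H 1 = infsum ?f (range int)"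
    unfolding H_def by (intro infsum_cong_neutral) auto
  also have "\<dots> = infsum (\<lambda>n. ?f (int n)) UNIV"
    by (subst infsum_reindex) (auto simp: o_def)
  also have "(\<lambda>n. ?f (int n)) = (\<lambda>n. u n 1)"
    by (auto simp: u_def power_int_def nat_add_distrib mult_ac)
  also have "infsum (\<lambda>n. u n 1) UNIV = V 1"
    unfolding V_def
    by (intro infsumI norm_summable_imp_has_sum summable_norm_u
          summable_sums[OF summable_norm_cancel[OF summable_norm_u]]) auto
  finally show ?thesis using V_one by simp
qed

end

section \<open>Numerators of the four series\<close>

lemma qpoch_0:
  assumes "qpoch_inf a q \<noteq> 0"
  shows "qpoch a q 0 = 1"
  using assms by (simp add: qpoch_def)

text \<open>If a q^n = 1, the lower product vanishes and \<open>qpoch a q n\<close> is 0 by default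
  where it should be infinite; for negative n the recurrence then fails.\<close>

lemma qpoch_rec:
  assumes "norm q < 1" "q \<noteq> 0" "a * q powi n \<noteq> 1"
  shows "qpoch a q (n + 1) = (1 - a * q powi n) * qpoch a q n"
proof -
  have "qpoch_inf (a * q powi n) q = (1 - a * q powi n) * qpoch_inf (a * q powi (n + 1)) q"
    using qpoch_inf_rec[OF assms(1), of "a * q powi n"] assms(2) by (simp add: power_int_add mult.assoc)
  then show ?thesis using assms(3) by (simp add: qpoch_def)
qed

text \<open>Moves the finite symbols of a denominator into infinite products above. At a pole both
  sides are 0 by convention, so the formula remains valid there.\<close>

lemma divide_qpoch_mult:
  "x / (qpoch a q m * qpoch b q m)
     = x * qpoch_inf (a * q powi m) q * qpoch_inf (b * q powi m) q * (1 / (qpoch_inf a q * qpoch_inf b q))"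
  by (simp add: qpoch_def)

lemma infsum_shift_int:
  fixes f :: "int \<Rightarrow> complex"
  shows "(\<Sum>\<^sub>\<infinity>n. f (n + 1)) = (\<Sum>\<^sub>\<infinity>n. f n)"
  by (rule infsum_reindex_bij_witness[of _ "\<lambda>n. n - 1" "\<lambda>n. n + 1"]) auto

lemma triangular_div_2_add_1:
  fixes n :: int
  shows "(n + 1) * (n + 2) div 2 = n * (n + 1) div 2 + (n + 1)"
proof -
  have "(n + 1) * (n + 2) = n * (n + 1) + (n + 1) * 2" by (simp add: algebra_simps)
  then show ?thesis by simp
qed

lemma g3_c_entire:
  assumes p: "norm p < 1" "p \<noteq> 0"
  obtains N where "N holomorphic_on - {0}" "\<And>y. g3_c y p = N y / jtheta y p"
    "\<And>y. y \<noteq> 0 \<Longrightarrow> N (p * y) = y\<^sup>2 * N y - (1 - y\<^sup>2) * (jtheta y p)\<^sup>2 / (y * qpoch_inf p p)"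
    "\<And>y. y \<noteq> 0 \<Longrightarrow> N (p / y) = N y" "N 1 = (qpoch_inf p p)\<^sup>2"
proof -
  interpret g: bilateral p 0 0 "\<lambda>n. p powi (n\<^sup>2 + n)"
  proof
    fix n :: int
    have "(n + 1)\<^sup>2 + (n + 1) = (n\<^sup>2 + n) + ((n + 1) + (n + 1))"
      by (simp add: power2_eq_square algebra_simps)
    then show "p powi ((n + 1)\<^sup>2 + (n + 1)) = (0 - p powi (n + 1)) * (0 - p powi (n + 1)) * p powi (n\<^sup>2 + n)"
      by (simp only: power_int_add[OF disjI1[OF p(2)]]) (simp add: mult_ac)
  qed (use p in auto)
  have nz: "qpoch_inf p p \<noteq> 0" by (rule qpoch_inf_self_nonzero[OF p(1)])
  have jt: "jtheta y p = qpoch_inf p p * g.\<theta> y" for y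
    by (simp add: jtheta_def g.\<theta>_def)
  have g3: "g3_c y p = g.H y / g.\<theta> y" for y
  proof -
    have eq: "p / y * p powi (n + 1) = p powi (n + 2) / y" for n
      using p by (simp add: power_int_add power2_eq_square)
    show ?thesis
      unfolding g3_c_def g.H_def divide_qpoch_mult infsum_cmult_left' eq by (simp add: g.\<theta>_def)
  qed
  have H1: "g.H 1 = qpoch_inf p p"
    using g.H_one by simp
  show ?thesis
  proof (rule that[of "\<lambda>y. qpoch_inf p p * g.H y"])
    show "(\<lambda>y. qpoch_inf p p * g.H y) holomorphic_on - {0}"
      by (intro holomorphic_intros g.H_holomorphic)
    show "g3_c y p = qpoch_inf p p * g.H y / jtheta y p" for y
      using nz by (simp add: g3 jt)
    show "qpoch_inf p p * g.H (p * y) = y\<^sup>2 * (qpoch_inf p p * g.H y)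
        - (1 - y\<^sup>2) * (jtheta y p)\<^sup>2 / (y * qpoch_inf p p)" if "y \<noteq> 0" for y
    proof -
      have "g.H (p * y) = y\<^sup>2 * g.H y + (1 - y\<^sup>2) * g.wlim y"
        using g.H_functional[OF that] by (simp add: power2_eq_square)
      then have "qpoch_inf p p * g.H (p * y)
          = y\<^sup>2 * (qpoch_inf p p * g.H y) + (1 - y\<^sup>2) * (qpoch_inf p p * g.wlim y)"
        by (simp only: ring_distribs mult_ac)
      also have "qpoch_inf p p * g.wlim y = - (jtheta y p)\<^sup>2 / (y * qpoch_inf p p)"
        using nz by (simp add: jt g.wlim_def power2_eq_square)
      finally show ?thesis by simp
    qed
    show "qpoch_inf p p * g.H (p / y) = qpoch_inf p p * g.H y" if "y \<noteq> 0" for y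
      using g.H_reflect[OF that] by simp
    show "qpoch_inf p p * g.H 1 = (qpoch_inf p p)\<^sup>2"
      unfolding H1 by (simp add: power2_eq_square)
  qed
qed

text \<open>The symbol (-p;p)_n grows by 1 + p^(n+1) = -(\<beta> - p^(n+1)) with \<beta> = -1, and
  the triangular exponent contributes p^(n+1) = -(\<alpha> - p^(n+1)) with \<alpha> = 0.\<close>

lemma g2_c_entire:
  assumes p: "norm p < 1" "p \<noteq> 0"
  obtains N where "N holomorphic_on - {0}" "\<And>y. g2_c y p = N y / jtheta y p"
    "\<And>y. y \<noteq> 0 \<Longrightarrow> N (p * y) = y * N y - (1 - y) * (jtheta y p)\<^sup>2 / (y * qpoch_inf (-1) p * qpoch_inf p p)"
    "\<And>y. y \<noteq> 0 \<Longrightarrow> N (p / y) = N y" "N 1 = (qpoch_inf p p)\<^sup>2 * qpoch_inf (- p) p"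
proof -
  \<comment> \<open>Makes the recurrence of (-p;p)_n available at every integer index, the negative
    ones included.\<close>
  have ne: "- p * p powi n \<noteq> 1" for n
  proof
    assume "- p * p powi n = 1"
    then have "p powi (n + 1) = -1"
      using p by (simp add: power_int_add algebra_simps) (metis minus_equation_iff)
    then show False using powi_neq_minus_one[OF p] by blast
  qed
  interpret g: bilateral p 0 "-1" "\<lambda>n. qpoch (- p) p n * p powi (n * (n + 1) div 2)"
  proof
    show "-1 * p ^ k \<noteq> 1" for k
      using powi_neq_minus_one[OF p, of "int k"] by (simp add: minus_equation_iff)
    have "qpoch_inf (- p) p \<noteq> 0" using p by (intro qpoch_inf_nonzero') auto
    then show "qpoch (- p) p 0 * p powi (0 * (0 + 1) div 2) = 1" by (simp add: qpoch_0)
    fix n :: int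
    show "qpoch (- p) p (n + 1) * p powi ((n + 1) * (n + 1 + 1) div 2)
        = (0 - p powi (n + 1)) * (- 1 - p powi (n + 1)) * (qpoch (- p) p n * p powi (n * (n + 1) div 2))"
    proof -
      have "(n + 1) * (n + 1 + 1) div 2 = n * (n + 1) div 2 + (n + 1)"
        using triangular_div_2_add_1[of n] by (simp add: add.assoc)
      then have "p powi ((n + 1) * (n + 1 + 1) div 2) = p powi (n * (n + 1) div 2) * p powi (n + 1)"
        by (simp only: power_int_add[OF disjI1[OF p(2)]])
      moreover have "- p * p powi n = - (p powi (n + 1))"
        using p by (simp add: power_int_add mult.commute)
      ultimately show ?thesis
        unfolding qpoch_rec[OF p ne] by (simp add: algebra_simps)
    qed
  qed (use p in auto)
  have nz: "qpoch_inf p p \<noteq> 0" by (rule qpoch_inf_self_nonzero[OF p(1)])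
  have jt: "jtheta y p = qpoch_inf p p * g.\<theta> y" for y
    by (simp add: jtheta_def g.\<theta>_def)
  have g2: "g2_c y p = g.H y / g.\<theta> y" for y
  proof -
    have eq: "p / y * p powi (n + 1) = p powi (n + 2) / y" for n
      using p by (simp add: power_int_add power2_eq_square)
    show ?thesis
      unfolding g2_c_def g.H_def divide_qpoch_mult infsum_cmult_left' eq by (simp add: g.\<theta>_def)
  qed
  show ?thesis
  proof (rule that[of "\<lambda>y. qpoch_inf p p * g.H y"])
    show "(\<lambda>y. qpoch_inf p p * g.H y) holomorphic_on - {0}"
      by (intro holomorphic_intros g.H_holomorphic)
    show "g2_c y p = qpoch_inf p p * g.H y / jtheta y p" for y
      using nz by (simp add: g2 jt)
    show "qpoch_inf p p * g.H (p * y) = y * (qpoch_inf p p * g.H y)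
        - (1 - y) * (jtheta y p)\<^sup>2 / (y * qpoch_inf (-1) p * qpoch_inf p p)" if "y \<noteq> 0" for y
    proof -
      have "g.H (p * y) = y * g.H y + (1 - y) * g.wlim y"
        using g.H_functional_minus_one[OF that] by simp
      then have "qpoch_inf p p * g.H (p * y)
          = y * (qpoch_inf p p * g.H y) + (1 - y) * (qpoch_inf p p * g.wlim y)"
        by (simp only: ring_distribs mult_ac)
      also have "qpoch_inf p p * g.wlim y = - (jtheta y p)\<^sup>2 / (y * qpoch_inf (-1) p * qpoch_inf p p)"
        using nz by (simp add: jt g.wlim_def power2_eq_square)
      finally show ?thesis by simp
    qed
    show "qpoch_inf p p * g.H (p / y) = qpoch_inf p p * g.H y" if "y \<noteq> 0" for y
      using g.H_reflect[OF that] by simp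
    show "qpoch_inf p p * g.H 1 = (qpoch_inf p p)\<^sup>2 * qpoch_inf (- p) p"
      by (simp add: g.H_one power2_eq_square)
  qed
qed

text \<open>Two steps of (-p;p)_(2n) and one factor p combine to the ratio with base p^2, \<alpha> =
  -p, \<beta> = -1, at y = Xp. The prefactor 1 + 1/X fits the equation of \<open>H\<close>: at p^2 X
  it supplies 1 + p^2 X, the coefficient 1 - \<alpha>y of the shifted value, and on the other side y
  - \<alpha> = p(X + 1).\<close>

lemma S2_c_entire:
  assumes p: "norm p < 1" "p \<noteq> 0"
  obtains N where "N holomorphic_on - {0}" "\<And>X. X \<noteq> 0 \<Longrightarrow> S2_c X p = N X / jtheta (X * p) (p\<^sup>2)"
    "\<And>X. X \<noteq> 0 \<Longrightarrow> N (p\<^sup>2 * X) = N X / p - (1 - p * X) * (jtheta (X * p) (p\<^sup>2))\<^sup>2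
        / (p\<^sup>2 * X\<^sup>2 * qpoch_inf (p\<^sup>2) (p\<^sup>2) * qpoch_inf (- p) (p\<^sup>2) * qpoch_inf (-1) (p\<^sup>2))"
    "\<And>X. X \<noteq> 0 \<Longrightarrow> N (1 / X) = X * N X"
    "N (1 / p) = p * (qpoch_inf (p\<^sup>2) (p\<^sup>2))\<^sup>2 * qpoch_inf (- p) p / qpoch_inf p (p\<^sup>2)"
proof -
  define P where "P = p\<^sup>2"
  have P: "norm P < 1" "P \<noteq> 0"
    using p by (simp_all add: P_def norm_power power_less_one_iff)
  have powP: "P powi n = p powi (2 * n)" for n
    by (simp add: P_def power_int_mult)
  have ne: "- p * p powi n \<noteq> 1" for n
  proof
    assume "- p * p powi n = 1"
    then have "p powi (n + 1) = -1"
      using p by (simp add: power_int_add algebra_simps) (metis minus_equation_iff)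
    then show False using powi_neq_minus_one[OF p] by blast
  qed
  interpret g: bilateral P "- p" "-1" "\<lambda>n. qpoch (- p) p (2 * n) * p powi n"
  proof
    show "- 1 * P ^ k \<noteq> 1" for k
      using powi_neq_minus_one[OF P, of "int k"] by (simp add: minus_equation_iff)
    show "- p * P ^ k \<noteq> 1" for k
      using ne[of "2 * int k"] powP[of "int k"] by simp
    have "qpoch_inf (- p) p \<noteq> 0" using p by (intro qpoch_inf_nonzero') auto
    then show "qpoch (- p) p (2 * 0) * p powi 0 = 1" by (simp add: qpoch_0)
    fix n :: int
    have "2 * (n + 1) = (2 * n + 1) + 1" by simp
    then have "qpoch (- p) p (2 * (n + 1)) = (1 - - p * p powi (2 * n + 1)) * ((1 - - p * p powi (2 * n)) * qpoch (- p) p (2 * n))"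
      by (simp only: qpoch_rec[OF p ne])
    moreover have "P powi (n + 1) = p * (p * p powi (2 * n))"
      unfolding powP using p by (simp add: power_int_add power2_eq_square ring_distribs)
    ultimately show "qpoch (- p) p (2 * (n + 1)) * p powi (n + 1)
        = (- p - P powi (n + 1)) * (- 1 - P powi (n + 1)) * (qpoch (- p) p (2 * n) * p powi n)"
      using p by (simp add: power_int_add algebra_simps)
  qed (use p P in auto)
  have nz: "qpoch_inf P P \<noteq> 0" by (rule qpoch_inf_self_nonzero[OF P(1)])
  have jt: "jtheta y P = qpoch_inf P P * g.\<theta> y" for y
    by (simp add: jtheta_def g.\<theta>_def)
  have S2: "S2_c X p = (1 + 1 / X) * (p * g.H (X * p) / g.\<theta> (X * p))" if "X \<noteq> 0" for X
  proof -
    have "p / X * P powi (n + 1) = P powi (n + 2) / (X * p)" for n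
      using p by (simp add: power_int_add power2_eq_square P_def)
    then have "(\<lambda>n. qpoch (- p) p (2 * n) * p powi (n + 1) / (qpoch (X * p) P (n + 1) * qpoch (p / X) P (n + 1)))
       = (\<lambda>n. p * ((qpoch (- p) p (2 * n) * p powi n) * qpoch_inf (X * p * P powi (n + 1)) P
           * qpoch_inf (P powi (n + 2) / (X * p)) P) * (1 / (qpoch_inf (X * p) P * qpoch_inf (p / X) P)))"
      unfolding divide_qpoch_mult using p by (auto simp: power_int_add fun_eq_iff)
    moreover have "p / X = P / (X * p)"
      using p by (simp add: P_def power2_eq_square)
    ultimately show ?thesis
      unfolding S2_c_def P_def[symmetric]
      by (simp only: infsum_cmult_left' infsum_cmult_right' g.H_def[symmetric]) (simp add: g.\<theta>_def)
  qed
  show ?thesis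
  proof (rule that[of "\<lambda>X. (1 + 1 / X) * (p * qpoch_inf P P * g.H (X * p))", folded P_def])
    have "(g.H \<circ> (\<lambda>X. X * p)) holomorphic_on - {0}"
      by (rule holomorphic_on_compose_gen[OF _ g.H_holomorphic]) (use p in \<open>auto intro!: holomorphic_intros\<close>)
    then have "(\<lambda>X. g.H (X * p)) holomorphic_on - {0}"
      by (simp add: o_def)
    then show "(\<lambda>X. (1 + 1 / X) * (p * qpoch_inf P P * g.H (X * p))) holomorphic_on - {0}"
      by (auto intro!: holomorphic_intros)
    show "S2_c X p = (1 + 1 / X) * (p * qpoch_inf P P * g.H (X * p)) / jtheta (X * p) P" if "X \<noteq> 0" for X
      using nz by (simp add: S2[OF that] jt)
    show "(1 + 1 / (1 / X)) * (p * qpoch_inf P P * g.H (1 / X * p))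
        = X * ((1 + 1 / X) * (p * qpoch_inf P P * g.H (X * p)))" if "X \<noteq> 0" for X
    proof -
      have "1 / X * p = P / (X * p)" using p by (simp add: P_def power2_eq_square)
      then have "g.H (1 / X * p) = g.H (X * p)" using g.H_reflect[of "X * p"] that p by simp
      then show ?thesis using that by (simp add: field_simps)
    qed
    show "(1 + 1 / (P * X)) * (p * qpoch_inf P P * g.H (P * X * p))
        = (1 + 1 / X) * (p * qpoch_inf P P * g.H (X * p)) / p - (1 - p * X) * (jtheta (X * p) P)\<^sup>2
          / (P * X\<^sup>2 * qpoch_inf P P * qpoch_inf (- p) P * qpoch_inf (-1) P)" if "X \<noteq> 0" for X
    proof -
      define A B where "A = g.H (X * p)" and "B = g.wlim (X * p)"
      have "(1 + p * (X * p)) * g.H (P * (X * p)) = (X * p + p) * A + (1 - X * p) * B"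
        using g.H_functional_minus_one[of "X * p"] that p by (simp add: A_def B_def)
      moreover have "1 + 1 / (P * X) = (1 + p * (X * p)) / (P * X)"
        using that P p by (simp add: P_def power2_eq_square field_simps)
      ultimately have "(1 + 1 / (P * X)) * g.H (P * (X * p)) = ((X * p + p) * A + (1 - X * p) * B) / (P * X)"
        by simp
      then have "(1 + 1 / (P * X)) * (p * qpoch_inf P P * g.H (P * X * p))
          = p * qpoch_inf P P * (((X * p + p) * A + (1 - X * p) * B) / (P * X))"
        by (simp add: mult_ac)
      also have "\<dots> = (1 + 1 / X) * (p * qpoch_inf P P * A) / p + (1 - p * X) * (p * qpoch_inf P P * B / (P * X))"
        using p that by (simp add: P_def power2_eq_square field_simps)
      also have "p * qpoch_inf P P * B / (P * X) = - (jtheta (X * p) P)\<^sup>2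
          / (P * X\<^sup>2 * qpoch_inf P P * qpoch_inf (- p) P * qpoch_inf (-1) P)"
        using nz p by (simp add: B_def g.wlim_def jt power2_eq_square mult_ac)
      finally show ?thesis by (simp add: A_def)
    qed
    \<comment> \<open>At X = 1/p the prefactor is 1 + p. It completes (-p^3;p^2)_inf to
      (-p;p^2)_inf, which merges with (-p^2;p^2)_inf into (-p;p)_inf.\<close>
    have "qpoch_inf (- p) p = qpoch_inf (- p) P * qpoch_inf (- P) P"
      using qpoch_inf_split_even_odd[OF p(1), of "- p"] by (simp add: P_def power2_eq_square)
    moreover have "qpoch_inf (- p) P = (1 + p) * qpoch_inf (P * - p) P"
      using qpoch_inf_rec[OF P(1), of "- p"] by (simp add: mult.commute)
    ultimately show "(1 + 1 / (1 / p)) * (p * qpoch_inf P P * g.H (1 / p * p))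
        = p * (qpoch_inf P P)\<^sup>2 * qpoch_inf (- p) p / qpoch_inf p P"
      using p by (simp add: g.H_one power2_eq_square)
  qed
qed

text \<open>\<open>K_c\<close> and \<open>K1_c\<close> are two linear combinations of the same sums
  \<open>E0\<close> and \<open>E1\<close>. The first identity is proved along the way because it is
  the telescoped relation between these sums, which are not visible from outside.\<close>

lemma K_c_entire:
  assumes q: "norm q < 1" "q \<noteq> 0"
  obtains N where "N holomorphic_on - {0}"
    "\<And>x. x \<noteq> 0 \<Longrightarrow> x \<noteq> 1 \<Longrightarrow> jtheta x (q\<^sup>2) \<noteq> 0 \<Longrightarrow> K_c x q / (x - 1) = N x / jtheta x (q\<^sup>2)"
    "\<And>x. x \<noteq> 0 \<Longrightarrow> x \<noteq> 1 \<Longrightarrow> jtheta x (q\<^sup>2) \<noteq> 0 \<Longrightarrow>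
       x / (x - 1) * K_c x q + (1 - 1 / (x * q)) * K1_c (x * q) q = jtheta (x * q\<^sup>2) (q\<^sup>2) / J 1 q"
    "\<And>x. x \<noteq> 0 \<Longrightarrow> N (q\<^sup>2 * x) = - q * x * N x - (jtheta x (q\<^sup>2))\<^sup>2 / J 1 q * (q / x + 1 / x\<^sup>2)"
    "\<And>x. x \<noteq> 0 \<Longrightarrow> N (1 / x) = N x" "N 1 = - J 1 q * J 2 q"
proof -
  define p where "p = q\<^sup>2"
  have p: "norm p < 1" "p \<noteq> 0"
    using q by (simp_all add: p_def norm_power power_less_one_iff)
  have powp: "p powi n = q powi (2 * n)" for n
    by (simp add: p_def power_int_mult)
  have ne: "q * p powi n \<noteq> 1" for n
  proof
    assume "q * p powi n = 1"
    then have "q powi (2 * n + 1) = q powi 0"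
      using q by (simp add: powp power_int_add mult.commute)
    then have "2 * n + 1 = 0" using norm_powi_eqD[OF q] by metis
    then show False by presburger
  qed
  \<comment> \<open>The exponent is that of \<open>K1_c\<close>, namely (n+1)^2, reduced by 1 so
    that the value at 0 is 1. \<open>K_c\<close> is reached through an index shift.\<close>
  interpret g: bilateral p q 0 "\<lambda>n. (- 1) powi n * qpoch q p n * q powi (n\<^sup>2 + 2 * n)"
  proof
    show ne': "q * p ^ k \<noteq> 1" for k
      using ne[of "int k"] by simp
    have "qpoch_inf q p \<noteq> 0" using p ne' by (intro qpoch_inf_nonzero)
    then show "(- 1) powi 0 * qpoch q p 0 * q powi (0\<^sup>2 + 2 * 0) = 1" by (simp add: qpoch_0)
    fix n :: int
    have "(n + 1)\<^sup>2 + 2 * (n + 1) = (n\<^sup>2 + 2 * n) + (2 * n + 3)"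
      by (simp add: power2_eq_square algebra_simps)
    then have "q powi ((n + 1)\<^sup>2 + 2 * (n + 1)) = q powi (n\<^sup>2 + 2 * n) * (q powi (2 * n) * q ^ 3)"
      by (simp only: power_int_add[OF disjI1[OF q(2)]]) simp
    moreover have "p powi (n + 1) = q\<^sup>2 * p powi n"
      using p by (simp add: power_int_add p_def)
    ultimately show "(- 1) powi (n + 1) * qpoch q p (n + 1) * q powi ((n + 1)\<^sup>2 + 2 * (n + 1))
        = (q - p powi (n + 1)) * (0 - p powi (n + 1)) * ((- 1) powi n * qpoch q p n * q powi (n\<^sup>2 + 2 * n))"
      unfolding qpoch_rec[OF p ne] using q
      by (simp add: powp power_int_add power2_eq_square power3_eq_cube algebra_simps)
  qed (use p in auto)
  have nz: "qpoch_inf p p \<noteq> 0" by (rule qpoch_inf_self_nonzero[OF p(1)])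
  have nzq: "qpoch_inf q p \<noteq> 0" using p g.\<alpha>_ne by (intro qpoch_inf_nonzero)
  have J1: "J 1 q = qpoch_inf q p * qpoch_inf p p"
    using qpoch_inf_split_even_odd[OF q(1), of q] by (simp add: J_def p_def power2_eq_square)
  note J1' = J1[unfolded One_nat_def]
  have J2: "J 2 q = qpoch_inf p p" by (simp add: J_def p_def)
  have jt: "jtheta y p = qpoch_inf p p * g.\<theta> y" for y
    by (simp add: jtheta_def g.\<theta>_def)
  define N where "N = (\<lambda>x. qpoch_inf p p * (q * g.E0 x - g.E1 x))"
  have K: "K_c x q = (1 - x) * (g.E1 x - q * g.E0 x) / g.\<theta> x" if x: "x \<noteq> 0" "x \<noteq> 1" for x
  proof -
    define C where "C = 1 / (qpoch_inf (x * p) p * qpoch_inf (p / x) p)"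
    define f where "f = (\<lambda>n. (-1) powi n * qpoch q p n * q powi (n\<^sup>2) / (qpoch (x * p) p n * qpoch (p / x) p n))"
    \<comment> \<open>After the shift the term is \<open>W (n + 1) x\<close> divided by p^(n+1).
      Since \<beta> = 0, this power divides the recurrence factor and the quotient is linear in
      p^(n+1).\<close>
    have "f (n + 1) = ((- q + 1 * p powi (n + 1)) * g.e n x) * C" for n
    proof -
      have "q powi ((n + 1)\<^sup>2) = q powi ((n + 1)\<^sup>2 + 2 * (n + 1)) / p powi (n + 1)"
        using q by (simp add: powp power_int_add)
      then have "f (n + 1) = g.W (n + 1) x / p powi (n + 1) * C"
        unfolding f_def divide_qpoch_mult g.W_def C_def
        using p by (simp add: power_int_add mult_ac add.assoc power2_eq_square)
      also have "g.W (n + 1) x / p powi (n + 1) = (- q + 1 * p powi (n + 1)) * g.e n x"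
        unfolding g.W_Suc_eq using p by (simp add: field_simps)
      finally show ?thesis .
    qed
    then have "K_c x q = (\<Sum>\<^sub>\<infinity>n. ((- q + 1 * p powi (n + 1)) * g.e n x) * C)"
      using infsum_shift_int[of f] by (simp add: K_c_def f_def p_def)
    also have "\<dots> = (- q * g.E0 x + 1 * g.E1 x) * C"
      unfolding infsum_cmult_left' using infsumI[OF g.has_sum_linear[OF x(1), of "- q" 1]] by simp
    also have "C = (1 - x) / g.\<theta> x"
      using qpoch_inf_rec[OF p(1), of x] x by (simp add: C_def g.\<theta>_def)
    finally show ?thesis
      by (simp add: mult_ac)
  qed
  have tel: "g.E0 x - (x + 1 / x - q) * g.E1 x = - (g.\<theta> x)\<^sup>2 / (x * qpoch_inf q p)" if "x \<noteq> 0" for x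
    using g.telescoped_sum[OF that] by (simp add: g.wlim_def)
  \<comment> \<open>The telescoped relation trades the combination q E0 - E1 for \<open>H\<close>,
    whose q-difference equation and value at 1 are known.\<close>
  have NH: "N x = qpoch_inf p p * ((q - x) * g.H x) - (jtheta x p)\<^sup>2 / J 1 q" if "x \<noteq> 0" for x
  proof -
    have "x * (1 / x) = 1" using that by simp
    then have "q * a - b = (q - x) * (a - x * b) + x * (a - (x + 1 / x - q) * b)" for a b
      by algebra
    from this[of "g.E0 x" "g.E1 x"]
    have "N x = qpoch_inf p p * ((q - x) * g.H x + x * (- (g.\<theta> x)\<^sup>2 / (x * qpoch_inf q p)))"
      unfolding N_def g.H_eq[OF that] tel[OF that] by simp
    then show ?thesis
      using that nz by (simp add: J1' jt power2_eq_square algebra_simps)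
  qed
  show ?thesis
  proof (rule that[of N, folded p_def])
    show "N holomorphic_on - {0}"
      unfolding N_def by (intro holomorphic_intros g.E0_holomorphic g.E1_holomorphic)
    show "K_c x q / (x - 1) = N x / jtheta x p" if "x \<noteq> 0" "x \<noteq> 1" "jtheta x p \<noteq> 0" for x
      using that nz by (simp add: K[OF that(1,2)] N_def jt field_simps)
    show "N (1 / x) = N x" if "x \<noteq> 0" for x
      by (simp only: N_def g.E0_inverse g.E1_inverse)
    have "qpoch_inf q p = (1 - q) * qpoch_inf (p * q) p"
      using qpoch_inf_rec[OF p(1), of q] by (simp add: mult.commute)
    moreover have "g.H 1 = qpoch_inf p p * qpoch_inf (p * q) p"
      using g.H_one by simp
    moreover have "N 1 = qpoch_inf p p * ((q - 1) * g.H 1)"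
      using NH[of 1] jtheta_one[OF p(1)] by simp
    ultimately show "N 1 = - J 1 q * J 2 q"
      unfolding J1 J2 by algebra
    show "N (p * x) = - q * x * N x - (jtheta x p)\<^sup>2 / J 1 q * (q / x + 1 / x\<^sup>2)" if "x \<noteq> 0" for x
    proof -
      define t where "t = (jtheta x p)\<^sup>2 / J 1 q"
      have w: "qpoch_inf p p * g.wlim x = - t / x"
        using nz that by (simp add: t_def g.wlim_def J1' jt power2_eq_square field_simps)
      have "(jtheta (p * x) p)\<^sup>2 = (jtheta x p)\<^sup>2 / x\<^sup>2"
        using jtheta_shift[OF p that] by (simp add: power_divide)
      then have "N (p * x) = qpoch_inf p p * ((q - p * x) * g.H (p * x)) - t / x\<^sup>2"
        using NH[of "p * x"] that p by (simp add: t_def)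
      also have "(q - p * x) * g.H (p * x) = q * ((1 - q * x) * g.H (p * x))"
        by (simp add: p_def power2_eq_square algebra_simps)
      also have "(1 - q * x) * g.H (p * x) = (x - q) * x * g.H x + (1 - x\<^sup>2) * g.wlim x"
        using g.H_functional[OF that] by simp
      also have "qpoch_inf p p * (q * ((x - q) * x * g.H x + (1 - x\<^sup>2) * g.wlim x))
          = - q * x * (qpoch_inf p p * ((q - x) * g.H x)) + q * (1 - x\<^sup>2) * (qpoch_inf p p * g.wlim x)"
        by (simp add: algebra_simps)
      also have "qpoch_inf p p * ((q - x) * g.H x) = N x + t"
        using NH[OF that] by (simp add: t_def)
      also have "- q * x * (N x + t) + q * (1 - x\<^sup>2) * (qpoch_inf p p * g.wlim x) - t / x\<^sup>2
          = - q * x * N x - t * (q / x + 1 / x\<^sup>2)"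
        unfolding w using that by (simp add: power2_eq_square field_simps)
      finally show ?thesis
        unfolding t_def .
    qed
    show "x / (x - 1) * K_c x q + (1 - 1 / (x * q)) * K1_c (x * q) q = jtheta (x * p) p / J 1 q"
      if x: "x \<noteq> 0" "x \<noteq> 1" "jtheta x p \<noteq> 0" for x
    proof -
      have xq: "x * q * q = p * x" "q / (x * q) = p / (p * x)"
        using p q x by (simp_all add: p_def power2_eq_square)
      have "K1_c (x * q) q = q * g.H (p * x) / g.\<theta> (p * x)"
      proof -
        have "p / (p * x) * p powi (n + 1) = p powi (n + 2) / (p * x)" for n
          using p by (simp add: power_int_add power2_eq_square)
        moreover have "q powi ((n + 1)\<^sup>2) = q * q powi (n\<^sup>2 + 2 * n)" for n
        proof -
          have "(n + 1)\<^sup>2 = 1 + (n\<^sup>2 + 2 * n)" by (simp add: power2_eq_square algebra_simps)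
          then show ?thesis by (simp only: power_int_add[OF disjI1[OF q(2)]]) simp
        qed
        ultimately have "(\<lambda>n. (-1) powi n * qpoch q p n * q powi ((n + 1)\<^sup>2)
             / (qpoch (p * x) p (n + 1) * qpoch (p / (p * x)) p (n + 1)))
          = (\<lambda>n. q * ((-1) powi n * qpoch q p n * q powi (n\<^sup>2 + 2 * n) * qpoch_inf (p * x * p powi (n + 1)) p
              * qpoch_inf (p powi (n + 2) / (p * x)) p) * (1 / (qpoch_inf (p * x) p * qpoch_inf (p / (p * x)) p)))"
          unfolding divide_qpoch_mult by (simp add: fun_eq_iff)
        then show ?thesis
          unfolding K1_c_def xq p_def[symmetric]
          by (simp only: infsum_cmult_left' infsum_cmult_right' g.H_def[symmetric]) (simp add: g.\<theta>_def)
      qed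
      also have "g.\<theta> (p * x) = - g.\<theta> x / x"
      proof -
        have "qpoch_inf p p * g.\<theta> (p * x) = qpoch_inf p p * (- g.\<theta> x / x)"
          using jtheta_shift[OF p x(1)] by (simp add: jt)
        then show ?thesis using nz mult_left_cancel by blast
      qed
      finally have K1: "K1_c (x * q) q = q * (g.E0 x - g.E1 x / x) / (- g.\<theta> x / x)"
        by (simp add: g.H_shift_eq[OF x(1)])
      have th: "g.\<theta> x \<noteq> 0" using x by (auto simp: jt)
      have "x / (x - 1) * K_c x q = - x * (g.E1 x - q * g.E0 x) / g.\<theta> x"
        using x th by (simp add: K[OF x(1,2)] field_simps)
      moreover have "(1 - 1 / (x * q)) * K1_c (x * q) q = - (q - 1 / x) * (x * g.E0 x - g.E1 x) / g.\<theta> x"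
        unfolding K1 using x th q by (simp add: field_simps)
      \<comment> \<open>The weights of \<open>K_c\<close> and \<open>K1_c\<close> are such that the
        coefficients of \<open>E0\<close> and \<open>E1\<close> add up to the left side of the
        telescoped relation.\<close>
      moreover have "- x * (b - q * a) / t + - (q - 1 / x) * (x * a - b) / t = (a - (x + 1 / x - q) * b) / t" for a b t
      proof -
        have "x * (1 / x) = 1" using x by simp
        then have "- x * (b - q * a) + - (q - 1 / x) * (x * a - b) = a - (x + 1 / x - q) * b"
          by algebra
        then show ?thesis by (simp only: add_divide_distrib[symmetric])
      qed
      ultimately have "x / (x - 1) * K_c x q + (1 - 1 / (x * q)) * K1_c (x * q) q
          = (g.E0 x - (x + 1 / x - q) * g.E1 x) / g.\<theta> x"
        by (simp only:)
      also have "\<dots> = - g.\<theta> x / (x * qpoch_inf q p)"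
        unfolding tel[OF x(1)] using th by (simp add: power2_eq_square)
      also have "\<dots> = jtheta (x * p) p / J 1 q"
        using jtheta_shift[OF p x(1)] nz by (simp add: jt J1' mult.commute)
      finally show ?thesis .
    qed
  qed
qed

section \<open>The identities\<close>

lemma norm_power2_less_one: "norm (p::complex) < 1 \<Longrightarrow> norm (p\<^sup>2) < 1"
  by (simp add: norm_power power_less_one_iff)

section \<open>Theta functions at special arguments\<close>

lemma qpoch_inf_minus_self:
  assumes "norm p < 1"
  shows "qpoch_inf (- p) p * qpoch_inf p p = qpoch_inf (p\<^sup>2) (p\<^sup>2)"
  using qpoch_inf_mult_minus[OF assms, of p] by (simp add: mult.commute)

lemma qpoch_inf_self_square:
  assumes "norm p < 1"
  shows "qpoch_inf p (p\<^sup>2) * qpoch_inf (p\<^sup>2) (p\<^sup>2) = qpoch_inf p p"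
  using qpoch_inf_split_even_odd[OF assms, of p] by (simp add: power2_eq_square)

lemma qpoch_inf_minus_one:
  assumes "norm p < 1"
  shows "qpoch_inf (-1) p = 2 * qpoch_inf (- p) p"
  using qpoch_inf_rec[OF assms, of "-1"] by simp

lemma jtheta_mult_minus:
  assumes "norm p < 1"
  shows "jtheta z p * jtheta (- z) p * qpoch_inf (p\<^sup>2) (p\<^sup>2) = jtheta (z\<^sup>2) (p\<^sup>2) * (qpoch_inf p p)\<^sup>2"
proof -
  have "qpoch_inf z p * qpoch_inf (- z) p = qpoch_inf (z\<^sup>2) (p\<^sup>2)"
    "qpoch_inf (p / z) p * qpoch_inf (- (p / z)) p = qpoch_inf (p\<^sup>2 / z\<^sup>2) (p\<^sup>2)"
    using qpoch_inf_mult_minus[OF assms] by (simp_all add: power_divide)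
  then show ?thesis
    by (simp add: jtheta_def power2_eq_square[of "qpoch_inf p p"]) (simp add: mult_ac)
qed

lemma jtheta_split_even_odd:
  assumes "norm p < 1" "p \<noteq> 0"
  shows "jtheta z (p\<^sup>2) * jtheta (z * p) (p\<^sup>2) * qpoch_inf p p = jtheta z p * (qpoch_inf (p\<^sup>2) (p\<^sup>2))\<^sup>2"
proof -
  have 1: "qpoch_inf z p = qpoch_inf z (p\<^sup>2) * qpoch_inf (z * p) (p\<^sup>2)"
    by (rule qpoch_inf_split_even_odd[OF assms(1)])
  have 2: "qpoch_inf (p / z) p = qpoch_inf (p / z) (p\<^sup>2) * qpoch_inf (p\<^sup>2 / z) (p\<^sup>2)"
    using qpoch_inf_split_even_odd[OF assms(1), of "p / z"] by (simp add: power2_eq_square)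
  have 3: "p\<^sup>2 / (z * p) = p / z" using assms by (simp add: power2_eq_square)
  show ?thesis
    unfolding jtheta_def 1 2 3 by (simp add: power2_eq_square)
qed

lemma jtheta_minus_one:
  assumes "norm p < 1"
  shows "jtheta (-1) p * qpoch_inf p p = 2 * (qpoch_inf (p\<^sup>2) (p\<^sup>2))\<^sup>2"
  using qpoch_inf_minus_self[OF assms, symmetric] qpoch_inf_minus_one[OF assms]
  by (simp add: jtheta_def power2_eq_square)

lemma jtheta_half_period:
  assumes "norm p < 1"
  shows "jtheta p (p\<^sup>2) * qpoch_inf (p\<^sup>2) (p\<^sup>2) = (qpoch_inf p p)\<^sup>2"
  using qpoch_inf_self_square[OF assms, symmetric]
  by (simp add: jtheta_def power2_eq_square)

text \<open>\<open>jtheta_mult_minus\<close> at z = p with nome p^2 ties this value to the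
  half-period values at nomes p^2 and p^4, which are then eliminated.\<close>

lemma jtheta_minus_half_period:
  assumes "norm p < 1"
  shows "jtheta (- p) (p\<^sup>2) * (qpoch_inf p p)\<^sup>2 * (qpoch_inf (p ^ 4) (p ^ 4))\<^sup>2 = qpoch_inf (p\<^sup>2) (p\<^sup>2) ^ 5"
proof -
  define A B C where "A = qpoch_inf p p" and "B = qpoch_inf (p\<^sup>2) (p\<^sup>2)" and "C = qpoch_inf (p ^ 4) (p ^ 4)"
  have p4: "(p\<^sup>2)\<^sup>2 = p ^ 4" by (simp flip: power_mult)
  have "jtheta p (p\<^sup>2) * jtheta (- p) (p\<^sup>2) * C = jtheta (p\<^sup>2) (p ^ 4) * B\<^sup>2"
    using jtheta_mult_minus[OF norm_power2_less_one[OF assms], of p] by (simp add: B_def C_def p4)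
  moreover have "jtheta (p\<^sup>2) (p ^ 4) * C = B\<^sup>2"
    using jtheta_half_period[OF norm_power2_less_one[OF assms]] by (simp add: B_def C_def p4)
  moreover have "jtheta p (p\<^sup>2) * B = A\<^sup>2"
    using jtheta_half_period[OF assms] by (simp add: A_def B_def)
  ultimately show ?thesis
    unfolding A_def[symmetric] B_def[symmetric] C_def[symmetric] by algebra
qed

lemma jtheta_self:
  assumes "norm p < 1" "p \<noteq> 0"
  shows "jtheta p p = 0"
  using jtheta_reflect[of p 1] jtheta_one[OF assms(1)] assms by simp

text \<open>With nome q^2 the zeros are even powers of q, and the modulus determines the exponent.
  This separates the orbits of the special points.\<close>

lemma jtheta_square_nome_nonzero:
  assumes q: "norm q < 1" "q \<noteq> 0" and "norm z = norm (q powi m)" "z \<noteq> q powi m"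
  shows "jtheta z (q\<^sup>2) \<noteq> 0"
proof
  assume *: "jtheta z (q\<^sup>2) = 0"
  have "norm (q powi m) \<noteq> 0" using q by simp
  then have "z \<noteq> 0" using assms(3) by auto
  then obtain k where "z = (q\<^sup>2) powi k"
    using jtheta_eq_0D[OF norm_power2_less_one[OF q(1)] _ _ *] q by auto
  then have k: "z = q powi (2 * k)" by (simp add: power_int_mult)
  then have "2 * k = m" using norm_powi_eqD[OF q] assms(3) by metis
  then show False using k assms(4) by simp
qed

text \<open>Differentiate the symmetry at its fixed point \<open>u\<close>: the left side gives
  -f'(u), the right side f'(u), because the multiplier is 1 there and f(u) = 0.\<close>

lemma deriv_eq_0_of_involution:
  fixes f :: "complex \<Rightarrow> complex"
  assumes hol: "f holomorphic_on - {0}" and u: "u \<noteq> 0" "f u = 0"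
    and f: "\<And>x. x \<noteq> 0 \<Longrightarrow> f (u\<^sup>2 / x) = C * x powi m * f x" and C: "C * u powi m = 1"
  shows "deriv f u = 0"
proof -
  have uu: "u\<^sup>2 / u = u" by (simp add: power2_eq_square)
  have df: "(f has_field_derivative deriv f u) (at u)"
    using hol u by (intro holomorphic_derivI) auto
  then have "(f has_field_derivative deriv f u) (at (u\<^sup>2 / u))"
    by (simp only: uu)
  moreover have "((\<lambda>x. u\<^sup>2 / x) has_field_derivative - 1) (at u)"
    using u by (auto intro!: derivative_eq_intros simp: power2_eq_square)
  ultimately have 1: "((\<lambda>x. f (u\<^sup>2 / x)) has_field_derivative deriv f u * (- 1)) (at u)"
    by (rule DERIV_chain2)
  have "(\<lambda>x. C * x powi m) holomorphic_on - {0}"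
    by (auto intro!: holomorphic_intros)
  then have "((\<lambda>x. C * x powi m) has_field_derivative deriv (\<lambda>x. C * x powi m) u) (at u)"
    using u by (intro holomorphic_derivI) auto
  from DERIV_mult[OF this df]
  have "((\<lambda>x. C * x powi m * f x) has_field_derivative deriv f u) (at u)"
    using u C by (simp add: mult_ac)
  moreover have "eventually (\<lambda>x. C * x powi m * f x = f (u\<^sup>2 / x)) (nhds u)"
    using t1_space_nhds[OF u(1)] by eventually_elim (use f in auto)
  ultimately have "((\<lambda>x. f (u\<^sup>2 / x)) has_field_derivative deriv f u) (at u)"
    by (rule has_field_derivative_cong_ev)
  from DERIV_unique[OF this 1] show ?thesis by simp
qed

text \<open>
  In the next two proofs \<open>E\<close> is the difference of the two sides, cleared of its theta denominators.
  Zeros at fixed points of the involutions \<open>x \<mapsto> 1 / x\<close> and \<open>x \<mapsto> 1 / (q\<^sup>2 * x)\<close> are double by symmetry.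
\<close>
lemma second_identity:
  fixes q x :: complex
  assumes q: "norm q < 1" "q \<noteq> 0" and x: "x \<noteq> 0" "x \<noteq> 1"
    and nz: "jtheta (x\<^sup>2 * q\<^sup>2) (q ^ 4) \<noteq> 0" "jtheta (- (x\<^sup>2 * q ^ 4)) (q ^ 4) \<noteq> 0"
      "jtheta (x * q) (q\<^sup>2) \<noteq> 0" "jtheta x q \<noteq> 0"
  shows "J 1 q * jtheta (- (x * q)) (q\<^sup>2) / (x - 1) * K_c x q
          + 2 * q * J 4 q * jtheta x (q\<^sup>2) / x * g2_c (- (x * q)) (q\<^sup>2)
        = 2 * q * J 4 q ^ 5 * jtheta x (q\<^sup>2)
            / (x * J 2 q ^ 2 * jtheta (x\<^sup>2 * q\<^sup>2) (q ^ 4))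
          - J 4 q ^ 11 * jtheta x (q\<^sup>2) * jtheta (- (x\<^sup>2 * q\<^sup>2)) (q ^ 4)
            / (x\<^sup>2 * J 2 q ^ 4 * J 8 q ^ 4 * jtheta (x\<^sup>2 * q\<^sup>2) (q ^ 4) * jtheta (- (x\<^sup>2 * q ^ 4)) (q ^ 4))
          + J 4 q ^ 5 * jtheta x (q\<^sup>2) * jtheta (- (x * q)) (q\<^sup>2)
            / (x\<^sup>2 * J 8 q ^ 2 * jtheta (x * q) (q\<^sup>2) * jtheta (- (x\<^sup>2 * q ^ 4)) (q ^ 4))
          - J 1 q ^ 5 * jtheta (- (x * q)) (q\<^sup>2) / (J 2 q ^ 2 * jtheta x q)"
proof -
  define J1 J2 J4 J8 where "J1 = J 1 q" and "J2 = J 2 q" and "J4 = J 4 q" and "J8 = J 8 q"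
  note Jdefs = J1_def J2_def J4_def J8_def
  have p: "norm (q\<^sup>2) < 1" "q\<^sup>2 \<noteq> 0" using q norm_power2_less_one by auto
  have q4: "(q\<^sup>2)\<^sup>2 = q ^ 4" "(q\<^sup>2) ^ 4 = q ^ 8" by (simp_all flip: power_mult)
  have p4: "norm (q ^ 4) < 1" "q ^ 4 \<noteq> 0" using p norm_power2_less_one[of "q\<^sup>2"] q4 by auto
  have q8: "(q ^ 4)\<^sup>2 = q ^ 8" by (simp flip: power_mult)
  have Jq: "qpoch_inf q q = J1" "qpoch_inf (q\<^sup>2) (q\<^sup>2) = J2" "qpoch_inf (q ^ 4) (q ^ 4) = J4" "qpoch_inf (q ^ 8) (q ^ 8) = J8"
    by (simp_all add: Jdefs J_def)
  have Jnz: "J1 \<noteq> 0" "J2 \<noteq> 0" "J4 \<noteq> 0" "J8 \<noteq> 0"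
    using qpoch_inf_self_nonzero[OF q(1)] qpoch_inf_self_nonzero[OF p(1)] qpoch_inf_self_nonzero[OF p4(1)]
      qpoch_inf_self_nonzero[OF norm_power2_less_one[OF p4(1)]] by (simp_all add: q8 Jq)
  obtain NK where NK: "NK holomorphic_on - {0}"
    "\<And>x. x \<noteq> 0 \<Longrightarrow> x \<noteq> 1 \<Longrightarrow> jtheta x (q\<^sup>2) \<noteq> 0 \<Longrightarrow> K_c x q / (x - 1) = NK x / jtheta x (q\<^sup>2)"
    "\<And>x. x \<noteq> 0 \<Longrightarrow> NK (q\<^sup>2 * x) = - q * x * NK x - (jtheta x (q\<^sup>2))\<^sup>2 / J1 * (q / x + 1 / x\<^sup>2)"
    "\<And>x. x \<noteq> 0 \<Longrightarrow> NK (1 / x) = NK x" "NK 1 = - J1 * J2"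
    unfolding Jdefs by (rule K_c_entire[OF q]) blast
  obtain Ng where Ng: "Ng holomorphic_on - {0}" "\<And>y. g2_c y (q\<^sup>2) = Ng y / jtheta y (q\<^sup>2)"
    "\<And>y. y \<noteq> 0 \<Longrightarrow> Ng (q\<^sup>2 * y) = y * Ng y - (1 - y) * (jtheta y (q\<^sup>2))\<^sup>2 / (y * qpoch_inf (-1) (q\<^sup>2) * J2)"
    "\<And>y. y \<noteq> 0 \<Longrightarrow> Ng (q\<^sup>2 / y) = Ng y" "Ng 1 = J2\<^sup>2 * qpoch_inf (- (q\<^sup>2)) (q\<^sup>2)"
    unfolding Jq[symmetric] by (rule g2_c_entire[OF p]) blast
  have Ng1: "Ng 1 = J2 * J4"
  proof -
    have *: "qpoch_inf (- (q\<^sup>2)) (q\<^sup>2) * J2 = J4"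
      using qpoch_inf_minus_self[OF p(1)] by (simp add: q4 Jq)
    show ?thesis
      unfolding Ng(5) *[symmetric] by (simp add: power2_eq_square mult_ac)
  qed
  have qm: "qpoch_inf (-1) (q\<^sup>2) * J2 = 2 * J4"
    using qpoch_inf_minus_self[OF p(1)] qpoch_inf_minus_one[OF p(1)] by (simp add: q4 Jq)
  define a b c L M where
    "a = (\<lambda>x. jtheta x (q\<^sup>2))" and "b = (\<lambda>x. jtheta (- (x * q)) (q\<^sup>2))" and "c = (\<lambda>x. jtheta (x * q) (q\<^sup>2))"
    and "L = (\<lambda>x. jtheta (- (x\<^sup>2 * q ^ 4)) (q ^ 4))" and "M = (\<lambda>x. jtheta (- (x\<^sup>2 * q\<^sup>2)) (q ^ 4))"
  \<comment> \<open>The difference of the two sides times a b c L, after \<open>jtheta x q\<close>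
    has been expressed through a c, and \<open>jtheta (x^2 * q^2) (q^4)\<close> through b c.\<close>
  define E where "E = (\<lambda>x. J1 * (b x)\<^sup>2 * c x * L x * NK x + 2 * q * J4 / x * (a x)\<^sup>2 * c x * L x * Ng (- (x * q))
     - 2 * q * J4 ^ 4 / x * (a x)\<^sup>2 * L x + J4 ^ 10 / (x\<^sup>2 * J2\<^sup>2 * J8 ^ 4) * (a x)\<^sup>2 * M x
     - J4 ^ 5 / (x\<^sup>2 * J8\<^sup>2) * (a x)\<^sup>2 * (b x)\<^sup>2 + J1 ^ 4 * (b x)\<^sup>2 * L x)"
  have shifts: "a (q\<^sup>2 * x) = - a x / x" "b (q\<^sup>2 * x) = b x / (x * q)" "c (q\<^sup>2 * x) = - c x / (x * q)"
    "L (q\<^sup>2 * x) = L x / (x\<^sup>2 * q ^ 4)" "M (q\<^sup>2 * x) = M x / (x\<^sup>2 * q\<^sup>2)"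
    "Ng (- (q\<^sup>2 * x * q)) = - (x * q) * Ng (- (x * q)) + (1 + x * q) * (b x)\<^sup>2 / (2 * J4 * (x * q))"
    if "x \<noteq> 0" for x
  proof -
    show "a (q\<^sup>2 * x) = - a x / x"
      unfolding a_def using jtheta_shift[OF p that] .
    show "b (q\<^sup>2 * x) = b x / (x * q)"
      unfolding b_def using jtheta_shift[OF p, of "- (x * q)"] that q by (simp add: mult_ac)
    show "c (q\<^sup>2 * x) = - c x / (x * q)"
      unfolding c_def using jtheta_shift[OF p, of "x * q"] that q by (simp add: mult_ac)
    show "L (q\<^sup>2 * x) = L x / (x\<^sup>2 * q ^ 4)"
      unfolding L_def using jtheta_shift[OF p4, of "- (x\<^sup>2 * q ^ 4)"] that q
      by (simp add: power_mult_distrib q4 mult.assoc)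
    show "M (q\<^sup>2 * x) = M x / (x\<^sup>2 * q\<^sup>2)"
      unfolding M_def using jtheta_shift[OF p4, of "- (x\<^sup>2 * q\<^sup>2)"] that q
      by (simp add: power_mult_distrib q4 mult.assoc)
    have "- (x * q) \<noteq> 0" using that q by simp
    from Ng(3)[OF this]
    have "Ng (- (q\<^sup>2 * x * q)) = - (x * q) * Ng (- (x * q)) - (1 + x * q) * (b x)\<^sup>2 / (- (x * q) * (qpoch_inf (-1) (q\<^sup>2) * J2))"
      unfolding b_def by (simp add: mult.assoc)
    then show "Ng (- (q\<^sup>2 * x * q)) = - (x * q) * Ng (- (x * q)) + (1 + x * q) * (b x)\<^sup>2 / (2 * J4 * (x * q))"
      unfolding qm by (simp add: mult_ac)
  qed
  have E_shift: "E (q\<^sup>2 * x) = 1 / q ^ 6 * x powi (-4) * E x" if "x \<noteq> 0" for x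
  proof -
    have *: "x powi (-4) = 1 / x ^ 4" by (simp add: power_int_def power_one_over inverse_eq_divide)
    \<comment> \<open>Here the inhomogeneous parts cancel: q/x + 1/x^2 = (1 + xq)/x^2 matches the
      factor 1 + xq from \<open>Ng\<close>, and both are multiples of A^2 B^2 C l.\<close>
    have K: "J1 * (B / (x * q))\<^sup>2 * (- C / (x * q)) * (l / (x\<^sup>2 * q ^ 4)) * (- q * x * nk - A\<^sup>2 / J1 * (q / x + 1 / x\<^sup>2))
        + 2 * q * J4 / (q\<^sup>2 * x) * (- A / x)\<^sup>2 * (- C / (x * q)) * (l / (x\<^sup>2 * q ^ 4)) * (- (x * q) * ng + (1 + x * q) * B\<^sup>2 / (2 * J4 * (x * q)))
        = 1 / q ^ 6 * (1 / x ^ 4) * (J1 * B\<^sup>2 * C * l * nk + 2 * q * J4 / x * A\<^sup>2 * C * l * ng)" for A B C l nk ng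
      using that q Jnz by (simp add: field_simps eval_nat_numeral)
    have T: "2 * q * J4 ^ 4 / (q\<^sup>2 * x) * (- A / x)\<^sup>2 * (l / (x\<^sup>2 * q ^ 4)) = 1 / q ^ 6 * (1 / x ^ 4) * (2 * q * J4 ^ 4 / x * A\<^sup>2 * l)"
      "k / ((q\<^sup>2 * x)\<^sup>2 * J2\<^sup>2 * J8 ^ 4) * (- A / x)\<^sup>2 * (m / (x\<^sup>2 * q\<^sup>2)) = 1 / q ^ 6 * (1 / x ^ 4) * (k / (x\<^sup>2 * J2\<^sup>2 * J8 ^ 4) * A\<^sup>2 * m)"
      "k / ((q\<^sup>2 * x)\<^sup>2 * J8\<^sup>2) * (- A / x)\<^sup>2 * (B / (x * q))\<^sup>2 = 1 / q ^ 6 * (1 / x ^ 4) * (k / (x\<^sup>2 * J8\<^sup>2) * A\<^sup>2 * B\<^sup>2)"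
      "k * (B / (x * q))\<^sup>2 * (l / (x\<^sup>2 * q ^ 4)) = 1 / q ^ 6 * (1 / x ^ 4) * (k * B\<^sup>2 * l)" for A B l m k
      using that q Jnz by (simp_all add: field_simps eval_nat_numeral)
    show ?thesis
      unfolding E_def shifts[OF that] NK(3)[OF that] a_def[symmetric] * T
      using K[of "b x" "c x" "L x" "NK x" "a x" "Ng (- (x * q))"]
      by (simp only: a_def ring_distribs)
  qed
  have E_inv: "E (1 / x) = x\<^sup>2 * E x" if "x \<noteq> 0" for x
  proof -
    have i1: "a (1 / x) = - a x / x"
      unfolding a_def using jtheta_inverse[OF p that] .
    have i2: "b (1 / x) = b x"
    proof -
      have "q\<^sup>2 / (- (x * q)) = - (1 / x * q)" using q that by (simp add: power2_eq_square)
      then show ?thesis unfolding b_def using jtheta_reflect[OF p(2), of "- (x * q)"] that q by simp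
    qed
    have i3: "c (1 / x) = c x"
    proof -
      have "q\<^sup>2 / (x * q) = 1 / x * q" using q that by (simp add: power2_eq_square)
      then show ?thesis unfolding c_def using jtheta_reflect[OF p(2), of "x * q"] that q by simp
    qed
    have i4: "L (1 / x) = x\<^sup>2 * L x"
    proof -
      have "q ^ 4 / (- (x\<^sup>2)) = - ((1 / x)\<^sup>2 * q ^ 4)" by (simp add: power_divide)
      then have "L (1 / x) = jtheta (- (x\<^sup>2)) (q ^ 4)"
        unfolding L_def using jtheta_reflect[OF p4(2), of "- (x\<^sup>2)"] that by simp
      moreover have "L x = jtheta (- (x\<^sup>2)) (q ^ 4) / x\<^sup>2"
        unfolding L_def using jtheta_shift[OF p4, of "- (x\<^sup>2)"] that by (simp add: mult.commute)
      ultimately show ?thesis using that by simp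
    qed
    have i5: "M (1 / x) = M x"
    proof -
      have "q ^ 4 / (- (x\<^sup>2 * q\<^sup>2)) = - ((1 / x)\<^sup>2 * q\<^sup>2)"
        using q that by (simp add: field_simps eval_nat_numeral)
      then show ?thesis unfolding M_def using jtheta_reflect[OF p4(2), of "- (x\<^sup>2 * q\<^sup>2)"] that q by simp
    qed
    have i6: "Ng (- (1 / x * q)) = Ng (- (x * q))"
    proof -
      have "q\<^sup>2 / (- (x * q)) = - (1 / x * q)" using q that by (simp add: power2_eq_square)
      then show ?thesis using Ng(4)[of "- (x * q)"] that q by simp
    qed
    have T: "k / (1 / x) * (- A / x)\<^sup>2 * C * (x\<^sup>2 * l) * n = x\<^sup>2 * (k / x * A\<^sup>2 * C * l * n)"
      "k / (1 / x) * (- A / x)\<^sup>2 * (x\<^sup>2 * l) = x\<^sup>2 * (k / x * A\<^sup>2 * l)"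
      "k / ((1 / x)\<^sup>2 * J2\<^sup>2 * J8 ^ 4) * (- A / x)\<^sup>2 * m = x\<^sup>2 * (k / (x\<^sup>2 * J2\<^sup>2 * J8 ^ 4) * A\<^sup>2 * m)"
      "k / ((1 / x)\<^sup>2 * J8\<^sup>2) * (- A / x)\<^sup>2 * B\<^sup>2 = x\<^sup>2 * (k / (x\<^sup>2 * J8\<^sup>2) * A\<^sup>2 * B\<^sup>2)"
      for A B C l m n k
      using that Jnz by (simp_all add: field_simps eval_nat_numeral)
    have T': "k * B\<^sup>2 * (x\<^sup>2 * l) = x\<^sup>2 * (k * B\<^sup>2 * l)"
      "k * B\<^sup>2 * C * (x\<^sup>2 * l) * n = x\<^sup>2 * (k * B\<^sup>2 * C * l * n)" for B C l k n
      by (simp_all add: mult_ac)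
    show ?thesis
      unfolding E_def i1 i2 i3 i4 i5 i6 NK(4)[OF that] T
      unfolding T' by (simp only: ring_distribs)
  qed
  have E_hol: "E holomorphic_on - {0}"
  proof -
    have "(Ng \<circ> (\<lambda>x. - (x * q))) holomorphic_on - {0}"
      by (rule holomorphic_on_compose_gen[OF _ Ng(1)]) (use q in \<open>auto intro!: holomorphic_intros\<close>)
    then have "(\<lambda>x. Ng (- (x * q))) holomorphic_on - {0}" by (simp add: o_def)
    then show ?thesis
      unfolding E_def a_def b_def c_def L_def M_def
      using q p p4 NK(1) Jnz by (auto intro!: holomorphic_intros)
  qed
  have q_half: "jtheta q (q\<^sup>2) * J2 = J1\<^sup>2"
    using jtheta_half_period[OF q(1)] by (simp add: Jq)
  have p_half: "jtheta (q\<^sup>2) (q ^ 4) * J4 = J2\<^sup>2"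
    using jtheta_half_period[OF p(1)] by (simp add: q4 Jq)
  have p_mhalf: "jtheta (- (q\<^sup>2)) (q ^ 4) * J2\<^sup>2 * J8\<^sup>2 = J4 ^ 5"
    using jtheta_minus_half_period[OF p(1)] by (simp add: q4 Jq)
  \<comment> \<open>The zero of \<open>a\<close> removes all but the \<open>K_c\<close> term and the
    last term, and \<open>NK 1\<close> is known.\<close>
  have E1: "E 1 = 0"
  proof -
    have "a 1 = 0" by (simp add: a_def jtheta_one p)
    then have "E 1 = (b 1)\<^sup>2 * L 1 * (J1 * c 1 * NK 1 + J1 ^ 4)"
      by (simp add: E_def algebra_simps)
    moreover have "J1 * c 1 * NK 1 + J1 ^ 4 = 0"
      unfolding c_def NK(5) using q_half by simp algebra
    ultimately show ?thesis by simp
  qed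
  \<comment> \<open>The zero of \<open>b\<close> removes the \<open>K_c\<close> term, while the
    argument of \<open>Ng\<close> becomes 1, where its value is known.\<close>
  have Eq: "E (- 1 / q) = 0"
  proof -
    have bz: "b (- 1 / q) = 0" using q p by (simp add: b_def jtheta_one)
    have c: "c (- 1 / q) * J2 = 2 * J4\<^sup>2"
      using jtheta_minus_one[OF p(1)] q by (simp add: c_def q4 Jq)
    have l: "L (- 1 / q) * J2\<^sup>2 * J8\<^sup>2 = J4 ^ 5"
    proof -
      have "(- 1 / q)\<^sup>2 * q ^ 4 = q\<^sup>2" using q by (simp add: field_simps eval_nat_numeral)
      then show ?thesis unfolding L_def using p_mhalf by simp
    qed
    have m: "M (- 1 / q) * J4 = 2 * J8\<^sup>2"
    proof -
      have "(- 1 / q)\<^sup>2 * q\<^sup>2 = 1" using q by (simp add: field_simps eval_nat_numeral)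
      then show ?thesis unfolding M_def using jtheta_minus_one[OF p4(1)] by (simp add: q8 Jq)
    qed
    have "Ng (- (- 1 / q * q)) = J2 * J4" using q Ng1 by simp
    then have "E (- 1 / q) = q\<^sup>2 * (a (- 1 / q))\<^sup>2 * (- 2 * J4 * c (- 1 / q) * L (- 1 / q) * (J2 * J4)
        + 2 * J4 ^ 4 * L (- 1 / q) + J4 ^ 10 * M (- 1 / q) / (J2\<^sup>2 * J8 ^ 4))"
      unfolding E_def bz using q by (simp add: field_simps power2_eq_square)
    also have "- 2 * J4 * c (- 1 / q) * L (- 1 / q) * (J2 * J4) + 2 * J4 ^ 4 * L (- 1 / q)
        + J4 ^ 10 * M (- 1 / q) / (J2\<^sup>2 * J8 ^ 4) = 0"
    proof -
      have v: "c (- 1 / q) = 2 * J4\<^sup>2 / J2" "L (- 1 / q) = J4 ^ 5 / (J2\<^sup>2 * J8\<^sup>2)" "M (- 1 / q) = 2 * J8\<^sup>2 / J4"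
        using c l m Jnz by (simp_all add: field_simps)
      show ?thesis unfolding v using Jnz by (simp add: field_simps eval_nat_numeral)
    qed
    finally show ?thesis by simp
  qed
  \<comment> \<open>The zero of \<open>L\<close> removes both series. Reflection gives b = c at this
    point, so their product formula yields the square of b.\<close>
  have Ei: "E \<i> = 0"
  proof -
    have l: "L \<i> = 0" using jtheta_self[OF p4] by (simp add: L_def)
    have m: "M \<i> = J2\<^sup>2 / J4"
      using p_half Jnz by (simp add: M_def field_simps)
    have "b \<i> = c \<i>"
    proof -
      have "q\<^sup>2 / (\<i> * q) = - (\<i> * q)" using q by (simp add: power2_eq_square)
      then show ?thesis using jtheta_reflect[OF p(2), of "\<i> * q"] q by (simp add: b_def c_def)
    qed
    moreover have "c \<i> * b \<i> * J4 = jtheta (- (q\<^sup>2)) (q ^ 4) * J2\<^sup>2"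
      using jtheta_mult_minus[OF p(1), of "\<i> * q"] by (simp add: b_def c_def q4 Jq power_mult_distrib)
    ultimately have "(b \<i>)\<^sup>2 * J4 * J8\<^sup>2 = J4 ^ 5"
      using p_mhalf by (simp add: power2_eq_square mult_ac)
    then have b: "(b \<i>)\<^sup>2 = J4 ^ 4 / J8\<^sup>2"
      using Jnz by (simp add: field_simps eval_nat_numeral)
    show ?thesis
      unfolding E_def l m b using Jnz by (simp add: field_simps eval_nat_numeral)
  qed
  have E_zero: "E x = 0" if "x \<noteq> 0" for x
  proof (rule quasi_periodic_five_zeros_eq_0[OF p, of "1 / q ^ 6" E 1 "- 1 / q" "\<i>"])
    show "deriv E 1 = 0"
      by (rule deriv_eq_0_of_involution[OF E_hol _ E1, of 1 2]) (use E_inv in auto)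
    show "deriv E (- 1 / q) = 0"
    proof (rule deriv_eq_0_of_involution[OF E_hol _ Eq, of "1 / q\<^sup>2" "-2"])
      fix x :: complex assume x: "x \<noteq> 0"
      have "(- 1 / q)\<^sup>2 / x = 1 / (q\<^sup>2 * x)" by (simp add: power_divide)
      \<comment> \<open>Inversion after the shift x -> q^2 x. The total multiplier 1/(q^2 x^2) is 1
        at the fixed point.\<close>
      then have "E ((- 1 / q)\<^sup>2 / x) = (q\<^sup>2 * x)\<^sup>2 * (1 / q ^ 6 * x powi (-4) * E x)"
        using E_inv[of "q\<^sup>2 * x"] E_shift[OF x] x q by simp
      also have "\<dots> = 1 / q\<^sup>2 * x powi (-2) * E x"
        using x q by (simp add: power_int_def field_simps eval_nat_numeral)
      finally show "E ((- 1 / q)\<^sup>2 / x) = 1 / q\<^sup>2 * x powi (-2) * E x" .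
    qed (use q in \<open>simp_all add: power_int_def field_simps eval_nat_numeral\<close>)
    show "jtheta (- 1 / q / 1) (q\<^sup>2) \<noteq> 0"
      by (rule jtheta_square_nome_nonzero[OF q, of _ "-1"])
         (use q in \<open>auto simp: power_int_minus norm_divide norm_inverse field_simps\<close>)
    show "jtheta (\<i> / 1) (q\<^sup>2) \<noteq> 0"
      by (rule jtheta_square_nome_nonzero[OF q, of _ 0]) (auto simp: complex_eq_iff)
    show "jtheta (\<i> / (- 1 / q)) (q\<^sup>2) \<noteq> 0"
      by (rule jtheta_square_nome_nonzero[OF q, of _ 1])
         (use q in \<open>auto simp: norm_mult complex_eq_iff\<close>)
  qed (use E_hol E_shift E1 Eq Ei q that in auto)
  have ac: "a x * c x * J1 = jtheta x q * J2\<^sup>2"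
    using jtheta_split_even_odd[OF q, of x] by (simp add: a_def c_def Jq)
  have bc: "c x * b x * J4 = jtheta (x\<^sup>2 * q\<^sup>2) (q ^ 4) * J2\<^sup>2"
    using jtheta_mult_minus[OF p(1), of "x * q"] by (simp add: b_def c_def q4 Jq power_mult_distrib)
  have nz': "a x \<noteq> 0" "b x \<noteq> 0" "c x \<noteq> 0" "L x \<noteq> 0"
    using ac bc nz Jnz by (auto simp: L_def c_def)
  have ac': "jtheta x q = a x * c x * J1 / J2\<^sup>2"
    using ac Jnz by (simp add: field_simps)
  have bc': "jtheta (x\<^sup>2 * q\<^sup>2) (q ^ 4) = c x * b x * J4 / J2\<^sup>2"
    using bc Jnz by (simp add: field_simps)
  have K: "K_c x q / (x - 1) = NK x / a x"
    using NK(2)[OF x] nz' by (simp add: a_def)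
  have folded: "jtheta x (q\<^sup>2) = a x" "jtheta (- (x * q)) (q\<^sup>2) = b x" "jtheta (x * q) (q\<^sup>2) = c x"
    "jtheta (- (x\<^sup>2 * q ^ 4)) (q ^ 4) = L x" "jtheta (- (x\<^sup>2 * q\<^sup>2)) (q ^ 4) = M x"
    by (simp_all add: a_def b_def c_def L_def M_def)
  have lhs: "J1 * b x / (x - 1) * K_c x q = J1 * b x * (NK x / a x)"
    unfolding K[symmetric] by simp
  have expand: "J1 * B * (nk / A) + 2 * q * J4 * A / x * (ng / B)
      - (2 * q * J4 ^ 5 * A / (x * J2\<^sup>2 * (C * B * J4 / J2\<^sup>2))
         - J4 ^ 11 * A * m / (x\<^sup>2 * J2 ^ 4 * J8 ^ 4 * (C * B * J4 / J2\<^sup>2) * l)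
         + J4 ^ 5 * A * B / (x\<^sup>2 * J8\<^sup>2 * C * l)
         - J1 ^ 5 * B / (J2\<^sup>2 * (A * C * J1 / J2\<^sup>2)))
      = (J1 * B\<^sup>2 * C * l * nk + 2 * q * J4 / x * A\<^sup>2 * C * l * ng
         - 2 * q * J4 ^ 4 / x * A\<^sup>2 * l + J4 ^ 10 / (x\<^sup>2 * J2\<^sup>2 * J8 ^ 4) * A\<^sup>2 * m
         - J4 ^ 5 / (x\<^sup>2 * J8\<^sup>2) * A\<^sup>2 * B\<^sup>2 + J1 ^ 4 * B\<^sup>2 * l) / (A * B * C * l)"
    if "A \<noteq> 0" "B \<noteq> 0" "C \<noteq> 0" "l \<noteq> 0" for A B C l m nk ng
    using that x Jnz by (simp add: field_simps eval_nat_numeral)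
  show ?thesis
    unfolding Jdefs[symmetric] folded ac' bc' lhs Ng(2)
    using expand[OF nz', of "NK x" "Ng (- (x * q))" "M x"] E_zero[OF x(1)]
    by (simp add: E_def)
qed

lemma third_identity:
  fixes q x :: complex
  assumes q: "norm q < 1" "q \<noteq> 0" and x: "x \<noteq> 0"
    and nz: "jtheta (x\<^sup>2 * q\<^sup>2) (q ^ 4) \<noteq> 0" "jtheta (- (x\<^sup>2)) (q ^ 4) \<noteq> 0"
      "jtheta (- (x\<^sup>2)) (q\<^sup>2) \<noteq> 0" "jtheta (x * q) (q\<^sup>2) \<noteq> 0"
  shows "2 * x * J 4 q ^ 2 * jtheta (x * q) (q\<^sup>2) * S2_c (x\<^sup>2) (q\<^sup>2)
          - q * J 2 q ^ 2 * jtheta (x\<^sup>2 * q\<^sup>2) (q ^ 4) * g3_c (x * q) (q\<^sup>2)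
        = x * J 4 q ^ 12 * jtheta (x * q) (q\<^sup>2) * jtheta (- (x\<^sup>2 * q\<^sup>2)) (q ^ 4)
            / (J 2 q ^ 4 * J 8 q ^ 4 * jtheta (x\<^sup>2 * q\<^sup>2) (q ^ 4) * jtheta (- (x\<^sup>2)) (q ^ 4))
          - x * J 2 q ^ 5 * jtheta (x\<^sup>2 * q\<^sup>2) (q ^ 4) * jtheta (- (x * q)) (q\<^sup>2) ^ 2
            / (2 * J 4 q ^ 2 * jtheta (- (x\<^sup>2)) (q\<^sup>2) * jtheta (x * q) (q\<^sup>2))
          - x * J 2 q ^ 5 * jtheta (x * q) (q\<^sup>2) * jtheta (x\<^sup>2 * q\<^sup>2) (q ^ 4)
            / (2 * J 4 q ^ 2 * jtheta (- (x\<^sup>2)) (q\<^sup>2))"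
proof -
  define J2 J4 J8 where "J2 = J 2 q" and "J4 = J 4 q" and "J8 = J 8 q"
  note Jdefs = J2_def J4_def J8_def
  have p: "norm (q\<^sup>2) < 1" "q\<^sup>2 \<noteq> 0" using q norm_power2_less_one by auto
  have q4: "(q\<^sup>2)\<^sup>2 = q ^ 4" "(q\<^sup>2) ^ 4 = q ^ 8" by (simp_all flip: power_mult)
  have p4: "norm (q ^ 4) < 1" "q ^ 4 \<noteq> 0" using p norm_power2_less_one[of "q\<^sup>2"] q4 by auto
  have q8: "(q ^ 4)\<^sup>2 = q ^ 8" by (simp flip: power_mult)
  have Jq: "qpoch_inf (q\<^sup>2) (q\<^sup>2) = J2" "qpoch_inf (q ^ 4) (q ^ 4) = J4" "qpoch_inf (q ^ 8) (q ^ 8) = J8"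
    by (simp_all add: Jdefs J_def)
  have Jnz: "J2 \<noteq> 0" "J4 \<noteq> 0" "J8 \<noteq> 0"
    using qpoch_inf_self_nonzero[OF p(1)] qpoch_inf_self_nonzero[OF p4(1)]
      qpoch_inf_self_nonzero[OF norm_power2_less_one[OF p4(1)]] by (simp_all add: q8 Jq)
  obtain NS where NS: "NS holomorphic_on - {0}"
    "\<And>X. X \<noteq> 0 \<Longrightarrow> S2_c X (q\<^sup>2) = NS X / jtheta (X * q\<^sup>2) (q ^ 4)"
    "\<And>X. X \<noteq> 0 \<Longrightarrow> NS (q ^ 4 * X) = NS X / q\<^sup>2 - (1 - q\<^sup>2 * X) * (jtheta (X * q\<^sup>2) (q ^ 4))\<^sup>2
        / (q ^ 4 * X\<^sup>2 * J4 * qpoch_inf (- (q\<^sup>2)) (q ^ 4) * qpoch_inf (-1) (q ^ 4))"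
    "\<And>X. X \<noteq> 0 \<Longrightarrow> NS (1 / X) = X * NS X"
    "NS (1 / q\<^sup>2) = q\<^sup>2 * J4\<^sup>2 * qpoch_inf (- (q\<^sup>2)) (q\<^sup>2) / qpoch_inf (q\<^sup>2) (q ^ 4)"
    unfolding Jq[symmetric] by (rule S2_c_entire[OF p, unfolded q4]) blast
  obtain N3 where N3: "N3 holomorphic_on - {0}" "\<And>y. g3_c y (q\<^sup>2) = N3 y / jtheta y (q\<^sup>2)"
    "\<And>y. y \<noteq> 0 \<Longrightarrow> N3 (q\<^sup>2 * y) = y\<^sup>2 * N3 y - (1 - y\<^sup>2) * (jtheta y (q\<^sup>2))\<^sup>2 / (y * J2)"
    "\<And>y. y \<noteq> 0 \<Longrightarrow> N3 (q\<^sup>2 / y) = N3 y" "N3 1 = J2\<^sup>2"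
    unfolding Jq[symmetric] by (rule g3_c_entire[OF p]) blast
  have m2: "qpoch_inf (- (q\<^sup>2)) (q\<^sup>2) = J4 / J2"
    using qpoch_inf_minus_self[OF p(1)] Jnz by (simp add: q4 Jq field_simps)
  have s2: "qpoch_inf (q\<^sup>2) (q ^ 4) = J2 / J4"
    using qpoch_inf_self_square[OF p(1)] Jnz by (simp add: q4 Jq field_simps)
  have NS1: "NS (1 / q\<^sup>2) = q\<^sup>2 * J4 ^ 4 / J2\<^sup>2"
    unfolding NS(5) m2 s2 using Jnz by (simp add: field_simps eval_nat_numeral)
  \<comment> \<open>Brings the constant in the equation of \<open>NS\<close> into a form that can
    cancel against the one for \<open>N3\<close>.\<close>
  have den: "J4 * qpoch_inf (- (q\<^sup>2)) (q ^ 4) * qpoch_inf (-1) (q ^ 4) = 2 * J4\<^sup>2 / J2"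
  proof -
    have 1: "qpoch_inf (-1) (q ^ 4) = 2 * (J8 / J4)"
      using qpoch_inf_minus_self[OF p4(1)] qpoch_inf_minus_one[OF p4(1)] Jnz by (simp add: q8 Jq field_simps)
    have "qpoch_inf (q ^ 4) (q ^ 8) = J4 / J8"
      using qpoch_inf_self_square[OF p4(1)] Jnz by (simp add: q8 Jq field_simps)
    moreover have "qpoch_inf (q\<^sup>2) (q ^ 4) * qpoch_inf (- (q\<^sup>2)) (q ^ 4) = qpoch_inf (q ^ 4) (q ^ 8)"
      using qpoch_inf_mult_minus[OF p4(1), of "q\<^sup>2"] by (simp add: q4 q8)
    ultimately have "J2 / J4 * qpoch_inf (- (q\<^sup>2)) (q ^ 4) = J4 / J8"
      unfolding s2 by simp
    then have 2: "qpoch_inf (- (q\<^sup>2)) (q ^ 4) = J4\<^sup>2 / (J2 * J8)"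
      using Jnz by (simp add: field_simps power2_eq_square)
    show ?thesis
      unfolding 1 2 using Jnz by (simp add: field_simps power2_eq_square)
  qed
  define a b L M where
    "a = (\<lambda>x. jtheta (x * q) (q\<^sup>2))" and "b = (\<lambda>x. jtheta (- (x * q)) (q\<^sup>2))"
    and "L = (\<lambda>x. jtheta (- (x\<^sup>2)) (q ^ 4))" and "M = (\<lambda>x. jtheta (- (x\<^sup>2 * q\<^sup>2)) (q ^ 4))"
  have ab: "jtheta (x\<^sup>2 * q\<^sup>2) (q ^ 4) = a x * b x * J4 / J2\<^sup>2" for x
    using jtheta_mult_minus[OF p(1), of "x * q"] Jnz
    by (simp add: a_def b_def q4 Jq power_mult_distrib field_simps)
  \<comment> \<open>The difference of the two sides times b L M;
    \<open>jtheta (- (x^2)) (q^2)\<close> splits into L M, and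
    \<open>jtheta (x^2 * q^2) (q^4)\<close> into a b.\<close>
  define E where "E = (\<lambda>x. (2 * x * J4 * J2\<^sup>2 * NS (x\<^sup>2) - q * J4 * (b x)\<^sup>2 * N3 (x * q)) * L x * M x
     - x * J4 ^ 11 / (J2\<^sup>2 * J8 ^ 4) * (M x)\<^sup>2
     + x * (J2\<^sup>2 * J4 / 2) * ((b x) ^ 4 + (a x)\<^sup>2 * (b x)\<^sup>2))"
  have shifts: "a (q\<^sup>2 * x) = - a x / (x * q)" "b (q\<^sup>2 * x) = b x / (x * q)"
    "L (q\<^sup>2 * x) = L x / x\<^sup>2" "M (q\<^sup>2 * x) = M x / (x\<^sup>2 * q\<^sup>2)"
    "N3 (q\<^sup>2 * x * q) = (x * q)\<^sup>2 * N3 (x * q) - (1 - (x * q)\<^sup>2) * (a x)\<^sup>2 / (x * q * J2)"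
    "NS ((q\<^sup>2 * x)\<^sup>2) = NS (x\<^sup>2) / q\<^sup>2 - (1 - (x * q)\<^sup>2) * (a x * b x * J4 / J2\<^sup>2)\<^sup>2 / (q ^ 4 * x ^ 4 * (2 * J4\<^sup>2 / J2))"
    if "x \<noteq> 0" for x
  proof -
    show "b (q\<^sup>2 * x) = b x / (x * q)"
      unfolding b_def using jtheta_shift[OF p, of "- (x * q)"] that q by (simp add: mult_ac)
    show "a (q\<^sup>2 * x) = - a x / (x * q)"
      unfolding a_def using jtheta_shift[OF p, of "x * q"] that q by (simp add: mult_ac)
    show "L (q\<^sup>2 * x) = L x / x\<^sup>2"
      unfolding L_def using jtheta_shift[OF p4, of "- (x\<^sup>2)"] that q
      by (simp add: power_mult_distrib q4)
    show "M (q\<^sup>2 * x) = M x / (x\<^sup>2 * q\<^sup>2)"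
      unfolding M_def using jtheta_shift[OF p4, of "- (x\<^sup>2 * q\<^sup>2)"] that q
      by (simp add: power_mult_distrib q4 mult.assoc)
    show "N3 (q\<^sup>2 * x * q) = (x * q)\<^sup>2 * N3 (x * q) - (1 - (x * q)\<^sup>2) * (a x)\<^sup>2 / (x * q * J2)"
      using N3(3)[of "x * q"] that q by (simp add: a_def mult.assoc)
    have eq: "(q\<^sup>2 * x)\<^sup>2 = q ^ 4 * x\<^sup>2" "(x\<^sup>2)\<^sup>2 = x ^ 4" "q\<^sup>2 * x\<^sup>2 = (x * q)\<^sup>2"
      by (simp_all add: power_mult_distrib q4 mult.commute flip: power_mult)
    have "x\<^sup>2 \<noteq> 0" using that by simp
    from NS(3)[OF this]
    have "NS (q ^ 4 * x\<^sup>2) = NS (x\<^sup>2) / q\<^sup>2 - (1 - (x * q)\<^sup>2) * (a x * b x * J4 / J2\<^sup>2)\<^sup>2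
        / (q ^ 4 * x ^ 4 * (J4 * qpoch_inf (- (q\<^sup>2)) (q ^ 4) * qpoch_inf (-1) (q ^ 4)))"
      unfolding ab eq by (simp only: mult.assoc)
    then show "NS ((q\<^sup>2 * x)\<^sup>2) = NS (x\<^sup>2) / q\<^sup>2 - (1 - (x * q)\<^sup>2) * (a x * b x * J4 / J2\<^sup>2)\<^sup>2 / (q ^ 4 * x ^ 4 * (2 * J4\<^sup>2 / J2))"
      unfolding den eq .
  qed
  have E_shift: "E (q\<^sup>2 * x) = 1 / q\<^sup>2 * x powi (-4) * E x" if "x \<noteq> 0" for x
  proof -
    have *: "x powi (-4) = 1 / x ^ 4" by (simp add: power_int_def power_one_over inverse_eq_divide)
    \<comment> \<open>Both inhomogeneous parts equal (1 - x^2 q^2) A^2 B^2 J4 / (q^2 x^3 J2) up to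
      sign, before the common factors in l and m, and cancel.\<close>
    have K: "(2 * (q\<^sup>2 * x) * J4 * J2\<^sup>2 * (ns / q\<^sup>2 - (1 - (x * q)\<^sup>2) * (A * B * J4 / J2\<^sup>2)\<^sup>2 / (q ^ 4 * x ^ 4 * (2 * J4\<^sup>2 / J2)))
          - q * J4 * (B / (x * q))\<^sup>2 * ((x * q)\<^sup>2 * n3 - (1 - (x * q)\<^sup>2) * A\<^sup>2 / (x * q * J2))) * (l / x\<^sup>2) * (m / (x\<^sup>2 * q\<^sup>2))
        = 1 / q\<^sup>2 * (1 / x ^ 4) * ((2 * x * J4 * J2\<^sup>2 * ns - q * J4 * B\<^sup>2 * n3) * l * m)" for A B l m ns n3
      using that q Jnz by (simp add: field_simps eval_nat_numeral)
    have T: "q\<^sup>2 * x * J4 ^ 11 / (J2\<^sup>2 * J8 ^ 4) * (m / (x\<^sup>2 * q\<^sup>2))\<^sup>2 = 1 / q\<^sup>2 * (1 / x ^ 4) * (x * J4 ^ 11 / (J2\<^sup>2 * J8 ^ 4) * m\<^sup>2)"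
      "q\<^sup>2 * x * k * ((B / (x * q)) ^ 4 + (- A / (x * q))\<^sup>2 * (B / (x * q))\<^sup>2) = 1 / q\<^sup>2 * (1 / x ^ 4) * (x * k * (B ^ 4 + A\<^sup>2 * B\<^sup>2))" for A B m k
      using that q Jnz by (simp_all add: field_simps eval_nat_numeral)
    show ?thesis
      unfolding E_def shifts[OF that] * T
      using K[of "NS (x\<^sup>2)" "a x" "b x" "N3 (x * q)" "L x" "M x"]
      by (simp only: ring_distribs)
  qed
  have E_inv: "E (1 / x) = x powi (-2) * E x" if "x \<noteq> 0" for x
  proof -
    have i1: "a (1 / x) = a x"
    proof -
      have "q\<^sup>2 / (x * q) = 1 / x * q" using q that by (simp add: power2_eq_square)
      then show ?thesis unfolding a_def using jtheta_reflect[OF p(2), of "x * q"] that q by simp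
    qed
    have i2: "b (1 / x) = b x"
    proof -
      have "q\<^sup>2 / (- (x * q)) = - (1 / x * q)" using q that by (simp add: power2_eq_square)
      then show ?thesis unfolding b_def using jtheta_reflect[OF p(2), of "- (x * q)"] that q by simp
    qed
    have i3: "L (1 / x) = L x / x\<^sup>2"
      unfolding L_def using jtheta_inverse[OF p4, of "- (x\<^sup>2)"] that by (simp add: power_divide)
    have i4: "M (1 / x) = M x"
    proof -
      have "q ^ 4 / (- (x\<^sup>2 * q\<^sup>2)) = - ((1 / x)\<^sup>2 * q\<^sup>2)"
        using q that by (simp add: field_simps eval_nat_numeral)
      then show ?thesis unfolding M_def using jtheta_reflect[OF p4(2), of "- (x\<^sup>2 * q\<^sup>2)"] that q by simp
    qed
    have i5: "N3 (1 / x * q) = N3 (x * q)"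
    proof -
      have "q\<^sup>2 / (x * q) = 1 / x * q" using q that by (simp add: power2_eq_square)
      then show ?thesis using N3(4)[of "x * q"] that q by simp
    qed
    have i6: "NS ((1 / x)\<^sup>2) = x\<^sup>2 * NS (x\<^sup>2)"
      using NS(4)[of "x\<^sup>2"] that by (simp add: power_divide)
    have *: "x powi (-2) = 1 / x\<^sup>2" by (simp add: power_int_def power_one_over inverse_eq_divide)
    have K: "(2 * (1 / x) * J4 * J2\<^sup>2 * (x\<^sup>2 * ns) - k) * (l / x\<^sup>2) * m = 1 / x\<^sup>2 * ((2 * x * J4 * J2\<^sup>2 * ns - k) * l * m)"
      "1 / x * J4 ^ 11 / (J2\<^sup>2 * J8 ^ 4) * k = 1 / x\<^sup>2 * (x * J4 ^ 11 / (J2\<^sup>2 * J8 ^ 4) * k)"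
      "1 / x * k * k' = 1 / x\<^sup>2 * (x * k * k')" for ns l m k k'
      using that by (simp_all add: power2_eq_square)
    show ?thesis
      unfolding E_def i1 i2 i3 i4 i5 i6 * K(1,2) K(3)[of "J2\<^sup>2 * J4 / 2"]
      by (simp only: ring_distribs)
  qed
  have E_hol: "E holomorphic_on - {0}"
  proof -
    have "(N3 \<circ> (\<lambda>x. x * q)) holomorphic_on - {0}"
      by (rule holomorphic_on_compose_gen[OF _ N3(1)]) (use q in \<open>auto intro!: holomorphic_intros\<close>)
    moreover have "(NS \<circ> (\<lambda>x. x\<^sup>2)) holomorphic_on - {0}"
      by (rule holomorphic_on_compose_gen[OF _ NS(1)]) (auto intro!: holomorphic_intros)
    ultimately have "(\<lambda>x. N3 (x * q)) holomorphic_on - {0}" "(\<lambda>x. NS (x\<^sup>2)) holomorphic_on - {0}"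
      by (simp_all add: o_def)
    then show ?thesis
      unfolding E_def a_def b_def L_def M_def
      using q p p4 Jnz by (auto intro!: holomorphic_intros)
  qed
  have mhalf: "jtheta (- (q\<^sup>2)) (q ^ 4) = J4 ^ 5 / (J2\<^sup>2 * J8\<^sup>2)"
    using jtheta_minus_half_period[OF p(1)] Jnz by (simp add: q4 Jq field_simps)
  have m1: "jtheta (-1) (q\<^sup>2) = 2 * J4\<^sup>2 / J2"
    using jtheta_minus_one[OF p(1)] Jnz by (simp add: q4 Jq field_simps)
  have E_pm: "E u = 0" if u: "u = 1 / q \<or> u = - 1 / q" for u
  proof -
    have u2: "u\<^sup>2 = 1 / q\<^sup>2" using u by (auto simp: power_divide)
    have uq: "u * q = 1 \<or> u * q = -1" using u q by auto
    have l: "L u = J4 ^ 5 / (J2\<^sup>2 * J8\<^sup>2) / q\<^sup>2"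
    proof -
      have "q ^ 4 * (- (1 / q\<^sup>2)) = - (q\<^sup>2)" using q by (simp add: field_simps eval_nat_numeral)
      then have "jtheta (- (q\<^sup>2)) (q ^ 4) = jtheta (- (1 / q\<^sup>2)) (q ^ 4) * q\<^sup>2"
        using jtheta_shift[OF p4, of "- (1 / q\<^sup>2)"] q by simp
      then show ?thesis
        using q unfolding L_def u2 mhalf by (simp add: field_simps)
    qed
    have m: "M u = 2 * J8\<^sup>2 / J4"
    proof -
      have "u\<^sup>2 * q\<^sup>2 = 1" using q by (simp add: u2)
      then show ?thesis
        unfolding M_def using jtheta_minus_one[OF p4(1)] Jnz by (simp add: q8 Jq field_simps)
    qed
    \<comment> \<open>\<open>NS\<close> sees only u^2 = 1/q^2, so its known value serves both points
      and cancels the term with M^2.\<close>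
    have "(2 * u * J4 * J2\<^sup>2 * NS (u\<^sup>2)) * L u * M u - u * J4 ^ 11 / (J2\<^sup>2 * J8 ^ 4) * (M u)\<^sup>2 = 0"
      unfolding u2 NS1 l m using q Jnz by (simp add: field_simps eval_nat_numeral)
    then have E: "E u = u * (J2\<^sup>2 * J4 / 2) * ((b u) ^ 4 + (a u)\<^sup>2 * (b u)\<^sup>2) - q * J4 * (b u)\<^sup>2 * N3 (u * q) * L u * M u"
      unfolding E_def by (simp add: algebra_simps)
    show ?thesis
    \<comment> \<open>At 1/q the value \<open>N3 1\<close> is known and a vanishes; at -1/q the zero
      of b removes the unknown \<open>N3 (-1)\<close> together with the rest.\<close>
    proof (cases "u * q = 1")
      case True
      then have 1: "a u = 0" "b u = 2 * J4\<^sup>2 / J2" "N3 (u * q) = J2\<^sup>2" "u = 1 / q"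
        using q u by (simp_all add: a_def b_def jtheta_one p m1 N3(5) field_simps)
      show ?thesis
        unfolding E l m 1(1-3) using q Jnz by (simp add: 1(4) field_simps eval_nat_numeral)
    next
      case False
      then have "b u = 0" using uq by (simp add: b_def jtheta_one p)
      then show ?thesis unfolding E by simp
    qed
  qed
  have Ei: "E (\<i> * q) = 0"
  proof -
    have m: "M (\<i> * q) = 0"
    proof -
      have "- ((\<i> * q)\<^sup>2 * q\<^sup>2) = q ^ 4" by (simp add: power_mult_distrib flip: power_add)
      then show ?thesis using jtheta_self[OF p4] by (simp add: M_def)
    qed
    have i: "1 / \<i> = - \<i>" by (simp add: field_simps)
    \<comment> \<open>Here a = \<open>\<i>\<close> b, so a^2 = -b^2 and the last bracket of
      \<open>E\<close> vanishes, while M = 0 removes all other terms.\<close>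
    have "a (\<i> * q) = \<i> * jtheta \<i> (q\<^sup>2)"
      using jtheta_shift[OF p, of \<i>] by (simp add: a_def power2_eq_square mult_ac)
    moreover have "b (\<i> * q) = jtheta \<i> (q\<^sup>2)"
      using jtheta_shift[OF p, of "- \<i>"] jtheta_inverse[OF p, of \<i>] i
      by (simp add: b_def power2_eq_square mult_ac)
    ultimately have "(b (\<i> * q)) ^ 4 + (a (\<i> * q))\<^sup>2 * (b (\<i> * q))\<^sup>2 = 0"
      by (simp add: power_mult_distrib flip: power_add)
    then show ?thesis unfolding E_def m by simp
  qed
  have E_deriv: "deriv E u = 0" if u: "u = 1 / q \<or> u = - 1 / q" for u
  proof (rule deriv_eq_0_of_involution[OF E_hol _ E_pm[OF u], of "1 / q ^ 6" "-6"])
    have u2: "u\<^sup>2 = 1 / q\<^sup>2" using u by (auto simp: power_divide)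
    show "u \<noteq> 0" using u q by auto
    have "u ^ 6 = (u\<^sup>2) ^ 3" by (simp flip: power_mult)
    also have "\<dots> = 1 / q ^ 6" unfolding u2 by (simp add: power_one_over flip: power_mult)
    finally have "u ^ 6 = 1 / q ^ 6" .
    then show "1 / q ^ 6 * u powi - 6 = 1"
      using q by (simp add: power_int_def power_inverse)
    fix x :: complex assume x: "x \<noteq> 0"
    have "u\<^sup>2 / x = 1 / (q\<^sup>2 * x)" by (simp add: u2)
    \<comment> \<open>Inversion after the shift, as in the second identity. The multiplier is now
      (qx)^(-6), equal to 1 at both fixed points.\<close>
    then have "E (u\<^sup>2 / x) = (q\<^sup>2 * x) powi (-2) * (1 / q\<^sup>2 * x powi (-4) * E x)"
      using E_inv[of "q\<^sup>2 * x"] E_shift[OF x] x q by simp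
    also have "\<dots> = 1 / q ^ 6 * x powi (-6) * E x"
      using x q by (simp add: power_int_def field_simps eval_nat_numeral)
    finally show "E (u\<^sup>2 / x) = 1 / q ^ 6 * x powi (-6) * E x" .
  qed
  have E_zero: "E x = 0" if "x \<noteq> 0" for x
  proof (rule quasi_periodic_five_zeros_eq_0[OF p, of "1 / q\<^sup>2" E "1 / q" "- 1 / q" "\<i> * q"])
    show "jtheta (- 1 / q / (1 / q)) (q\<^sup>2) \<noteq> 0"
      by (rule jtheta_square_nome_nonzero[OF q, of _ 0]) (use q in auto)
    show "jtheta (\<i> * q / (1 / q)) (q\<^sup>2) \<noteq> 0"
      by (rule jtheta_square_nome_nonzero[OF q, of _ 2])
         (use q in \<open>auto simp: norm_mult norm_power power2_eq_square complex_eq_iff\<close>)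
    show "jtheta (\<i> * q / (- 1 / q)) (q\<^sup>2) \<noteq> 0"
      by (rule jtheta_square_nome_nonzero[OF q, of _ 2])
         (use q in \<open>auto simp: norm_mult norm_power power2_eq_square complex_eq_iff\<close>)
  qed (use E_hol E_shift E_pm E_deriv Ei q that in auto)
  have lm: "jtheta (- (x\<^sup>2)) (q\<^sup>2) = L x * M x * J2 / J4\<^sup>2"
    using jtheta_split_even_odd[OF p, of "- (x\<^sup>2)"] Jnz by (simp add: L_def M_def q4 Jq field_simps)
  have nz': "a x \<noteq> 0" "b x \<noteq> 0" "L x \<noteq> 0" "M x \<noteq> 0"
    using lm ab[of x] nz by (auto simp: a_def)
  have folded: "jtheta (x * q) (q\<^sup>2) = a x" "jtheta (- (x * q)) (q\<^sup>2) = b x"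
    "jtheta (- (x\<^sup>2)) (q ^ 4) = L x" "jtheta (- (x\<^sup>2 * q\<^sup>2)) (q ^ 4) = M x"
    by (simp_all add: a_def b_def L_def M_def)
  have S: "S2_c (x\<^sup>2) (q\<^sup>2) = NS (x\<^sup>2) / (a x * b x * J4 / J2\<^sup>2)"
    using NS(2)[of "x\<^sup>2"] x ab[of x] by simp
  have G: "g3_c (x * q) (q\<^sup>2) = N3 (x * q) / a x"
    by (simp add: N3(2) a_def)
  have expand: "2 * x * J4\<^sup>2 * A * (ns / (A * B * J4 / J2\<^sup>2)) - q * J2\<^sup>2 * (A * B * J4 / J2\<^sup>2) * (n3 / A)
      - (x * J4 ^ 12 * A * m / (J2 ^ 4 * J8 ^ 4 * (A * B * J4 / J2\<^sup>2) * l)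
         - x * J2 ^ 5 * (A * B * J4 / J2\<^sup>2) * B\<^sup>2 / (2 * J4\<^sup>2 * (l * m * J2 / J4\<^sup>2) * A)
         - x * J2 ^ 5 * A * (A * B * J4 / J2\<^sup>2) / (2 * J4\<^sup>2 * (l * m * J2 / J4\<^sup>2)))
      = ((2 * x * J4 * J2\<^sup>2 * ns - q * J4 * B\<^sup>2 * n3) * l * m
         - x * J4 ^ 11 / (J2\<^sup>2 * J8 ^ 4) * m\<^sup>2 + x * (J2\<^sup>2 * J4 / 2) * (B ^ 4 + A\<^sup>2 * B\<^sup>2)) / (B * l * m)"
    if "A \<noteq> 0" "B \<noteq> 0" "l \<noteq> 0" "m \<noteq> 0" for A B l m ns n3
    using that x Jnz by (simp add: field_simps eval_nat_numeral)
  show ?thesis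
    unfolding Jdefs[symmetric] folded lm S G ab
    using expand[OF nz', of "NS (x\<^sup>2)" "N3 (x * q)"] E_zero[OF x]
    by (simp add: E_def)
qed

text \<open>The index n = 0 suffices: \<open>qpoch\<close> is nonzero there only if its infinite
  product is, and the two products contain every factor of the theta function except 1 - x and
  (q^2;q^2)_inf.\<close>

lemma K_c_defined_imp_jtheta_nonzero:
  assumes "norm q < 1" "x \<noteq> 1" "K_c_defined x q"
  shows "jtheta x (q\<^sup>2) \<noteq> 0"
proof -
  have p: "norm (q\<^sup>2) < 1" by (rule norm_power2_less_one[OF assms(1)])
  have "qpoch (x * q\<^sup>2) (q\<^sup>2) 0 * qpoch (q\<^sup>2 / x) (q\<^sup>2) 0 \<noteq> 0"
    using assms(3) unfolding K_c_defined_def by blast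
  then have "qpoch_inf (x * q\<^sup>2) (q\<^sup>2) \<noteq> 0" "qpoch_inf (q\<^sup>2 / x) (q\<^sup>2) \<noteq> 0"
    by (auto simp: qpoch_def)
  then show ?thesis
    using jtheta_expand[OF p, of x] qpoch_inf_self_nonzero[OF p] assms(2) by simp
qed

lemma first_identity:
  assumes "norm q < 1" "q \<noteq> 0" "x \<noteq> 0" "jtheta x (q\<^sup>2) \<noteq> 0"
  shows "x / (x - 1) * K_c x q + (1 - 1 / (x * q)) * K1_c (x * q) q = jtheta (x * q\<^sup>2) (q\<^sup>2) / J 1 q"
proof -
  have "x \<noteq> 1"
    using assms jtheta_one[OF norm_power2_less_one[OF assms(1)]] by auto
  show ?thesis
  proof (rule K_c_entire[OF assms(1,2)])
    fix N :: "complex \<Rightarrow> complex"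
    assume *: "\<And>x. x \<noteq> 0 \<Longrightarrow> x \<noteq> 1 \<Longrightarrow> jtheta x (q\<^sup>2) \<noteq> 0 \<Longrightarrow>
       x / (x - 1) * K_c x q + (1 - 1 / (x * q)) * K1_c (x * q) q = jtheta (x * q\<^sup>2) (q\<^sup>2) / J 1 q"
    show ?thesis by (rule *) fact+
  qed
qed

theorem theorem2p9:
  fixes q x :: complex
  assumes "norm q < 1" and "q \<noteq> 0" and "x \<noteq> 0"
  shows
    "(x \<noteq> 1 \<and> K_c_defined x q \<and> K1_c_defined (x * q) q \<longrightarrow>
        x / (x - 1) * K_c x q + (1 - 1 / (x * q)) * K1_c (x * q) q
          = jtheta (x * q^2) (q^2) / J 1 q)
     \<and>
     (x \<noteq> 1 \<and> K_c_defined x q \<and> g2_c_defined (- (x * q)) (q^2)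
        \<and> jtheta (x^2 * q^2) (q^4) \<noteq> 0 \<and> jtheta (- (x^2 * q^4)) (q^4) \<noteq> 0
        \<and> jtheta (x * q) (q^2) \<noteq> 0 \<and> jtheta x q \<noteq> 0 \<longrightarrow>
        J 1 q * jtheta (- (x * q)) (q^2) / (x - 1) * K_c x q
          + 2 * q * J 4 q * jtheta x (q^2) / x * g2_c (- (x * q)) (q^2)
        = 2 * q * J 4 q ^ 5 * jtheta x (q^2)
            / (x * J 2 q ^ 2 * jtheta (x^2 * q^2) (q^4))
          - J 4 q ^ 11 * jtheta x (q^2) * jtheta (- (x^2 * q^2)) (q^4)
            / (x^2 * J 2 q ^ 4 * J 8 q ^ 4 * jtheta (x^2 * q^2) (q^4) * jtheta (- (x^2 * q^4)) (q^4))
          + J 4 q ^ 5 * jtheta x (q^2) * jtheta (- (x * q)) (q^2)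
            / (x^2 * J 8 q ^ 2 * jtheta (x * q) (q^2) * jtheta (- (x^2 * q^4)) (q^4))
          - J 1 q ^ 5 * jtheta (- (x * q)) (q^2) / (J 2 q ^ 2 * jtheta x q))
     \<and>
     (S2_c_defined (x^2) (q^2) \<and> g3_c_defined (x * q) (q^2)
        \<and> jtheta (x^2 * q^2) (q^4) \<noteq> 0 \<and> jtheta (- (x^2)) (q^4) \<noteq> 0
        \<and> jtheta (- (x^2)) (q^2) \<noteq> 0 \<and> jtheta (x * q) (q^2) \<noteq> 0 \<longrightarrow>
        2 * x * J 4 q ^ 2 * jtheta (x * q) (q^2) * S2_c (x^2) (q^2)
          - q * J 2 q ^ 2 * jtheta (x^2 * q^2) (q^4) * g3_c (x * q) (q^2)
        = x * J 4 q ^ 12 * jtheta (x * q) (q^2) * jtheta (- (x^2 * q^2)) (q^4)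
            / (J 2 q ^ 4 * J 8 q ^ 4 * jtheta (x^2 * q^2) (q^4) * jtheta (- (x^2)) (q^4))
          - x * J 2 q ^ 5 * jtheta (x^2 * q^2) (q^4) * jtheta (- (x * q)) (q^2) ^ 2
            / (2 * J 4 q ^ 2 * jtheta (- (x^2)) (q^2) * jtheta (x * q) (q^2))
          - x * J 2 q ^ 5 * jtheta (x * q) (q^2) * jtheta (x^2 * q^2) (q^4)
            / (2 * J 4 q ^ 2 * jtheta (- (x^2)) (q^2)))"
  using first_identity[OF assms K_c_defined_imp_jtheta_nonzero[OF assms(1)]]
    second_identity[OF assms] third_identity[OF assms] by blast

end
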